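(* Let $X$ be a normal pseudomanifold of dimension $d\geq 4$. Then $X$ is a stacked $d$-sphere if and only if $X\in \mathcal{K}(d)$ and the geometric realization $|X|$ is simply connected.
   Context: A simplicial complex is a finite set of finite sets closed under taking subsets; an element of size $i+1$ is an $i$-face (the empty set is the unique $(-1)$-face). A pure $d$-dimensional complex has all maximal faces (facets) of dimension $d$. The link of a face $\alpha$ is $\mathrm{lk}_X(\alpha)=\{\beta\in X:\beta\cap\alpha=\emptyset,\ \alpha\cup\beta\in X\}$. A $d$-dimensional normal pseudomanifold ($d\ge1$) is a pure $d$-dimensional simplicial complex in which every $(d-1)$-face lies in exactly two facets and the link of every face of dimension $\le d-2$ (including the empty face, whose link is $X$) is connected. The standard $d$-sphere $S^d_{d+2}$ is the complex of all proper subsets of a $(d+2)$-set. Starring a new vertex $v$ in a facet $\sigma$ of a pure $d$-dimensional complex replaces $\sigma$ by the facets $\tau\cup\{v\}$, $\tau$ a $(d-1)$-face of $\sigma$. A stacked $d$-sphere is a complex obtained from $S^d_{d+2}$ by finitely many such starrings. For $d\ge 2$, $\mathcal{K}(d)$ denotes the class of all $d$-dimensional normal pseudomanifolds in which the link of every vertex is a stacked $(d-1)$-sphere. *)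

theory Defs
  imports "HOL-Analysis.Analysis"
begin

text \<open>Abstract simplicial complexes on a vertex type 'a; faces are finite vertex sets.
  A face of cardinality i+1 has dimension i.\<close>

definition simplicial_complex :: "'a set set \<Rightarrow> bool" where
  "simplicial_complex X \<longleftrightarrow> finite X \<and> (\<forall>\<sigma>\<in>X. finite \<sigma>) \<and>
     (\<forall>\<sigma>\<in>X. \<forall>\<tau>. \<tau> \<subseteq> \<sigma> \<longrightarrow> \<tau> \<in> X)"

definition facets :: "'a set set \<Rightarrow> 'a set set" where
  "facets X = {\<sigma>\<in>X. \<forall>\<tau>\<in>X. \<sigma> \<subseteq> \<tau> \<longrightarrow> \<tau> = \<sigma>}"

text \<open>Pure d-dimensional: nonempty set of facets, all of dimension d.\<close>
definition pure :: "nat \<Rightarrow> 'a set set \<Rightarrow> bool" where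
  "pure d X \<longleftrightarrow> facets X \<noteq> {} \<and> (\<forall>\<sigma>\<in>facets X. card \<sigma> = d + 1)"

definition link :: "'a set set \<Rightarrow> 'a set \<Rightarrow> 'a set set" where
  "link X \<alpha> = {\<beta>\<in>X. \<beta> \<inter> \<alpha> = {} \<and> \<alpha> \<union> \<beta> \<in> X}"

text \<open>A complex is connected if its 1-skeleton (vertex graph) is connected.\<close>
definition complex_connected :: "'a set set \<Rightarrow> bool" where
  "complex_connected K \<longleftrightarrow>
     (\<forall>u\<in>\<Union>K. \<forall>v\<in>\<Union>K. (u, v) \<in> {(x, y). {x, y} \<in> K}\<^sup>*)"

definition normal_pseudomanifold :: "nat \<Rightarrow> 'a set set \<Rightarrow> bool" where
  "normal_pseudomanifold d X \<longleftrightarrow> d \<ge> 1 \<and> simplicial_complex X \<and> pure d X \<and>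
     (\<forall>\<tau>\<in>X. card \<tau> = d \<longrightarrow> card {\<sigma>\<in>facets X. \<tau> \<subseteq> \<sigma>} = 2) \<and>
     (\<forall>\<alpha>\<in>X. card \<alpha> \<le> d - 1 \<longrightarrow> complex_connected (link X \<alpha>))"

text \<open>Downward closure of a set of facets.\<close>
definition closure_cx :: "'a set set \<Rightarrow> 'a set set" where
  "closure_cx F = {\<tau>. \<exists>\<sigma>\<in>F. \<tau> \<subseteq> \<sigma>}"

text \<open>Starring a new vertex v in the facet \<sigma>.\<close>
definition star_in :: "'a set set \<Rightarrow> 'a set \<Rightarrow> 'a \<Rightarrow> 'a set set" where
  "star_in X \<sigma> v = closure_cx ((facets X - {\<sigma>}) \<union>
      {insert v \<tau> | \<tau>. \<tau> \<subseteq> \<sigma> \<and> card \<tau> = card \<sigma> - 1})"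

inductive stacked_sphere :: "nat \<Rightarrow> 'a set set \<Rightarrow> bool" for d :: nat where
  standard: "finite A \<Longrightarrow> card A = d + 2 \<Longrightarrow> stacked_sphere d {\<sigma>. \<sigma> \<subset> A}"
| starring: "stacked_sphere d X \<Longrightarrow> \<sigma> \<in> facets X \<Longrightarrow> v \<notin> \<Union>X \<Longrightarrow>
     stacked_sphere d (star_in X \<sigma> v)"

text \<open>The class K(d).\<close>
definition class_K :: "nat \<Rightarrow> 'a set set \<Rightarrow> bool" where
  "class_K d X \<longleftrightarrow> d \<ge> 2 \<and> normal_pseudomanifold d X \<and>
     (\<forall>v\<in>\<Union>X. stacked_sphere (d - 1) (link X {v}))"

text \<open>Geometric realization as a subspace of 'a \<Rightarrow> real (product topology).\<close>
definition geom_realization :: "'a set set \<Rightarrow> ('a \<Rightarrow> real) set" where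
  "geom_realization X = {f. \<exists>\<sigma>\<in>X. (\<forall>v. 0 \<le> f v) \<and> (\<forall>v. v \<notin> \<sigma> \<longrightarrow> f v = 0) \<and>
       (\<Sum>v\<in>\<sigma>. f v) = 1}"

end

theory Submission
  imports Defs
begin

text \<open>
  A stacked sphere has stacked vertex links, and starring a facet does not change the realization up
  to homeomorphism, so its realization is that of a simplex boundary, which is simply connected.

  Conversely, let all vertex links be stacked. As \<open>d \<ge> 4\<close>, a missing facet of the link of \<open>v\<close> together
  with \<open>v\<close> is a missing \<open>d\<close>-face \<open>\<sigma>\<close> of \<open>X\<close> whose boundary lies in \<open>X\<close>. At every vertex of \<open>\<sigma>\<close> the
  boundary of \<open>\<sigma>\<close> separates the link into two sides, and the sides can be chosen coherently. Counting
  crossings gives an integral 1-cocycle, i.e. a map from the realization to the circle; since that map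
  lifts, the cocycle is a coboundary, so the vertices of \<open>\<sigma>\<close> separate \<open>X\<close>. A missing \<open>d\<close>-face cutting
  off a minimal side shows that some vertex link is a simplex boundary; undoing a starring at
  that vertex gives a smaller complex of the same kind.
\<close>

section \<open>Stellar subdivision of facets and stacked spheres\<close>

text \<open>Simple connectivity is awkward to carry through an induction that removes vertices. It
  is used once, to show that integral 1-cocycles are coboundaries (\<open>cocycles_trivial\<close>).
  That condition passes to the smaller complex by pulling cocycles back along a simplicial map.
  Integers are the right coefficients because \<open>exp\<close> covers the punctured plane, so the
  lifting is done by a known covering space. In the same way \<open>locally_stacked\<close> replaces
  the pseudomanifold axioms: connected 1-skeleton and stacked vertex links are what removing a
  vertex visibly preserves. Links have dimension \<open>k = d - 1\<close>. Sides of a missing facet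
  are described by the 1-skeleton alone, which needs dimension at least 2, since only then does
  starring a facet delete no edge. Coherence compares sides inside links of edges, of dimension
  \<open>k - 1\<close>, hence \<open>k \<ge> 3\<close>. The same bound makes three vertices a proper
  subset of a missing facet of a link, so that this facet can be recognised as a face of
  \<open>X\<close>.\<close>

definition uniform_complex :: "nat \<Rightarrow> 'a set set \<Rightarrow> bool" where
  "uniform_complex k X \<longleftrightarrow> simplicial_complex X \<and>
     (\<forall>\<tau>\<in>X. card \<tau> \<le> k + 1 \<and> (\<exists>\<sigma>\<in>X. \<tau> \<subseteq> \<sigma> \<and> card \<sigma> = k + 1))"

text \<open>The operation of \<open>star_in\<close>, given face by face instead of as a closure of
  facets. For a new \<open>v\<close>, membership is then decided by whether \<open>v\<close> lies in
  the face (\<open>mem_stellar_iff\<close>).\<close>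

definition stellar :: "'a set set \<Rightarrow> 'a set \<Rightarrow> 'a \<Rightarrow> 'a set set" where
  "stellar X \<rho> v = (X - {\<rho>}) \<union> insert v ` {\<tau>. \<tau> \<subset> \<rho>}"

lemma stellarE:
  assumes "\<tau> \<in> stellar X \<rho> v"
  obtains "\<tau> \<in> X" "\<tau> \<noteq> \<rho>" | \<tau>' where "\<tau>' \<subset> \<rho>" "\<tau> = insert v \<tau>'"
proof -
  have "\<tau> \<in> X - {\<rho>} \<or> \<tau> \<in> insert v ` {\<tau>. \<tau> \<subset> \<rho>}"
    using assms unfolding stellar_def by (rule UnE) blast+
  then show ?thesis
    by (elim disjE imageE DiffE) (use that in simp_all)
qed

lemma stellarI:
  shows "\<tau> \<in> X \<Longrightarrow> \<tau> \<noteq> \<rho> \<Longrightarrow> \<tau> \<in> stellar X \<rho> v"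
    and "\<tau> \<subset> \<rho> \<Longrightarrow> insert v \<tau> \<in> stellar X \<rho> v"
  unfolding stellar_def by simp_all

lemma simplicial_complexD:
  assumes "simplicial_complex X"
  shows "finite X" "\<sigma> \<in> X \<Longrightarrow> finite \<sigma>" "\<sigma> \<in> X \<Longrightarrow> \<tau> \<subseteq> \<sigma> \<Longrightarrow> \<tau> \<in> X"
  using assms unfolding simplicial_complex_def by blast+

lemma finite_vertices: "simplicial_complex X \<Longrightarrow> finite (\<Union>X)"
  unfolding simplicial_complex_def by blast

lemma vertex_iff: "simplicial_complex X \<Longrightarrow> v \<in> \<Union>X \<longleftrightarrow> {v} \<in> X"
  unfolding simplicial_complex_def by (metis UnionE UnionI empty_subsetI insert_subset singletonI)

text \<open>Maximality becomes a matter of size, so a face kept by a modification remains a facet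
  without a new maximality check.\<close>

lemma facets_uniform:
  assumes "uniform_complex k X"
  shows "facets X = {\<sigma>\<in>X. card \<sigma> = k + 1}"
proof -
  have "\<sigma> = \<tau>" if "\<sigma> \<in> X" "card \<sigma> = k + 1" "\<tau> \<in> X" "\<sigma> \<subseteq> \<tau>" for \<sigma> \<tau>
  proof -
    have "finite \<tau>" "card \<tau> \<le> k + 1"
      using assms that unfolding uniform_complex_def simplicial_complex_def by blast+
    then show ?thesis
      using that by (simp add: card_seteq)
  qed
  moreover have "\<exists>\<sigma>\<in>X. \<tau> \<subseteq> \<sigma> \<and> card \<sigma> = k + 1" if "\<tau> \<in> X" for \<tau>
    using assms that unfolding uniform_complex_def by blast
  ultimately show ?thesis
    unfolding facets_def by fastforce
qed

text \<open>A face not inside \<open>\<rho>\<close> extends by uniformity to a facet other than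
  \<open>\<rho>\<close> and so survives. A proper face of \<open>\<rho>\<close> survives below one
  of the new facets through \<open>v\<close>.\<close>

lemma star_in_eq_stellar:
  assumes X: "uniform_complex k X" and \<rho>: "\<rho> \<in> facets X" and v: "v \<notin> \<Union>X"
  shows "star_in X \<rho> v = stellar X \<rho> v"
proof
  have sc: "simplicial_complex X"
    using X unfolding uniform_complex_def by blast
  have c: "\<rho> \<in> X" "card \<rho> = k + 1"
    using \<rho> unfolding facets_uniform[OF X] by auto
  have fin: "finite \<rho>"
    using sc c(1) by (rule simplicial_complexD(2))
  have sub: "\<tau> \<in> X" if "\<tau> \<subseteq> \<sigma>" "\<sigma> \<in> X" for \<tau> \<sigma>
    using that sc unfolding simplicial_complex_def by blast
  have max: "\<sigma> = \<rho>" if "\<sigma> \<in> X" "\<rho> \<subseteq> \<sigma>" for \<sigma>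
    using \<rho> that unfolding facets_def by blast
  show "star_in X \<rho> v \<subseteq> stellar X \<rho> v"
  proof
    fix \<tau> assume "\<tau> \<in> star_in X \<rho> v"
    then consider \<sigma> where "\<sigma> \<in> facets X" "\<sigma> \<noteq> \<rho>" "\<tau> \<subseteq> \<sigma>"
      | \<sigma> where "\<sigma> \<subseteq> \<rho>" "card \<sigma> = card \<rho> - 1" "\<tau> \<subseteq> insert v \<sigma>"
      unfolding star_in_def closure_cx_def by auto
    then show "\<tau> \<in> stellar X \<rho> v"
    proof cases
      case 1
      then have "\<sigma> \<in> X" unfolding facets_def by blast
      with 1 have "\<tau> \<in> X" "\<tau> \<noteq> \<rho>" using sub max by auto
      then show ?thesis by (rule stellarI(1))
    next
      case 2
      then have ps: "\<sigma> \<subset> \<rho>" using c by auto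
      show ?thesis
      proof (cases "v \<in> \<tau>")
        case True
        then have "\<tau> = insert v (\<tau> - {v})" "\<tau> - {v} \<subset> \<rho>" using ps 2 by auto
        then show ?thesis using stellarI(2)[of "\<tau> - {v}" \<rho> v X] by simp
      next
        case False
        then have "\<tau> \<subset> \<rho>" using ps 2 by auto
        then show ?thesis by (intro stellarI(1)) (use sub[OF _ c(1)] in auto)
      qed
    qed
  qed
  show "stellar X \<rho> v \<subseteq> star_in X \<rho> v"
  proof
    fix \<tau> assume "\<tau> \<in> stellar X \<rho> v"
    then consider \<tau>' where "\<tau>' \<subset> \<rho>" "\<tau> \<subseteq> insert v \<tau>'" | "\<tau> \<in> X" "\<not> \<tau> \<subseteq> \<rho>"
      by (cases rule: stellarE) (metis order.order_iff_strict subset_insertI2, metis order_refl)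
    then show "\<tau> \<in> star_in X \<rho> v"
    proof cases
      case 1
      then obtain x where "x \<in> \<rho>" "\<tau>' \<subseteq> \<rho> - {x}"
        by blast
      then have "\<tau> \<subseteq> insert v (\<rho> - {x})" "\<rho> - {x} \<subseteq> \<rho>" "card (\<rho> - {x}) = card \<rho> - 1"
        using 1 fin by auto
      then show ?thesis unfolding star_in_def closure_cx_def by blast
    next
      case 2
      then obtain \<sigma> where "\<sigma> \<in> X" "\<tau> \<subseteq> \<sigma>" "card \<sigma> = k + 1"
        using X unfolding uniform_complex_def by blast
      then have "\<sigma> \<in> facets X" "\<sigma> \<noteq> \<rho>"
        using facets_uniform[OF X] 2 by auto
      with \<open>\<tau> \<subseteq> \<sigma>\<close> show ?thesis unfolding star_in_def closure_cx_def by blast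
    qed
  qed
qed

text \<open>Since \<open>\<rho>\<close> is maximal, no other face contains it, and deleting it alone
  keeps the family closed under subsets.\<close>

lemma simplicial_complex_stellar:
  assumes X: "simplicial_complex X" and \<rho>: "\<rho> \<in> facets X"
  shows "simplicial_complex (stellar X \<rho> v)"
proof -
  have \<rho>X: "\<rho> \<in> X" and max: "\<And>\<sigma>. \<sigma> \<in> X \<Longrightarrow> \<rho> \<subseteq> \<sigma> \<Longrightarrow> \<sigma> = \<rho>"
    using \<rho> unfolding facets_def by blast+
  have fin: "finite \<rho>" using X \<rho>X by (rule simplicial_complexD(2))
  have "finite {\<tau>. \<tau> \<subset> \<rho>}"
    by (rule finite_subset[of _ "Pow \<rho>"]) (use fin in auto)
  then have "finite (stellar X \<rho> v)"
    using simplicial_complexD(1)[OF X] unfolding stellar_def by (intro finite_UnI finite_Diff finite_imageI)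
  moreover have "finite \<sigma>" if "\<sigma> \<in> stellar X \<rho> v" for \<sigma>
  proof -
    have "\<sigma> \<in> X \<or> \<sigma> \<subseteq> insert v \<rho>" using that by (cases rule: stellarE) auto
    then show ?thesis using simplicial_complexD(2)[OF X] fin finite_subset[of \<sigma> "insert v \<rho>"] by auto
  qed
  moreover have "\<tau> \<in> stellar X \<rho> v" if "\<sigma> \<in> stellar X \<rho> v" "\<tau> \<subseteq> \<sigma>" for \<sigma> \<tau>
  proof -
    from that(1) show ?thesis
    proof (cases rule: stellarE)
      case 1
      then have "\<tau> \<in> X" "\<tau> \<noteq> \<rho>" using simplicial_complexD(3)[OF X] that max by blast+
      then show ?thesis by (rule stellarI(1))
    next
      case 2
      show ?thesis
      proof (cases "v \<in> \<tau>")
        case True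
        then have "\<tau> = insert v (\<tau> - {v})" "\<tau> - {v} \<subset> \<rho>" using 2(1) that(2)[unfolded 2(2)] by auto
        then show ?thesis using stellarI(2)[of "\<tau> - {v}" \<rho> v X] by simp
      next
        case False
        then have "\<tau> \<subset> \<rho>" using 2(1) that(2)[unfolded 2(2)] by auto
        then show ?thesis by (intro stellarI(1)) (use simplicial_complexD(3)[OF X \<rho>X] in auto)
      qed
    qed
  qed
  ultimately show ?thesis unfolding simplicial_complex_def by blast
qed

lemma uniform_stellar:
  assumes X: "uniform_complex k X" and \<rho>: "\<rho> \<in> facets X" and v: "v \<notin> \<Union>X"
  shows "uniform_complex k (stellar X \<rho> v)"
proof -
  have sc: "simplicial_complex X"
    using X unfolding uniform_complex_def by blast
  have c: "\<rho> \<in> X" "card \<rho> = k + 1"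
    using \<rho> unfolding facets_uniform[OF X] by auto
  have fin: "finite \<rho>"
    using sc c(1) by (rule simplicial_complexD(2))
  have cone: "\<exists>\<sigma>\<in>stellar X \<rho> v. \<tau> \<subseteq> \<sigma> \<and> card \<sigma> = k + 1" if sub: "\<tau>' \<subset> \<rho>" "\<tau> \<subseteq> insert v \<tau>'" for \<tau> \<tau>'
  proof -
    obtain x where x: "x \<in> \<rho>" "\<tau>' \<subseteq> \<rho> - {x}"
      using sub(1) by blast
    moreover have "v \<notin> \<rho>" using v c by blast
    ultimately have "card (insert v (\<rho> - {x})) = k + 1" "\<tau> \<subseteq> insert v (\<rho> - {x})"
      "insert v (\<rho> - {x}) \<in> stellar X \<rho> v"
      using c fin sub by (auto intro: stellarI(2))
    then show ?thesis by blast
  qed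
  have "card \<tau> \<le> k + 1 \<and> (\<exists>\<sigma>\<in>stellar X \<rho> v. \<tau> \<subseteq> \<sigma> \<and> card \<sigma> = k + 1)" if \<tau>: "\<tau> \<in> stellar X \<rho> v" for \<tau>
  proof -
    consider \<tau>' where "\<tau>' \<subset> \<rho>" "\<tau> \<subseteq> insert v \<tau>'" | "\<tau> \<in> X" "\<not> \<tau> \<subseteq> \<rho>"
      using \<tau> by (cases rule: stellarE) (metis order.order_iff_strict subset_insertI2, metis order_refl)
    then show ?thesis
    proof cases
      case 1
      then have "card \<tau>' < k + 1" using c fin by (metis psubset_card_mono)
      moreover have "finite \<tau>'" using 1 fin by (meson finite_subset psubset_imp_subset)
      moreover have "card \<tau> \<le> card (insert v \<tau>')" using 1 \<open>finite \<tau>'\<close> by (simp add: card_mono)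
      ultimately have "card \<tau> \<le> k + 1" by (simp add: card_insert_if split: if_splits)
      then show ?thesis using cone 1 by blast
    next
      case 2
      then obtain \<sigma> where \<sigma>: "\<sigma> \<in> X" "\<tau> \<subseteq> \<sigma>" "card \<sigma> = k + 1" and "card \<tau> \<le> k + 1"
        using X unfolding uniform_complex_def by blast
      moreover have "\<sigma> \<in> stellar X \<rho> v" using \<sigma> 2 by (intro stellarI(1)) auto
      ultimately show ?thesis by blast
    qed
  qed
  then show ?thesis
    using simplicial_complex_stellar[OF sc \<rho>] by (simp add: uniform_complex_def)
qed

lemma uniform_standard:
  assumes "finite A" "card A = k + 2"
  shows "uniform_complex k {\<sigma>. \<sigma> \<subset> A}"
proof -
  have "finite {\<sigma>. \<sigma> \<subset> A}"
    by (rule finite_subset[of _ "Pow A"]) (use assms in auto)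
  moreover have "finite \<sigma>" if "\<sigma> \<subset> A" for \<sigma>
    using that assms(1) finite_subset by blast
  ultimately have "simplicial_complex {\<sigma>. \<sigma> \<subset> A}"
    unfolding simplicial_complex_def by auto
  moreover have "card \<tau> \<le> k + 1 \<and> (\<exists>\<sigma>\<in>{\<sigma>. \<sigma> \<subset> A}. \<tau> \<subseteq> \<sigma> \<and> card \<sigma> = k + 1)" if sub: "\<tau> \<subset> A" for \<tau>
  proof -
    obtain x where "x \<in> A" "\<tau> \<subseteq> A - {x}" using sub by blast
    moreover have "card (A - {x}) = k + 1" using assms \<open>x \<in> A\<close> by simp
    moreover have "card \<tau> < k + 2" using sub assms by (metis psubset_card_mono)
    ultimately show ?thesis by (intro conjI bexI[of _ "A - {x}"]) auto
  qed
  ultimately show ?thesis unfolding uniform_complex_def by blast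
qed

lemma stacked_uniform: "stacked_sphere k X \<Longrightarrow> uniform_complex k X"
proof (induction rule: stacked_sphere.induct)
  case (standard A)
  then show ?case by (rule uniform_standard)
next
  case (starring X \<sigma> v)
  then show ?case using uniform_stellar star_in_eq_stellar by metis
qed

lemma stacked_complex: "stacked_sphere k X \<Longrightarrow> simplicial_complex X"
  using stacked_uniform unfolding uniform_complex_def by blast

lemma stacked_facetD:
  assumes "stacked_sphere k X" "\<sigma> \<in> facets X"
  shows "\<sigma> \<in> X" "card \<sigma> = k + 1" "finite \<sigma>" "\<tau> \<subseteq> \<sigma> \<Longrightarrow> \<tau> \<in> X"
  using assms facets_uniform[OF stacked_uniform[OF assms(1)]] stacked_complex[OF assms(1)]
  by (auto dest: simplicial_complexD(2,3))

lemma stacked_stellar: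
  assumes "stacked_sphere k X" "\<rho> \<in> facets X" "v \<notin> \<Union>X"
  shows "stacked_sphere k (stellar X \<rho> v)"
  using stacked_sphere.starring[OF assms] star_in_eq_stellar[OF stacked_uniform] assms by metis

lemma stacked_induct [consumes 1, case_names standard stellar]:
  assumes "stacked_sphere k X"
    and "\<And>A. finite A \<Longrightarrow> card A = k + 2 \<Longrightarrow> P {\<sigma>. \<sigma> \<subset> A}"
    and "\<And>X \<rho> v. stacked_sphere k X \<Longrightarrow> P X \<Longrightarrow> \<rho> \<in> facets X \<Longrightarrow> v \<notin> \<Union>X \<Longrightarrow> P (stellar X \<rho> v)"
  shows "P X"
  using assms(1)
proof (induction rule: stacked_sphere.induct)
  case (standard A)
  then show ?case by (rule assms(2))
next
  case (starring X \<sigma> v)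
  then show ?case using assms(3) star_in_eq_stellar[OF stacked_uniform] by metis
qed

lemma stacked_cases [consumes 1, case_names standard stellar]:
  assumes "stacked_sphere k X"
  obtains A where "finite A" "card A = k + 2" "X = {\<sigma>. \<sigma> \<subset> A}"
  | Y \<rho> v where "stacked_sphere k Y" "\<rho> \<in> facets Y" "v \<notin> \<Union>Y" "X = stellar Y \<rho> v"
  using assms
proof cases
  case (standard A)
  then show ?thesis using that by blast
next
  case (starring Y \<sigma> v)
  then show ?thesis using that star_in_eq_stellar[OF stacked_uniform] by metis
qed

lemma Union_psubsets: "finite A \<Longrightarrow> card A \<ge> 2 \<Longrightarrow> \<Union>{\<sigma>. \<sigma> \<subset> A} = A"
proof -
  assume A: "finite A" "card A \<ge> 2"
  have "{x} \<subset> A" if "x \<in> A" for x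
    using that A by (metis card.empty card.insert empty_iff empty_subsetI finite.emptyI insert_subset
        not_less_eq_eq numeral_2_eq_2 One_nat_def psubsetI order_refl)
  then show ?thesis by blast
qed

text \<open>The bound on \<open>card \<rho>\<close> matters: starring a facet that is a single
  vertex would delete that vertex.\<close>

lemma Union_stellar:
  assumes "\<rho> \<in> X" "card \<rho> \<ge> 2" "simplicial_complex X"
  shows "\<Union>(stellar X \<rho> v) = insert v (\<Union>X)"
proof -
  have "finite \<rho>" using assms by (auto dest: simplicial_complexD(2,3))
  then have U: "\<Union>{\<sigma>. \<sigma> \<subset> \<rho>} = \<rho>" using Union_psubsets assms by blast
  have "{\<tau>. \<tau> \<subset> \<rho>} \<subseteq> X - {\<rho>}" using assms by (auto dest: simplicial_complexD(2,3))
  then have "\<Union>(X - {\<rho>}) \<union> \<rho> = \<Union>(X - {\<rho>})" using U by blast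
  moreover have "\<Union>(insert v ` {\<tau>. \<tau> \<subset> \<rho>}) = insert v \<rho>"
  proof -
    have "{} \<subset> \<rho>" using assms(2) by auto
    then have "\<Union>(insert v ` {\<tau>. \<tau> \<subset> \<rho>}) = insert v (\<Union>{\<tau>. \<tau> \<subset> \<rho>})"
      by (intro set_eqI) (auto simp del: psubset_eq)
    then show ?thesis using U by simp
  qed
  ultimately have "\<Union>(stellar X \<rho> v) = \<Union>(X - {\<rho>}) \<union> insert v \<rho>"
    unfolding stellar_def by (metis Union_Un_distrib)
  moreover have "\<Union>X = \<Union>(X - {\<rho>}) \<union> \<rho>" using assms(1) by blast
  ultimately show ?thesis by simp
qed

lemma stacked_card_vertices: "stacked_sphere k X \<Longrightarrow> k \<ge> 1 \<Longrightarrow> card (\<Union>X) \<ge> k + 2"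
proof (induction rule: stacked_induct)
  case (standard A)
  then show ?case by (simp add: Union_psubsets)
next
  case (stellar X \<rho> v)
  then have "\<Union>(stellar X \<rho> v) = insert v (\<Union>X)"
    using Union_stellar stacked_facetD stacked_complex by (metis Suc_1 Suc_eq_plus1 add_le_mono1 one_add_one)
  then show ?case using stellar finite_vertices[OF stacked_complex] by fastforce
qed

section \<open>Vertex links after a starring\<close>

lemma mem_stellar_iff:
  assumes "v \<notin> \<Union>X" "\<rho> \<in> X"
  shows "\<tau> \<in> stellar X \<rho> v \<longleftrightarrow> (if v \<in> \<tau> then \<tau> - {v} \<subset> \<rho> else \<tau> \<in> X \<and> \<tau> \<noteq> \<rho>)"
proof (cases "v \<in> \<tau>")
  case True
  have "\<tau> - {v} \<subset> \<rho>" if "\<tau> \<in> stellar X \<rho> v"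
    using that
  proof (cases rule: stellarE)
    case 1
    then show ?thesis using True assms(1) by blast
  next
    case (2 \<tau>')
    then have "v \<notin> \<tau>'" using assms by blast
    then show ?thesis using 2 by simp
  qed
  moreover have "\<tau> \<in> stellar X \<rho> v" if "\<tau> - {v} \<subset> \<rho>"
    using stellarI(2)[OF that, of v X] True by (simp add: insert_absorb)
  ultimately show ?thesis using True by auto
next
  case False
  then have "\<tau> \<notin> insert v ` {\<tau>. \<tau> \<subset> \<rho>}" by blast
  then show ?thesis using False unfolding stellar_def by simp
qed

lemma mem_link_vertex: "simplicial_complex X \<Longrightarrow> \<tau> \<in> link X {v} \<longleftrightarrow> v \<notin> \<tau> \<and> insert v \<tau> \<in> X"
  unfolding link_def by (auto dest: simplicial_complexD(2,3))

lemma link_complex: "simplicial_complex X \<Longrightarrow> simplicial_complex (link X {v})"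
  unfolding simplicial_complex_def link_def 
  by (intro conjI ballI allI impI) (auto, metis insert_mono)

lemma mem_link_stellar:
  assumes "simplicial_complex X" "\<rho> \<in> facets X" "v \<notin> \<Union>X"
  shows "\<tau> \<in> link (stellar X \<rho> v) {u} \<longleftrightarrow>
    u \<notin> \<tau> \<and> (if v \<in> insert u \<tau> then insert u \<tau> - {v} \<subset> \<rho> else insert u \<tau> \<in> X \<and> insert u \<tau> \<noteq> \<rho>)"
proof -
  have "\<rho> \<in> X" using assms(2) unfolding facets_def by blast
  then show ?thesis
    using mem_link_vertex[OF simplicial_complex_stellar[OF assms(1,2)]] mem_stellar_iff[OF assms(3)] by simp
qed

lemma link_stellar_apex:
  assumes "simplicial_complex X" "\<rho> \<in> facets X" "v \<notin> \<Union>X"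
  shows "link (stellar X \<rho> v) {v} = {\<sigma>. \<sigma> \<subset> \<rho>}"
proof (intro set_eqI)
  fix \<tau>
  have "v \<notin> \<rho>" using assms unfolding facets_def by blast
  then show "\<tau> \<in> link (stellar X \<rho> v) {v} \<longleftrightarrow> \<tau> \<in> {\<sigma>. \<sigma> \<subset> \<rho>}"
    unfolding mem_link_stellar[OF assms] by auto
qed

lemma link_stellar_off:
  assumes "simplicial_complex X" "\<rho> \<in> facets X" "v \<notin> \<Union>X" "u \<noteq> v" "u \<notin> \<rho>"
  shows "link (stellar X \<rho> v) {u} = link X {u}"
proof (intro set_eqI)
  fix \<tau>
  show "\<tau> \<in> link (stellar X \<rho> v) {u} \<longleftrightarrow> \<tau> \<in> link X {u}"
    unfolding mem_link_stellar[OF assms(1-3)] mem_link_vertex[OF assms(1)] using assms(3-5) by auto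
qed

lemma link_stellar_on:
  assumes "simplicial_complex X" "\<rho> \<in> facets X" "v \<notin> \<Union>X" "u \<in> \<rho>"
  shows "link (stellar X \<rho> v) {u} = stellar (link X {u}) (\<rho> - {u}) v"
proof (intro set_eqI)
  fix \<tau>
  have \<rho>: "\<rho> \<in> X" and uv: "u \<noteq> v" using assms unfolding facets_def by blast+
  have in_l: "\<rho> - {u} \<in> link X {u}" using assms(4) \<rho> mem_link_vertex[OF assms(1)] by (simp add: insert_absorb)
  have v': "v \<notin> \<Union>(link X {u})" using assms(3) unfolding link_def by blast
  show "\<tau> \<in> link (stellar X \<rho> v) {u} \<longleftrightarrow> \<tau> \<in> stellar (link X {u}) (\<rho> - {u}) v"
    unfolding mem_link_stellar[OF assms(1-3)] mem_stellar_iff[OF v' in_l] mem_link_vertex[OF assms(1)]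
    using assms(3,4) uv by auto
qed

text \<open>Starring in \<open>\<rho>\<close> acts on links by starrings too: the new vertex gets
  the boundary of \<open>\<rho>\<close>, a vertex \<open>u\<close> of \<open>\<rho>\<close> has its
  link starred in \<open>\<rho> - {u}\<close>, and all other links stay.\<close>

lemma stacked_vertex_link:
  assumes "stacked_sphere (Suc k) X" "u \<in> \<Union>X"
  shows "stacked_sphere k (link X {u})"
  using assms
proof (induction rule: stacked_induct)
  case (standard A)
  then have u: "u \<in> A" by auto
  have "link {\<sigma>. \<sigma> \<subset> A} {u} = {\<sigma>. \<sigma> \<subset> A - {u}}"
    using u unfolding link_def by auto
  moreover have "card (A - {u}) = k + 2" using standard u by simp
  ultimately show ?case using stacked_sphere.standard standard by (metis finite_Diff)
next
  case (stellar X \<rho> v)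
  note F = stacked_facetD[OF stellar.hyps(1,2)]
  have sc: "simplicial_complex X" using stellar.hyps(1) by (rule stacked_complex)
  note H = sc stellar.hyps(2,3)
  have Us: "\<Union>(stellar X \<rho> v) = insert v (\<Union>X)"
    by (rule Union_stellar[OF F(1) _ sc]) (use F(2) in simp)
  consider "u = v" | "u \<noteq> v" "u \<notin> \<rho>" | "u \<noteq> v" "u \<in> \<rho>" by blast
  then show ?case
  proof cases
    case 1
    then show ?thesis
      using link_stellar_apex[OF H] stacked_sphere.standard[of \<rho> k] F by simp
  next
    case 2
    then have uX: "u \<in> \<Union>X" using stellar.prems Us by simp
    show ?thesis using stellar.IH[OF uX] link_stellar_off[OF H 2] by simp
  next
    case 3
    then have uX: "u \<in> \<Union>X" using stellar.prems Us by simp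
    have st: "stacked_sphere k (link X {u})" using stellar.IH[OF uX] .
    have in_l: "\<rho> - {u} \<in> link X {u}" using 3 F mem_link_vertex[OF sc] by (simp add: insert_absorb)
    have f: "\<rho> - {u} \<in> facets (link X {u})"
      unfolding facets_uniform[OF stacked_uniform[OF st]] using in_l F 3 by simp
    have v': "v \<notin> \<Union>(link X {u})" using stellar.hyps(3) unfolding link_def by blast
    show ?thesis using stacked_stellar[OF st f v'] link_stellar_on[OF H 3(2)] by simp
  qed
qed

section \<open>Connectivity and missing faces in stacked spheres\<close>

text \<open>Connectivity of the graph on \<open>W\<close>, phrased by subsets closed under edges
  instead of paths, so that applying it amounts to exhibiting a closed set. The empty
  \<open>W\<close> counts as connected.\<close>

definition induces_connected :: "'a set set \<Rightarrow> 'a set \<Rightarrow> bool" where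
  "induces_connected X W \<longleftrightarrow>
     (\<forall>C. C \<subseteq> W \<longrightarrow> C \<noteq> {} \<longrightarrow> (\<forall>x\<in>C. \<forall>y\<in>W. {x, y} \<in> X \<longrightarrow> y \<in> C) \<longrightarrow> C = W)"

definition missing_face :: "'a set set \<Rightarrow> 'a set \<Rightarrow> bool" where
  "missing_face X \<tau> \<longleftrightarrow> finite \<tau> \<and> \<tau> \<notin> X \<and> (\<forall>\<sigma>. \<sigma> \<subset> \<tau> \<longrightarrow> \<sigma> \<in> X)"

lemma induces_connectedD:
  assumes "induces_connected X W" "C \<subseteq> W" "x \<in> C" "\<And>x y. x \<in> C \<Longrightarrow> y \<in> W \<Longrightarrow> {x, y} \<in> X \<Longrightarrow> y \<in> C"
  shows "C = W"
  using assms unfolding induces_connected_def by blast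

lemma clique_induces_connected:
  "(\<And>x y. x \<in> W \<Longrightarrow> y \<in> W \<Longrightarrow> {x, y} \<in> X) \<Longrightarrow> induces_connected X W"
  unfolding induces_connected_def by blast

lemma induces_connected_mono:
  "induces_connected X W \<Longrightarrow> (\<And>x y. x \<in> W \<Longrightarrow> y \<in> W \<Longrightarrow> {x, y} \<in> X \<Longrightarrow> {x, y} \<in> Y) \<Longrightarrow> induces_connected Y W"
  unfolding induces_connected_def by (meson subsetD)

lemma induces_connected_insert:
  assumes W: "induces_connected X W" and w: "w \<in> W" "{w, v} \<in> X"
  shows "induces_connected X (insert v W)"
  unfolding induces_connected_def
proof (intro allI impI)
  fix C assume C: "C \<subseteq> insert v W" "C \<noteq> {}" and cl: "\<forall>x\<in>C. \<forall>y\<in>insert v W. {x, y} \<in> X \<longrightarrow> y \<in> C"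
  have "w \<in> C"
  proof (cases "C \<inter> W = {}")
    case True
    then have "v \<in> C" using C by blast
    moreover have "{v, w} \<in> X" using w by (simp add: insert_commute)
    ultimately show ?thesis using cl w by blast
  next
    case False
    then obtain x where "x \<in> C \<inter> W" by blast
    then have "C \<inter> W = W" using cl by (intro induces_connectedD[OF W]) auto
    then show ?thesis using w by blast
  qed
  moreover have "C \<inter> W = W" 
    using cl \<open>w \<in> C\<close> w by (intro induces_connectedD[OF W, of _ w]) auto
  ultimately show "C = insert v W" using C cl w by blast
qed

lemma stellar_small:
  assumes "\<tau> \<in> X" "card \<tau> < card \<rho>"
  shows "\<tau> \<in> stellar X \<rho> v"
  using assms by (intro stellarI(1)) auto

lemma edge_stellar: "{x, y} \<in> X \<Longrightarrow> card \<rho> \<ge> 3 \<Longrightarrow> {x, y} \<in> stellar X \<rho> v"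
  by (rule stellar_small) (auto simp: card_insert_if)

text \<open>For \<open>k \<ge> 2\<close> a starring deletes no edge, so only the new vertex has to
  be attached. A face \<open>\<sigma>\<close> other than the facet \<open>\<rho>\<close> misses some
  vertex of \<open>\<rho>\<close>, and \<open>v\<close> is adjacent to it.\<close>

lemma stacked_avoid_connected:
  assumes "stacked_sphere k X" "k \<ge> 2" "\<sigma> \<in> X"
  shows "induces_connected X (\<Union>X - \<sigma>)"
  using assms
proof (induction arbitrary: \<sigma> rule: stacked_induct)
  case (standard A)
  show ?case
  proof (rule clique_induces_connected)
    fix x y assume "x \<in> \<Union> {\<sigma>. \<sigma> \<subset> A} - \<sigma>" "y \<in> \<Union> {\<sigma>. \<sigma> \<subset> A} - \<sigma>"
    then have "{x, y} \<subseteq> A" by auto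
    moreover have "card {x, y} < card A" using standard by (auto simp: card_insert_if)
    ultimately show "{x, y} \<in> {\<sigma>. \<sigma> \<subset> A}" by auto
  qed
next
  case (stellar X \<rho> v)
  note F = stacked_facetD[OF stellar.hyps(1,2)]
  have sc: "simplicial_complex X" using stellar.hyps(1) by (rule stacked_complex)
  have \<rho>3: "card \<rho> \<ge> 3" using F stellar.prems by simp
  have Us: "\<Union>(stellar X \<rho> v) = insert v (\<Union>X)"
    by (rule Union_stellar[OF F(1) _ sc]) (use \<rho>3 in simp)
  note ms = mem_stellar_iff[OF stellar.hyps(3) F(1)]
  show ?case
  proof (cases "v \<in> \<sigma>")
    case True
    then have "\<sigma> - {v} \<in> X" using stellar.prems(2) F(4) ms by auto
    then have "induces_connected X (\<Union>X - (\<sigma> - {v}))" using stellar.IH stellar.prems by blast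
    then have "induces_connected (stellar X \<rho> v) (\<Union>X - (\<sigma> - {v}))"
      by (rule induces_connected_mono) (rule edge_stellar[OF _ \<rho>3])
    moreover have "\<Union>X - (\<sigma> - {v}) = insert v (\<Union>X) - \<sigma>" using stellar.hyps(3) True by blast
    ultimately show ?thesis using Us by simp
  next
    case False
    then have \<sigma>: "\<sigma> \<in> X" "\<sigma> \<noteq> \<rho>" using stellar.prems(2) ms by auto
    then have "induces_connected X (\<Union>X - \<sigma>)" using stellar.IH stellar.prems by blast
    then have c: "induces_connected (stellar X \<rho> v) (\<Union>X - \<sigma>)"
      by (rule induces_connected_mono) (rule edge_stellar[OF _ \<rho>3])
    obtain s where s: "s \<in> \<rho>" "s \<notin> \<sigma>"
      using \<sigma> stellar.hyps(2) unfolding facets_def by blast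
    have "{s} \<subset> \<rho>" using s \<rho>3 by auto
    then have "{s, v} \<in> stellar X \<rho> v" using stellarI(2)[of "{s}" \<rho> v X] by (simp add: insert_commute)
    then have "induces_connected (stellar X \<rho> v) (insert v (\<Union>X - \<sigma>))"
      using s F(1) by (intro induces_connected_insert[OF c]) auto
    then show ?thesis using Us False by (simp add: insert_Diff_if)
  qed
qed

text \<open>The facet across the ridge \<open>\<sigma> - {t}\<close>; it supplies the ridge clauses
  of \<open>splits\<close> for the side away from a new vertex.\<close>

lemma stacked_ridge:
  assumes "stacked_sphere k X" "\<sigma> \<in> facets X" "t \<in> \<sigma>"
  shows "\<exists>x\<in>\<Union>X - \<sigma>. insert x (\<sigma> - {t}) \<in> X"
proof -
  have "\<exists>x. x \<notin> \<sigma> \<and> insert x (\<sigma> - {t}) \<in> X"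
    using assms
  proof (induction arbitrary: \<sigma> t rule: stacked_induct)
    case (standard A)
    then have "\<sigma> \<subset> A" "card \<sigma> = k + 1"
      using facets_uniform[OF uniform_standard[OF standard(1,2)]] by auto
    moreover have "finite \<sigma>" using \<open>\<sigma> \<subset> A\<close> standard(1) by (meson finite_subset psubset_imp_subset)
    ultimately have "card (A - \<sigma>) = 1" using standard by (simp add: card_Diff_subset psubset_imp_subset)
    then obtain a where a: "A - \<sigma> = {a}" using card_1_singletonE by blast
    then have "insert a (\<sigma> - {t}) \<subset> A" using \<open>\<sigma> \<subset> A\<close> standard(4) by blast
    then show ?case using a by auto
  next
    case (stellar X \<rho> v)
    note F = stacked_facetD[OF stellar.hyps(1,2)]
    note ms = mem_stellar_iff[OF stellar.hyps(3) F(1)]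
    have \<sigma>: "\<sigma> \<in> stellar X \<rho> v" "card \<sigma> = k + 1"
      using stellar.prems facets_uniform[OF uniform_stellar[OF stacked_uniform[OF stellar.hyps(1)] stellar.hyps(2,3)]]
      by auto
    have v\<rho>: "v \<notin> \<rho>" using F(1) stellar.hyps(3) by blast
    show ?case
    proof (cases "v \<in> \<sigma>")
      case False
      then have \<sigma>X: "\<sigma> \<in> X" "\<sigma> \<noteq> \<rho>" using \<sigma> ms by auto
      then have "\<sigma> \<in> facets X" using \<sigma> facets_uniform[OF stacked_uniform[OF stellar.hyps(1)]] by simp
      then obtain x where x: "x \<notin> \<sigma>" "insert x (\<sigma> - {t}) \<in> X" using stellar.IH stellar.prems by blast
      show ?thesis
      \<comment> \<open>If the old neighbour across the ridge was \<open>\<rho>\<close>, it is gone,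
        and \<open>v\<close> takes the place of \<open>x\<close>.\<close>
      proof (cases "insert x (\<sigma> - {t}) = \<rho>")
        case True
        then have "\<sigma> - {t} \<subset> \<rho>" using x by blast
        then show ?thesis using stellarI(2)[of "\<sigma> - {t}" \<rho> v X] False by blast
      next
        case False
        then show ?thesis using x stellarI(1)[OF x(2)] by blast
      qed
    next
      case True
      then have ps: "\<sigma> - {v} \<subset> \<rho>" using \<sigma> ms by auto
      have "finite (\<sigma> - {v})" using ps F(3) by (meson finite_subset psubset_imp_subset)
      then have "card (\<rho> - (\<sigma> - {v})) = 1"
        using ps True \<sigma> F by (simp add: card_Diff_subset psubset_imp_subset)
      then obtain r where r: "\<rho> - (\<sigma> - {v}) = {r}" using card_1_singletonE by blast
      then have r': "\<sigma> - {v} = \<rho> - {r}" "r \<in> \<rho>" using ps by blast+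
      show ?thesis
      \<comment> \<open>Dropping the apex crosses the ridge \<open>\<rho> - {r}\<close> into an old
        facet. Dropping any other \<open>t\<close> exchanges it for the absent vertex
        \<open>r\<close>.\<close>
      proof (cases "t = v")
        case True
        obtain x where x: "x \<notin> \<rho>" "insert x (\<rho> - {r}) \<in> X" using stellar.IH[OF stellar.hyps(2) r'(2)] by blast
        then have "x \<noteq> v" using stellar.hyps(3) by blast
        moreover have "x \<notin> \<sigma>" using x \<open>x \<noteq> v\<close> ps by blast
        moreover have "insert x (\<sigma> - {t}) \<in> stellar X \<rho> v"
          using x r' True by (auto intro!: stellarI(1))
        ultimately show ?thesis by blast
      next
        case False
        then have "insert r (\<sigma> - {t}) = insert v (\<rho> - {t})"
          using r' True stellar.prems(2) v\<rho> by blast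
        moreover have "t \<in> \<rho>" using False stellar.prems(2) ps by blast
        moreover have "r \<notin> \<sigma>" using r' v\<rho> by blast
        ultimately show ?thesis using stellarI(2)[of "\<rho> - {t}" \<rho> v X] by (metis Diff_subset insert_Diff_single insert_absorb psubsetI Diff_insert_absorb insertI1 mk_disjoint_insert psubset_insert_iff)
      qed
    qed
  qed
  then show ?thesis by blast
qed

section \<open>Missing facets and the two sides they cut off\<close>

lemma missing_face_stellar:
  assumes X: "stacked_sphere k X" and k: "k \<ge> 2" and \<rho>: "\<rho> \<in> facets X" and v: "v \<notin> \<Union>X"
    and \<tau>: "missing_face (stellar X \<rho> v) \<tau>" "card \<tau> = k + 1"
  shows "v \<notin> \<tau>" "\<tau> \<noteq> \<rho> \<Longrightarrow> missing_face X \<tau>"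
proof -
  note F = stacked_facetD[OF X \<rho>]
  note ms = mem_stellar_iff[OF v F(1)]
  have fin: "finite \<tau>" and notin: "\<tau> \<notin> stellar X \<rho> v" and
    sub: "\<And>\<sigma>. \<sigma> \<subset> \<tau> \<Longrightarrow> \<sigma> \<in> stellar X \<rho> v"
    using \<tau> unfolding missing_face_def by auto
  show nv: "v \<notin> \<tau>"
  proof
    assume v\<tau>: "v \<in> \<tau>"
    have "x \<in> \<rho>" if x: "x \<in> \<tau> - {v}" for x
    proof -
      \<comment> \<open>\<open>k \<ge> 2\<close> leaves a third vertex \<open>t\<close>. The face
        \<open>\<tau> - {t}\<close> still contains \<open>v\<close> and \<open>x\<close>, and a face
        through \<open>v\<close> has its other vertices in \<open>\<rho>\<close>.\<close>
      have "card (\<tau> - {v, x}) > 0" using \<tau>(2) fin x v\<tau> k by (simp add: card_Diff_subset card_insert_if)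
      then obtain t where t: "t \<in> \<tau>" "t \<noteq> v" "t \<noteq> x" by (metis Diff_iff card_gt_0_iff ex_in_conv insertCI)
      then have "\<tau> - {t} \<in> stellar X \<rho> v" "v \<in> \<tau> - {t}" using sub v\<tau> by auto
      then have "\<tau> - {t} - {v} \<subset> \<rho>" using ms by auto
      then show ?thesis using x t by blast
    qed
    then have "\<tau> - {v} \<subseteq> \<rho>" by blast
    moreover have "card (\<tau> - {v}) < card \<rho>" using \<tau>(2) F v\<tau> fin by simp
    ultimately have "\<tau> - {v} \<subset> \<rho>" by auto
    then show False using notin v\<tau> ms by auto
  qed
  show "missing_face X \<tau>" if "\<tau> \<noteq> \<rho>"
  proof -
    have "\<sigma> \<in> X" if "\<sigma> \<subset> \<tau>" for \<sigma>
      using sub[OF that] ms nv that by (auto split: if_splits)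
    moreover have "\<tau> \<notin> X" using notin ms nv that by auto
    ultimately show ?thesis using fin unfolding missing_face_def by blast
  qed
qed

lemma missing_face_apex:
  assumes "stacked_sphere k X" "\<rho> \<in> facets X" "v \<notin> \<Union>X"
  shows "missing_face (stellar X \<rho> v) \<rho>"
proof -
  note F = stacked_facetD[OF assms(1,2)]
  have "v \<notin> \<rho>" using F assms(3) by blast
  then have "\<rho> \<notin> stellar X \<rho> v" using mem_stellar_iff[OF assms(3) F(1)] by simp
  moreover have "\<sigma> \<in> stellar X \<rho> v" if "\<sigma> \<subset> \<rho>" for \<sigma>
    using that F(4) by (intro stellarI(1)) auto
  ultimately show ?thesis using F(3) unfolding missing_face_def by blast
qed

text \<open>The facet destroyed by the last starring is missing while its boundary remains.\<close>

lemma stacked_nonstandard_missing_face: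
  assumes "stacked_sphere k X" "\<nexists>A. finite A \<and> card A = k + 2 \<and> X = {\<sigma>. \<sigma> \<subset> A}"
  obtains \<tau> where "missing_face X \<tau>" "card \<tau> = k + 1"
  using assms(1)
proof (cases rule: stacked_cases)
  case (standard A)
  then show ?thesis using assms(2) by blast
next
  case (stellar Y \<rho> v)
  then show ?thesis using that missing_face_apex stacked_facetD(2) by metis
qed

text \<open>\<open>C\<close> and \<open>D\<close> are the two components left after deleting the
  vertices of a missing facet \<open>\<tau>\<close>. The last two clauses say that each side has a
  facet at every ridge of \<open>\<tau>\<close>; they provide the vertices that are seen from
  several links at once.\<close>

definition splits :: "'a set set \<Rightarrow> 'a set \<Rightarrow> 'a set \<Rightarrow> 'a set \<Rightarrow> bool" where
  "splits X \<tau> C D \<longleftrightarrow> C \<union> D = \<Union>X - \<tau> \<and> C \<inter> D = {} \<and> (\<forall>x\<in>C. \<forall>y\<in>D. {x, y} \<notin> X) \<and>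
     induces_connected X C \<and> induces_connected X D \<and>
     (\<forall>t\<in>\<tau>. \<exists>x\<in>C. insert x (\<tau> - {t}) \<in> X) \<and> (\<forall>t\<in>\<tau>. \<exists>x\<in>D. insert x (\<tau> - {t}) \<in> X)"

lemma splitsI:
  assumes "C \<union> D = \<Union>X - \<tau>" "C \<inter> D = {}" "\<And>x y. x \<in> C \<Longrightarrow> y \<in> D \<Longrightarrow> {x, y} \<notin> X"
    "induces_connected X C" "induces_connected X D"
    "\<And>t. t \<in> \<tau> \<Longrightarrow> \<exists>x\<in>C. insert x (\<tau> - {t}) \<in> X" "\<And>t. t \<in> \<tau> \<Longrightarrow> \<exists>x\<in>D. insert x (\<tau> - {t}) \<in> X"
  shows "splits X \<tau> C D"
  unfolding splits_def by (intro conjI ballI assms)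

lemma splits_sym:
  assumes "splits X \<tau> C D"
  shows "splits X \<tau> D C"
proof -
  have "\<forall>x\<in>D. \<forall>y\<in>C. {x, y} \<notin> X"
    using assms unfolding splits_def by (metis insert_commute)
  then show ?thesis
    using assms unfolding splits_def Un_commute[of D] Int_commute[of D] by blast
qed

text \<open>The vertices of \<open>\<rho>\<close> are pairwise adjacent and no edge joins
  \<open>C\<close> to \<open>D\<close>, so once \<open>\<rho>\<close> meets \<open>C\<close> it
  avoids \<open>D\<close>, and the new vertex joins \<open>C\<close>.\<close>

lemma splits_stellar:
  assumes X: "stacked_sphere k X" and k: "k \<ge> 2" and \<rho>: "\<rho> \<in> facets X" and v: "v \<notin> \<Union>X" "v \<notin> \<tau>"
    and sp: "splits X \<tau> C D" and s: "s \<in> \<rho>" "s \<in> C"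
  shows "splits (stellar X \<rho> v) \<tau> (insert v C) D"
proof -
  note F = stacked_facetD[OF X \<rho>]
  note ms = mem_stellar_iff[OF v(1) F(1)]
  have \<rho>3: "card \<rho> \<ge> 3" using F k by simp
  have Us: "\<Union>(stellar X \<rho> v) = insert v (\<Union>X)"
    by (rule Union_stellar[OF F(1) _ stacked_complex[OF X]]) (use \<rho>3 in simp)
  have sp': "C \<union> D = \<Union>X - \<tau>" "C \<inter> D = {}" "\<And>x y. x \<in> C \<Longrightarrow> y \<in> D \<Longrightarrow> {x, y} \<notin> X"
     "induces_connected X C" "induces_connected X D"
     "\<And>t. t \<in> \<tau> \<Longrightarrow> \<exists>x\<in>C. insert x (\<tau> - {t}) \<in> X" "\<And>t. t \<in> \<tau> \<Longrightarrow> \<exists>x\<in>D. insert x (\<tau> - {t}) \<in> X"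
    using sp unfolding splits_def by blast+
  have vCD: "v \<notin> C" "v \<notin> D" using sp'(1) v by blast+
  have \<rho>D: "y \<notin> D" if "y \<in> \<rho>" for y
    using sp'(3)[OF s(2), of y] F(4)[of "{s, y}"] s that by auto
  have e: "{x, y} \<notin> stellar X \<rho> v" if "x \<in> insert v C" "y \<in> D" for x y
  proof
    assume xy: "{x, y} \<in> stellar X \<rho> v"
    have "y \<noteq> v" using that vCD by blast
    show False
    proof (cases "x = v")
      case True
      then have "{y} \<subset> \<rho>" using xy ms \<open>y \<noteq> v\<close> by (auto simp: insert_Diff_if)
      then show ?thesis using \<rho>D that by blast
    next
      case False
      then have "{x, y} \<in> X" using xy ms \<open>y \<noteq> v\<close> by auto
      then show ?thesis using sp'(3) that False by blast
    qed
  qed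
  have c: "induces_connected (stellar X \<rho> v) C" "induces_connected (stellar X \<rho> v) D"
    using sp'(4,5) by (auto elim!: induces_connected_mono intro: edge_stellar[OF _ \<rho>3])
  have "{s} \<subset> \<rho>" using s \<rho>3 by auto
  then have "{s, v} \<in> stellar X \<rho> v" using stellarI(2)[of "{s}" \<rho> v X] by (simp add: insert_commute)
  then have cv: "induces_connected (stellar X \<rho> v) (insert v C)"
    using induces_connected_insert[OF c(1) s(2)] by blast
  have r1: "\<exists>x\<in>insert v C. insert x (\<tau> - {t}) \<in> stellar X \<rho> v" if t: "t \<in> \<tau>" for t
  proof -
    obtain x where x: "x \<in> C" "insert x (\<tau> - {t}) \<in> X" using sp'(6)[OF t] by blast
    show ?thesis
    proof (cases "insert x (\<tau> - {t}) = \<rho>")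
      case True
      moreover have "x \<notin> \<tau>" using x sp' by blast
      ultimately have "\<tau> - {t} \<subset> \<rho>" by blast
      then show ?thesis by (intro bexI[of _ v] stellarI(2)) auto
    next
      case False
      then show ?thesis using stellarI(1)[OF x(2)] x(1) by blast
    qed
  qed
  have r2: "\<exists>x\<in>D. insert x (\<tau> - {t}) \<in> stellar X \<rho> v" if t: "t \<in> \<tau>" for t
  proof -
    obtain x where x: "x \<in> D" "insert x (\<tau> - {t}) \<in> X" using sp'(7)[OF t] by blast
    then have "insert x (\<tau> - {t}) \<noteq> \<rho>" using \<rho>D by blast
    then show ?thesis using stellarI(1)[OF x(2)] x(1) by blast
  qed
  have "insert v C \<union> D = \<Union>(stellar X \<rho> v) - \<tau>" using Us sp'(1) v by auto
  moreover have "insert v C \<inter> D = {}" using sp'(2) vCD by auto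
  ultimately show ?thesis by (rule splitsI[OF _ _ e cv c(2) r1 r2])
qed

text \<open>If the last starring created \<open>\<tau>\<close>, its apex alone is one side and
  \<open>stacked_avoid_connected\<close> gives the other. An older \<open>\<tau>\<close> has as many
  vertices as \<open>\<rho>\<close>, so some vertex of \<open>\<rho>\<close> lies off
  \<open>\<tau>\<close> and tells which side receives the apex.\<close>

lemma stacked_splits:
  assumes "stacked_sphere k X" "k \<ge> 2" "missing_face X \<tau>" "card \<tau> = k + 1"
  shows "\<exists>C D. splits X \<tau> C D"
  using assms
proof (induction rule: stacked_induct)
  case (standard A)
  have "\<tau> \<subseteq> A"
  proof
    fix x assume "x \<in> \<tau>"
    then have "{x} \<subset> \<tau>" using standard(3,5) by auto
    then show "x \<in> A" using standard(4) unfolding missing_face_def by blast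
  qed
  moreover have "\<tau> \<noteq> A" using standard by auto
  ultimately show ?case using standard(4) unfolding missing_face_def by blast
next
  case (stellar X \<rho> v)
  note F = stacked_facetD[OF stellar.hyps(1,2)]
  note ms = mem_stellar_iff[OF stellar.hyps(3) F(1)]
  have \<rho>3: "card \<rho> \<ge> 3" using F stellar.prems by simp
  have Us: "\<Union>(stellar X \<rho> v) = insert v (\<Union>X)"
    by (rule Union_stellar[OF F(1) _ stacked_complex[OF stellar.hyps(1)]]) (use \<rho>3 in simp)
  note M = missing_face_stellar[OF stellar.hyps(1) stellar.prems(1) stellar.hyps(2,3) stellar.prems(2,3)]
  show ?case
  proof (cases "\<tau> = \<rho>")
    case True
    have "induces_connected X (\<Union>X - \<rho>)"
      using stacked_avoid_connected stellar.hyps(1) stellar.prems(1) F(1) by blast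
    then have c: "induces_connected (stellar X \<rho> v) (\<Union>X - \<rho>)"
      by (rule induces_connected_mono) (rule edge_stellar[OF _ \<rho>3])
    have cv: "induces_connected (stellar X \<rho> v) {v}" unfolding induces_connected_def by blast
    have e: "{x, y} \<notin> stellar X \<rho> v" if "x \<in> {v}" "y \<in> \<Union>X - \<rho>" for x y
      using that stellar.hyps(3) ms by (auto simp: insert_Diff_if)
    have r1: "\<exists>x\<in>{v}. insert x (\<rho> - {t}) \<in> stellar X \<rho> v" if "t \<in> \<rho>" for t
      using that stellarI(2)[of "\<rho> - {t}" \<rho> v X] by blast
    have r2: "\<exists>x\<in>(\<Union>X - \<rho>). insert x (\<rho> - {t}) \<in> stellar X \<rho> v" if t: "t \<in> \<rho>" for t
    proof -
      obtain x where x: "x \<in> \<Union>X - \<rho>" "insert x (\<rho> - {t}) \<in> X"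
        using stacked_ridge[OF stellar.hyps(1,2) t] by blast
      then have "insert x (\<rho> - {t}) \<noteq> \<rho>" by blast
      then show ?thesis using stellarI(1)[OF x(2)] x(1) by blast
    qed
    have "{v} \<union> (\<Union>X - \<rho>) = \<Union>(stellar X \<rho> v) - \<rho>" using Us M(1) True by auto
    moreover have "{v} \<inter> (\<Union>X - \<rho>) = {}" using stellar.hyps(3) by blast
    ultimately have "splits (stellar X \<rho> v) \<rho> {v} (\<Union>X - \<rho>)"
      by (rule splitsI[OF _ _ e cv c r1 r2])
    then show ?thesis using True by blast
  next
    case False
    then obtain C D where CD: "splits X \<tau> C D"
      using stellar.IH[OF stellar.prems(1) M(2) stellar.prems(3)] by blast
    have "\<not> \<rho> \<subseteq> \<tau>" using False F stellar.prems(2,3) unfolding missing_face_def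
      by (metis card_subset_eq)
    then obtain s where s: "s \<in> \<rho>" "s \<notin> \<tau>" by blast
    then have "s \<in> C \<or> s \<in> D" using CD F(1) unfolding splits_def by blast
    then show ?thesis
      using splits_stellar[OF stellar.hyps(1) stellar.prems(1) stellar.hyps(2,3) M(1)] CD splits_sym[OF CD] s(1) by blast
  qed
qed

section \<open>Rigidity of stacked spheres: cliques, simplex boundaries, removal of a vertex\<close>

text \<open>All neighbours of a new vertex lie in \<open>\<rho>\<close>, and \<open>Q - {v}\<close>
  is too small to exhaust \<open>\<rho>\<close>. The bound is sharp: after the starring
  \<open>\<rho>\<close> is a clique of size \<open>k + 1\<close> that is not a face.\<close>

lemma stacked_clique:
  assumes "stacked_sphere k X" "k \<ge> 2" "finite Q" "card Q \<le> k" "\<And>x y. x \<in> Q \<Longrightarrow> y \<in> Q \<Longrightarrow> {x, y} \<in> X"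
  shows "Q \<in> X"
  using assms
proof (induction rule: stacked_induct)
  case (standard A)
  have "Q \<subseteq> A" using standard(6) by blast
  moreover have "Q \<noteq> A" using standard by auto
  ultimately show ?case by auto
next
  case (stellar X \<rho> v)
  note F = stacked_facetD[OF stellar.hyps(1,2)]
  note ms = mem_stellar_iff[OF stellar.hyps(3) F(1)]
  show ?case
  proof (cases "v \<in> Q")
    case True
    have "x \<in> \<rho>" if "x \<in> Q - {v}" for x
      using stellar.prems(4)[of v x] True that ms by (auto simp: insert_Diff_if)
    then have "Q - {v} \<subseteq> \<rho>" by blast
    moreover have "card (Q - {v}) < card \<rho>" using stellar.prems F True by simp
    ultimately have "Q - {v} \<subset> \<rho>" by auto
    then show ?thesis using True ms by auto
  next
    case False
    then have "{x, y} \<in> X" if "x \<in> Q" "y \<in> Q" for x y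
      using stellar.prems(4)[OF that] that ms by (auto split: if_splits)
    then have "Q \<in> X" using stellar.IH stellar.prems by blast
    then show ?thesis using stellar_small F stellar.prems by fastforce
  qed
qed

text \<open>A proper starring would destroy a proper subset of \<open>D\<close>. If \<open>v\<close>
  is in \<open>D\<close>, then \<open>D - {v}\<close> is \<open>\<rho>\<close>, no longer a face.
  Otherwise the boundary of \<open>D\<close> was already the whole old complex, and its facet
  \<open>\<rho>\<close> has been removed.\<close>

lemma stacked_contains_standard:
  assumes "stacked_sphere k X" "k \<ge> 1" "finite D" "card D = k + 2" "{\<sigma>. \<sigma> \<subset> D} \<subseteq> X"
  shows "X = {\<sigma>. \<sigma> \<subset> D}"
  using assms
proof (induction rule: stacked_induct)
  case (standard A)
  have "\<Union>{\<sigma>. \<sigma> \<subset> D} \<subseteq> \<Union>{\<sigma>. \<sigma> \<subset> A}" using standard(6) by (rule Union_mono)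
  then have "D \<subseteq> A" using Union_psubsets[of A] Union_psubsets[of D] standard by simp
  then have "D = A" using standard by (metis card_subset_eq)
  then show ?case by simp
next
  case (stellar X \<rho> v)
  note F = stacked_facetD[OF stellar.hyps(1,2)]
  note ms = mem_stellar_iff[OF stellar.hyps(3) F(1)]
  have v\<rho>: "v \<notin> \<rho>" using F(1) stellar.hyps(3) by blast
  have n\<rho>: "\<rho> \<notin> stellar X \<rho> v" using ms v\<rho> by simp
  show ?case
  proof (cases "v \<in> D")
    case True
    have "x \<in> \<rho>" if x: "x \<in> D - {v}" for x
    proof -
      have "{v, x} \<noteq> D" using stellar.prems(1,3) by (auto simp: card_insert_if split: if_splits)
      then have "{v, x} \<subset> D" using x True by blast
      then have "{v, x} \<in> stellar X \<rho> v" using stellar.prems(4) by blast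
      then have "{v, x} - {v} \<subset> \<rho>" using ms[of "{v, x}"] by simp
      then show ?thesis using x by blast
    qed
    then have "D - {v} \<subseteq> \<rho>" by blast
    moreover have "card (D - {v}) = card \<rho>" using F True stellar.prems by simp
    ultimately have "D - {v} = \<rho>" using F by (metis card_subset_eq)
    then have "\<rho> \<subset> D" using True by blast
    then show ?thesis using n\<rho> stellar.prems(4) by blast
  next
    case False
    have "{\<sigma>. \<sigma> \<subset> D} \<subseteq> X"
    proof
      fix \<sigma> assume "\<sigma> \<in> {\<sigma>. \<sigma> \<subset> D}"
      then have "\<sigma> \<in> stellar X \<rho> v" "v \<notin> \<sigma>" using stellar.prems(4) False by blast+
      then show "\<sigma> \<in> X" using ms by auto
    qed
    then have "X = {\<sigma>. \<sigma> \<subset> D}" using stellar by blast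
    then have "\<rho> \<subset> D" using F(1) by blast
    then show ?thesis using n\<rho> stellar.prems(4) by blast
  qed
qed

text \<open>Inverse of \<open>stellar\<close>: the star of the apex \<open>v\<close> is replaced by
  the base facet \<open>B\<close>.\<close>

definition unstar :: "'a set set \<Rightarrow> 'a \<Rightarrow> 'a set \<Rightarrow> 'a set set" where
  "unstar X v B = insert B {\<tau>\<in>X. v \<notin> \<tau>}"

text \<open>The difficulty is that \<open>v\<close> need not be the vertex added last. The induction
  compares it with the last apex \<open>w\<close>: either they coincide, or the two operations
  commute, apart from the exchange that occurs when both have the same base.\<close>

lemma stacked_unstar:
  assumes "stacked_sphere k X" "k \<ge> 2" "v \<in> \<Union>X" "finite B" "card B = k + 1"
    "link X {v} = {\<sigma>. \<sigma> \<subset> B}" "B \<notin> X"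
  shows "stacked_sphere k (unstar X v B)"
  using assms
proof (induction rule: stacked_induct)
  case (standard A)
  then have v: "v \<in> A" by blast
  have "link {\<sigma>. \<sigma> \<subset> A} {v} = {\<sigma>. \<sigma> \<subset> A - {v}}"
    using v unfolding link_def by auto
  then have "\<Union>{\<sigma>. \<sigma> \<subset> A - {v}} = \<Union>{\<sigma>. \<sigma> \<subset> B}" using standard(7) by simp
  moreover have "card (A - {v}) = k + 1" using standard v by simp
  ultimately have "A - {v} = B" using standard Union_psubsets[of B] Union_psubsets[of "A - {v}"] by simp
  then have "B \<subset> A" using v by blast
  then show ?case using standard(8) by blast
next
  case (stellar X \<rho> w)
  note F = stacked_facetD[OF stellar.hyps(1,2)]
  note ms = mem_stellar_iff[OF stellar.hyps(3) F(1)]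
  have sc: "simplicial_complex X" using stellar.hyps(1) by (rule stacked_complex)
  note H = sc stellar.hyps(2,3)
  note pr = stellar.prems
  have Us: "\<Union>(stellar X \<rho> w) = insert w (\<Union>X)"
    by (rule Union_stellar[OF F(1) _ sc]) (use F(2) pr(1) in simp)
  have w\<rho>: "w \<notin> \<rho>" using F(1) stellar.hyps(3) by blast
  have UB: "\<Union>{\<sigma>. \<sigma> \<subset> B} = B" using pr by (intro Union_psubsets) auto
  show ?case
  proof (cases "v = w")
    case True
    then have eq: "{\<sigma>. \<sigma> \<subset> \<rho>} = {\<sigma>. \<sigma> \<subset> B}"
      using link_stellar_apex[OF H] pr(5) by metis
    have U\<rho>: "\<Union>{\<sigma>. \<sigma> \<subset> \<rho>} = \<rho>" using F pr by (intro Union_psubsets) auto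
    have "B = \<rho>" using arg_cong[OF eq, of Union] unfolding UB U\<rho> by (rule sym)
    moreover have "unstar (stellar X \<rho> w) w \<rho> = X"
    proof (intro set_eqI)
      fix \<tau>
      show "\<tau> \<in> unstar (stellar X \<rho> w) w \<rho> \<longleftrightarrow> \<tau> \<in> X"
        unfolding unstar_def insert_iff mem_Collect_eq ms using F(1) stellar.hyps(3) by auto
    qed
    ultimately show ?thesis using True stellar.hyps(1) by simp
  next
    case vw: False
    then have vX: "v \<in> \<Union>X" using pr(2) Us by simp
    show ?thesis
    proof (cases "v \<in> \<rho>")
      case True
      \<comment> \<open>Contradiction by counting: this link has \<open>w\<close> and at least
        \<open>k + 1\<close> old vertices, but \<open>B\<close> has only \<open>k + 1\<close>
        vertices.\<close>
      have "link (stellar X \<rho> w) {v} = stellar (link X {v}) (\<rho> - {v}) w"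
        using link_stellar_on[OF H True] .
      moreover have "\<rho> - {v} \<in> link X {v}" using True F mem_link_vertex[OF sc] by (simp add: insert_absorb)
      ultimately have "B = insert w (\<Union>(link X {v}))"
        using Union_stellar[of "\<rho> - {v}" "link X {v}" w] link_complex[OF sc] pr(1,5) UB F True by simp
      moreover have "w \<notin> \<Union>(link X {v})" using stellar.hyps(3) unfolding link_def by blast
      moreover have "stacked_sphere (k - 1) (link X {v})"
        using stacked_vertex_link[of "k - 1" X v] stellar.hyps(1) vX pr(1) by simp
      then have "card (\<Union>(link X {v})) \<ge> k - 1 + 2" using pr(1) by (intro stacked_card_vertices) auto
      moreover have "finite (\<Union>(link X {v}))" using finite_vertices[OF link_complex[OF sc]] .
      ultimately show ?thesis using pr(4) by simp
    next
      case v\<rho>: False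
      have lk: "link X {v} = {\<sigma>. \<sigma> \<subset> B}" using link_stellar_off[OF H vw v\<rho>] pr(5) by simp
      show ?thesis
      proof (cases "B = \<rho>")
        case True
        \<comment> \<open>Here \<open>v\<close> and \<open>w\<close> are coned over opposite sides
          of the same \<open>\<rho>\<close>: the old complex is the boundary of
          \<open>insert v \<rho>\<close>, and removing \<open>v\<close> leaves the boundary of
          \<open>insert w \<rho>\<close>.\<close>
        have "{\<sigma>. \<sigma> \<subset> insert v \<rho>} \<subseteq> X"
        proof
          fix \<sigma> assume \<sigma>: "\<sigma> \<in> {\<sigma>. \<sigma> \<subset> insert v \<rho>}"
          show "\<sigma> \<in> X"
          proof (cases "v \<in> \<sigma>")
            case v\<sigma>: True
            then have "\<sigma> - {v} \<subset> \<rho>" using \<sigma> by blast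
            then have "\<sigma> - {v} \<in> link X {v}" using lk True by simp
            then show ?thesis using mem_link_vertex[OF sc] v\<sigma> by (simp add: insert_absorb)
          next
            case False
            then show ?thesis using \<sigma> by (intro F(4)) blast
          qed
        qed
        then have X: "X = {\<sigma>. \<sigma> \<subset> insert v \<rho>}"
          using stacked_contains_standard[OF stellar.hyps(1), of "insert v \<rho>"] pr(1) F v\<rho> by simp
        have memX: "\<tau> \<in> X \<longleftrightarrow> \<tau> \<subset> insert v \<rho>" for \<tau> using X by blast
        have "unstar (stellar X \<rho> w) v \<rho> = {\<sigma>. \<sigma> \<subset> insert w \<rho>}"
        proof (intro set_eqI)
          fix \<tau>
          show "\<tau> \<in> unstar (stellar X \<rho> w) v \<rho> \<longleftrightarrow> \<tau> \<in> {\<sigma>. \<sigma> \<subset> insert w \<rho>}"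
            unfolding unstar_def insert_iff mem_Collect_eq ms memX using w\<rho> v\<rho> vw by auto
        qed
        moreover have "card (insert w \<rho>) = k + 2" using F w\<rho> by simp
        ultimately show ?thesis using True stacked_sphere.standard[of "insert w \<rho>" k] F(3) by simp
      next
        case B\<rho>: False
        have "\<Union>(link X {v}) \<subseteq> \<Union>X" unfolding link_def by blast
        then have BX: "B \<subseteq> \<Union>X" using lk UB by simp
        then have wB: "w \<notin> B" using stellar.hyps(3) by blast
        then have "B \<notin> X" using pr(6) ms B\<rho> by auto
        then have st: "stacked_sphere k (unstar X v B)"
          using stellar.IH[OF pr(1) vX pr(3,4) lk] by blast
        have "\<rho> \<in> unstar X v B" unfolding unstar_def using F v\<rho> by simp
        then have f: "\<rho> \<in> facets (unstar X v B)"
          unfolding facets_uniform[OF stacked_uniform[OF st]] using F by simp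
        have w: "w \<notin> \<Union>(unstar X v B)" unfolding unstar_def using wB stellar.hyps(3) by blast
        \<comment> \<open>With different bases the two operations commute, so the induction
          hypothesis can be starred again.\<close>
        have "unstar (stellar X \<rho> w) v B = stellar (unstar X v B) \<rho> w"
        proof (intro set_eqI)
          fix \<tau>
          show "\<tau> \<in> unstar (stellar X \<rho> w) v B \<longleftrightarrow> \<tau> \<in> stellar (unstar X v B) \<rho> w"
            unfolding mem_stellar_iff[OF w \<open>\<rho> \<in> unstar X v B\<close>]
            unfolding unstar_def insert_iff mem_Collect_eq ms
            using wB v\<rho> vw B\<rho> by auto
        qed
        then show ?thesis using stacked_stellar[OF st f w] by simp
      qed
    qed
  qed
qed

section \<open>Complexes with stacked vertex links\<close>

definition cocycle :: "'a set set \<Rightarrow> ('a \<Rightarrow> 'a \<Rightarrow> int) \<Rightarrow> bool" where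
  "cocycle X c \<longleftrightarrow> (\<forall>x y z. {x, y, z} \<in> X \<longrightarrow> c x y + c y z + c z x = 0)"

text \<open>Vanishing of the first cohomology with integer coefficients.\<close>

definition cocycles_trivial :: "'a set set \<Rightarrow> bool" where
  "cocycles_trivial X \<longleftrightarrow> (\<forall>c. cocycle X c \<longrightarrow> (\<exists>g. \<forall>x y. {x, y} \<in> X \<longrightarrow> c x y = g y - g x))"

text \<open>The invariant of the main induction. The index \<open>k\<close> is the dimension of the
  links, one less than that of the complex.\<close>

definition locally_stacked :: "nat \<Rightarrow> 'a set set \<Rightarrow> bool" where
  "locally_stacked k X \<longleftrightarrow> simplicial_complex X \<and> \<Union>X \<noteq> {} \<and> induces_connected X (\<Union>X) \<and>
     (\<forall>v\<in>\<Union>X. stacked_sphere k (link X {v}))"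

lemma locally_stackedD:
  assumes "locally_stacked k X"
  shows "simplicial_complex X" "\<Union>X \<noteq> {}" "induces_connected X (\<Union>X)"
    "v \<in> \<Union>X \<Longrightarrow> stacked_sphere k (link X {v})"
  using assms unfolding locally_stacked_def by blast+

lemma induces_connected_const:
  assumes "induces_connected X W" "\<And>x y. x \<in> W \<Longrightarrow> y \<in> W \<Longrightarrow> {x, y} \<in> X \<Longrightarrow> f x = f y"
    "a \<in> W" "b \<in> W"
  shows "f a = f b"
proof -
  have "{x\<in>W. f x = f a} = W"
    by (rule induces_connectedD[OF assms(1), of _ a]) (use assms(2)[symmetric] assms(3) in auto)
  then show ?thesis using assms(4) by force
qed

text \<open>The vertices of the face are deleted one at a time. A connection through the deleted
  vertex \<open>v\<close> is rerouted in its link, which stays connected after removal of the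
  remaining face by \<open>stacked_avoid_connected\<close>.\<close>

lemma locally_stacked_avoid:
  assumes X: "locally_stacked k X" and k: "k \<ge> 2" and \<rho>: "\<rho> \<in> X"
  shows "induces_connected X (\<Union>X - \<rho>)"
proof -
  note sc = locally_stackedD(1)[OF X]
  have "finite \<rho>" using sc \<rho> by (rule simplicial_complexD(2))
  then show ?thesis using \<rho>
  proof (induction rule: finite_induct)
    case empty
    then show ?case using locally_stackedD(3)[OF X] by simp
  next
    case (insert v \<rho>)
    let ?L = "link X {v}"
    have \<rho>: "\<rho> \<in> X" using simplicial_complexD(3)[OF sc insert.prems] by blast
    have v: "v \<in> \<Union>X" using insert.prems by blast
    have mL: "\<tau> \<in> ?L \<longleftrightarrow> v \<notin> \<tau> \<and> insert v \<tau> \<in> X" for \<tau> using mem_link_vertex[OF sc] .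
    have LX: "\<tau> \<in> X" if "\<tau> \<in> ?L" for \<tau> using that unfolding link_def by blast
    have "\<rho> \<in> ?L" using mL insert.hyps insert.prems by blast
    then have cL: "induces_connected ?L (\<Union>?L - \<rho>)"
      using stacked_avoid_connected[OF locally_stackedD(4)[OF X v] k] by blast
    have c\<rho>: "induces_connected X (\<Union>X - \<rho>)" using insert.IH \<rho> by blast
    have UL: "x \<in> \<Union>?L" if "{x, v} \<in> X" "x \<noteq> v" for x
      using mL[of "{x}"] that by (auto simp: insert_commute)
    show ?case
      unfolding induces_connected_def
    proof (intro allI impI)
      fix C assume C: "C \<subseteq> \<Union>X - insert v \<rho>" "C \<noteq> {}"
        and cl: "\<forall>x\<in>C. \<forall>y\<in>\<Union>X - insert v \<rho>. {x, y} \<in> X \<longrightarrow> y \<in> C"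
      show "C = \<Union>X - insert v \<rho>"
      proof (cases "C \<inter> \<Union>?L = {}")
        case True
        obtain x where "x \<in> C" using C by blast
        \<comment> \<open>A closed set with no neighbour of \<open>v\<close> is closed even when
          \<open>v\<close> is allowed, so it would have to contain \<open>v\<close>.\<close>
        have "C = \<Union>X - \<rho>"
        proof (rule induces_connectedD[OF c\<rho> _ \<open>x \<in> C\<close>])
          show "C \<subseteq> \<Union>X - \<rho>" using C by blast
          fix a b assume ab: "a \<in> C" "b \<in> \<Union>X - \<rho>" "{a, b} \<in> X"
          have "b \<noteq> v" using UL[of a] ab True C by blast
          then show "b \<in> C" using cl ab by blast
        qed
        then show ?thesis using C v insert.hyps by blast
      next
        case False
        then obtain x where x: "x \<in> C" "x \<in> \<Union>?L" by blast
        have xx: "x \<in> C \<inter> (\<Union>?L - \<rho>)" using x C by blast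
        have "C \<inter> (\<Union>?L - \<rho>) = \<Union>?L - \<rho>"
        proof (rule induces_connectedD[OF cL _ xx])
          show "C \<inter> (\<Union>?L - \<rho>) \<subseteq> \<Union>?L - \<rho>" by blast
          fix a b assume ab: "a \<in> C \<inter> (\<Union>?L - \<rho>)" "b \<in> \<Union>?L - \<rho>" "{a, b} \<in> ?L"
          then have "{a, b} \<in> X" "b \<noteq> v" "b \<in> \<Union>X" using LX mL by blast+
          then show "b \<in> C \<inter> (\<Union>?L - \<rho>)" using cl ab by blast
        qed
        then have LC: "\<Union>?L - \<rho> \<subseteq> C" by blast
        have "insert v C = \<Union>X - \<rho>"
        proof (rule induces_connectedD[OF c\<rho>, of _ v])
          show "insert v C \<subseteq> \<Union>X - \<rho>" using C v insert.hyps by blast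
          show "v \<in> insert v C" by blast
          fix a b assume ab: "a \<in> insert v C" "b \<in> \<Union>X - \<rho>" "{a, b} \<in> X"
          show "b \<in> insert v C"
          proof (cases "a = v \<and> b \<noteq> v")
            case True
            then have "b \<in> \<Union>?L" using UL[of b] ab by (simp add: insert_commute)
            then show ?thesis using LC ab by blast
          next
            case False
            then show ?thesis using cl ab by blast
          qed
        qed
        then show ?thesis using C by blast
      qed
    qed
  qed
qed

text \<open>The point is that \<open>\<alpha>\<close> itself is a face of \<open>X\<close>. In the
  link of some \<open>w\<close> in \<open>\<alpha>\<close> the other \<open>k\<close> vertices form
  a clique, since by \<open>k \<ge> 3\<close> every triple in \<open>\<alpha>\<close> is a proper
  subset; then \<open>stacked_clique\<close> applies.\<close>

lemma link_missing_face:
  assumes X: "locally_stacked k X" and k: "k \<ge> 3" and v: "v \<in> \<Union>X"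
    and \<alpha>: "missing_face (link X {v}) \<alpha>" "card \<alpha> = k + 1"
  shows "missing_face X (insert v \<alpha>)" "v \<notin> \<alpha>"
proof -
  note sc = locally_stackedD(1)[OF X]
  have mL: "\<tau> \<in> link X {v} \<longleftrightarrow> v \<notin> \<tau> \<and> insert v \<tau> \<in> X" for \<tau> using mem_link_vertex[OF sc] .
  have sub: "\<sigma> \<in> link X {v}" if "\<sigma> \<subset> \<alpha>" for \<sigma> using \<alpha>(1) that unfolding missing_face_def by blast
  have subX: "\<sigma> \<in> X" if "\<sigma> \<subset> \<alpha>" for \<sigma> using sub[OF that] unfolding link_def by blast
  have fin: "finite \<alpha>" and notin: "\<alpha> \<notin> link X {v}" using \<alpha>(1) unfolding missing_face_def by blast+
  show v\<alpha>: "v \<notin> \<alpha>"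
  proof
    assume "v \<in> \<alpha>"
    then have "{v} \<subset> \<alpha>" using \<alpha>(2) k by auto
    then show False using sub mL by blast
  qed
  obtain w where w: "w \<in> \<alpha>" using \<alpha>(2) by fastforce
  have "{w} \<subset> \<alpha>" using w \<alpha>(2) k by auto
  then have "{w} \<in> X" using subX by blast
  then have wX: "w \<in> \<Union>X" by blast
  have "\<alpha> - {w} \<in> link X {w}"
  proof (rule stacked_clique[OF locally_stackedD(4)[OF X wX]])
    show "2 \<le> k" using k by simp
    show "finite (\<alpha> - {w})" "card (\<alpha> - {w}) \<le> k" using fin \<alpha> w by auto
    fix x y assume xy: "x \<in> \<alpha> - {w}" "y \<in> \<alpha> - {w}"
    have "card {w, x, y} < card \<alpha>" using \<alpha>(2) k by (auto simp: card_insert_if)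
    then have "{w, x, y} \<subset> \<alpha>" using xy w by auto
    then show "{x, y} \<in> link X {w}" using subX mem_link_vertex[OF sc] xy by auto
  qed
  then have \<alpha>X: "\<alpha> \<in> X" using mem_link_vertex[OF sc] w by (auto simp: insert_absorb)
  have "\<sigma> \<in> X" if \<sigma>: "\<sigma> \<subset> insert v \<alpha>" for \<sigma>
  proof (cases "v \<in> \<sigma>")
    case True
    then have "\<sigma> - {v} \<subset> \<alpha>" using \<sigma> by blast
    then have "\<sigma> - {v} \<in> link X {v}" by (rule sub)
    then show ?thesis using mL[of "\<sigma> - {v}"] True by (simp add: insert_absorb)
  next
    case False
    then have "\<sigma> \<subseteq> \<alpha>" using \<sigma> by blast
    then show ?thesis using simplicial_complexD(3)[OF sc \<alpha>X] by blast
  qed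
  moreover have "insert v \<alpha> \<notin> X" using notin mL v\<alpha> by blast
  ultimately show "missing_face X (insert v \<alpha>)" using fin unfolding missing_face_def by blast
qed

lemma missing_face_link:
  assumes "simplicial_complex X" "missing_face X \<sigma>" "v \<in> \<sigma>"
  shows "missing_face (link X {v}) (\<sigma> - {v})"
proof -
  note mL = mem_link_vertex[OF assms(1), of _ v]
  have "\<tau> \<in> link X {v}" if "\<tau> \<subset> \<sigma> - {v}" for \<tau>
  proof -
    have "insert v \<tau> \<subset> \<sigma>" "v \<notin> \<tau>" using that assms(3) by auto
    then show ?thesis using mL assms(2) unfolding missing_face_def by blast
  qed
  moreover have "\<sigma> - {v} \<notin> link X {v}"
    using mL assms(2,3) unfolding missing_face_def by (simp add: insert_absorb)
  ultimately show ?thesis using assms(2) unfolding missing_face_def by blast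
qed

text \<open>An edge-invariant predicate is determined by its values on the two sides; if it is not
  constant, it singles out one of them.\<close>

lemma stacked_sides_unique:
  assumes M: "stacked_sphere j M" "j \<ge> 2" "missing_face M \<tau>" "card \<tau> = j + 1"
    and P: "\<And>x y. x \<in> \<Union>M - \<tau> \<Longrightarrow> y \<in> \<Union>M - \<tau> \<Longrightarrow> {x, y} \<in> M \<Longrightarrow> P x = P y"
    and Q: "\<And>x y. x \<in> \<Union>M - \<tau> \<Longrightarrow> y \<in> \<Union>M - \<tau> \<Longrightarrow> {x, y} \<in> M \<Longrightarrow> Q x = Q y"
    and nP: "x1 \<in> \<Union>M - \<tau>" "P x1" "x2 \<in> \<Union>M - \<tau>" "\<not> P x2"
    and nQ: "y1 \<in> \<Union>M - \<tau>" "Q y1" "y2 \<in> \<Union>M - \<tau>" "\<not> Q y2"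
  shows "(\<forall>x\<in>\<Union>M - \<tau>. P x \<longleftrightarrow> Q x) \<or> (\<forall>x\<in>\<Union>M - \<tau>. P x \<longleftrightarrow> \<not> Q x)"
proof -
  obtain C D where CD: "splits M \<tau> C D" using stacked_splits[OF M] by blast
  then have U: "\<Union>M - \<tau> = C \<union> D" and c: "induces_connected M C" "induces_connected M D"
    unfolding splits_def by blast+
  have PC: "P x = P y" "Q x = Q y" if "x \<in> C" "y \<in> C" for x y
    using induces_connected_const[OF c(1), of P x y] induces_connected_const[OF c(1), of Q x y]
      that P Q U by blast+
  have PD: "P x = P y" "Q x = Q y" if "x \<in> D" "y \<in> D" for x y
    using induces_connected_const[OF c(2), of P x y] induces_connected_const[OF c(2), of Q x y]
      that P Q U by blast+
  show ?thesis using PC PD nP nQ unfolding U by (metis Un_iff)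
qed

section \<open>The sides of a missing facet at its vertices, and the cocycle that counts
  crossings\<close>

locale missing_facet =
  fixes k :: nat and X :: "'a set set" and \<sigma> :: "'a set"
  assumes X: "locally_stacked k X" and k: "k \<ge> 3"
    and \<sigma>: "missing_face X \<sigma>" "card \<sigma> = k + 2"
begin

lemma sc: "simplicial_complex X"
  using locally_stackedD(1)[OF X] .

lemma fin: "finite \<sigma>"
  using \<sigma>(1) unfolding missing_face_def by blast

lemma proper: "\<tau> \<subset> \<sigma> \<Longrightarrow> \<tau> \<in> X"
  using \<sigma>(1) unfolding missing_face_def by blast

text \<open>\<open>\<sigma>\<close> has at least five vertices. Dropping such a \<open>t\<close>
  gives a ridge of \<open>\<sigma>\<close> that retains whichever of the three given points lie in
  \<open>\<sigma>\<close>.\<close>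

lemma pick:
  obtains t where "t \<in> \<sigma>" "t \<noteq> a" "t \<noteq> b" "t \<noteq> c"
proof -
  have "card {a, b, c} \<le> 3" by (simp add: card_insert_if)
  then have "\<not> \<sigma> \<subseteq> {a, b, c}" using \<sigma>(2) k card_mono[of "{a, b, c}" \<sigma>] by auto
  then show ?thesis using that by blast
qed

lemma vert: "v \<in> \<sigma> \<Longrightarrow> v \<in> \<Union>X"
proof -
  assume v: "v \<in> \<sigma>"
  obtain t where "t \<in> \<sigma>" "t \<noteq> v" using pick[of v v v] by blast
  then have "{v} \<subset> \<sigma>" using v by blast
  then show ?thesis using proper by blast
qed

definition side :: "'a \<Rightarrow> 'a set \<Rightarrow> bool" where
  "side v C \<longleftrightarrow> (\<exists>D. splits (link X {v}) (\<sigma> - {v}) C D)"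

lemma side_exists: "v \<in> \<sigma> \<Longrightarrow> \<exists>C. side v C"
  unfolding side_def
  using stacked_splits[OF locally_stackedD(4)[OF X vert] _ missing_face_link[OF sc \<sigma>(1)]] k \<sigma>(2) fin
  by simp

lemma side_edge:
  assumes "side v C" "{v, x, y} \<in> X" "v \<in> \<sigma>" "x \<notin> \<sigma>" "y \<notin> \<sigma>"
  shows "x \<in> C \<longleftrightarrow> y \<in> C"
proof -
  obtain D where D: "splits (link X {v}) (\<sigma> - {v}) C D" using assms(1) unfolding side_def by blast
  have e: "{x, y} \<in> link X {v}" using mem_link_vertex[OF sc] assms by auto
  then have "x \<in> \<Union>(link X {v}) - (\<sigma> - {v})" "y \<in> \<Union>(link X {v}) - (\<sigma> - {v})" using assms by blast+
  then have "x \<in> C \<union> D" "y \<in> C \<union> D" using D unfolding splits_def by blast+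
  moreover have "\<not> (x \<in> C \<and> y \<in> D)" using D e unfolding splits_def by blast
  moreover have "\<not> (y \<in> C \<and> x \<in> D)" using D e unfolding splits_def by (metis insert_commute)
  ultimately show ?thesis using D unfolding splits_def by blast
qed

text \<open>The vertex \<open>x\<close> forms a face with all of \<open>\<sigma> - {t}\<close>, so
  it is visible from every vertex of \<open>\<sigma>\<close> except possibly \<open>t\<close>. This
  makes choices at different vertices comparable.\<close>

lemma side_inside:
  assumes "side v C" "v \<in> \<sigma>" "t \<in> \<sigma>" "t \<noteq> v"
  obtains x where "x \<in> C" "x \<notin> \<sigma>" "insert x (\<sigma> - {t}) \<in> X"
proof -
  obtain D where D: "splits (link X {v}) (\<sigma> - {v}) C D" using assms(1) unfolding side_def by blast
  have "t \<in> \<sigma> - {v}" using assms by simp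
  then obtain x where x: "x \<in> C" "insert x (\<sigma> - {v} - {t}) \<in> link X {v}" using D unfolding splits_def by blast
  then have "v \<noteq> x" "insert v (insert x (\<sigma> - {v} - {t})) \<in> X" using mem_link_vertex[OF sc] by auto
  moreover have "insert v (insert x (\<sigma> - {v} - {t})) = insert x (\<sigma> - {t})" using assms by blast
  moreover have "x \<notin> \<sigma> - {v}" using x D unfolding splits_def by blast
  ultimately show ?thesis using that x by auto
qed

lemma side_opposite:
  assumes "side v C" "v \<in> \<sigma>"
  obtains D where "side v D" "C \<inter> D = {}" "\<And>x. {v, x} \<in> X \<Longrightarrow> x \<notin> \<sigma> \<Longrightarrow> x \<in> C \<union> D"
proof -
  obtain D where D: "splits (link X {v}) (\<sigma> - {v}) C D" using assms(1) unfolding side_def by blast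
  have "x \<in> C \<union> D" if "{v, x} \<in> X" "x \<notin> \<sigma>" for x
  proof -
    have "{x} \<in> link X {v}" using mem_link_vertex[OF sc] that assms by auto
    then have "x \<in> \<Union>(link X {v}) - (\<sigma> - {v})" using that by blast
    then show ?thesis using D unfolding splits_def by blast
  qed
  moreover have "side v D" unfolding side_def using splits_sym[OF D] by blast
  moreover have "C \<inter> D = {}" using D unfolding splits_def by blast
  ultimately show ?thesis using that by blast
qed

text \<open>Both sides restrict to the link of the edge \<open>{v, w}\<close>, a stacked sphere of
  dimension \<open>k - 1 \<ge> 2\<close> with missing facet \<open>\<sigma> - {v, w}\<close>. There
  each is edge-invariant and nonconstant, so \<open>stacked_sides_unique\<close> decides.\<close>

lemma sides_agree_or_oppose:
  assumes "v \<in> \<sigma>" "w \<in> \<sigma>" "v \<noteq> w" "side v C" "side w C'"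
  shows "(\<forall>x. {v, w, x} \<in> X \<longrightarrow> x \<notin> \<sigma> \<longrightarrow> (x \<in> C \<longleftrightarrow> x \<in> C')) \<or>
         (\<forall>x. {v, w, x} \<in> X \<longrightarrow> x \<notin> \<sigma> \<longrightarrow> (x \<in> C \<longleftrightarrow> x \<notin> C'))"
proof -
  let ?M = "link (link X {v}) {w}"
  let ?\<tau> = "\<sigma> - {v} - {w}"
  have mM: "\<tau> \<in> ?M \<longleftrightarrow> v \<notin> \<tau> \<and> w \<notin> \<tau> \<and> insert v (insert w \<tau>) \<in> X" for \<tau>
    using mem_link_vertex[OF link_complex[OF sc], of \<tau> v w] mem_link_vertex[OF sc] assms(3) by auto
  have vw: "{v, w} \<in> X"
  proof -
    obtain t where "t \<in> \<sigma>" "t \<noteq> v" "t \<noteq> w" using pick[of v w w] by blast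
    then show ?thesis using assms by (intro proper) blast
  qed
  then have "{w} \<in> link X {v}" using mem_link_vertex[OF sc] assms(3) by auto
  then have wL: "w \<in> \<Union>(link X {v})" by blast
  have st: "stacked_sphere (k - 1) ?M"
    using stacked_vertex_link[of "k - 1" "link X {v}" w] locally_stackedD(4)[OF X vert[OF assms(1)]] k wL by simp
  have mf: "missing_face ?M ?\<tau>"
    using missing_face_link[OF link_complex[OF sc] missing_face_link[OF sc \<sigma>(1) assms(1)]] assms by simp
  have cd: "card ?\<tau> = k - 1 + 1" using assms \<sigma>(2) fin k by simp
  have T: "x \<in> \<Union>?M - ?\<tau> \<longleftrightarrow> {v, w, x} \<in> X \<and> x \<notin> \<sigma>" for x
  proof -
    have "x \<in> \<Union>?M \<longleftrightarrow> {x} \<in> ?M"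
      using vertex_iff[OF link_complex[OF link_complex[OF sc]]] .
    also have "\<dots> \<longleftrightarrow> x \<noteq> v \<and> x \<noteq> w \<and> {v, w, x} \<in> X" unfolding mM by auto
    finally show ?thesis using assms(1,2) by auto
  qed
  have edge: "P x = P y" if "x \<in> \<Union>?M - ?\<tau>" "y \<in> \<Union>?M - ?\<tau>" "{x, y} \<in> ?M"
    "u = v \<or> u = w" "side u B" "P = (\<lambda>z. z \<in> B)" for x y u B P
  proof -
    have "insert v (insert w {x, y}) \<in> X" using that(3) mM by blast
    then have "{u, x, y} \<in> X" using that(4) by (elim simplicial_complexD(3)[OF sc]) auto
    then show ?thesis using side_edge[OF that(5)] that assms T by auto
  qed
  \<comment> \<open>A dropped vertex \<open>t\<close> other than \<open>v\<close> and
    \<open>w\<close> leaves a face through both, which puts \<open>x\<close> in the link of the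
    edge.\<close>
  have half: "\<exists>x. x \<in> \<Union>?M - ?\<tau> \<and> x \<in> B" if B: "side u B" "u = v \<or> u = w" for u B
  proof -
    obtain t where t: "t \<in> \<sigma>" "t \<noteq> v" "t \<noteq> w" using pick[of v w w] by blast
    then obtain x where x: "x \<in> B" "x \<notin> \<sigma>" "insert x (\<sigma> - {t}) \<in> X"
      using side_inside[OF B(1), of t] B(2) assms by auto
    then have "{v, w, x} \<in> X" using t assms by (intro simplicial_complexD(3)[OF sc x(3)]) auto
    then show ?thesis using x T by blast
  qed
  have opp: "\<exists>x. x \<in> \<Union>?M - ?\<tau> \<and> x \<notin> B" if B: "side u B" "u = v \<or> u = w" for u B
  proof -
    obtain D where "side u D" "B \<inter> D = {}" using side_opposite[OF B(1)] B(2) assms by metis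
    then show ?thesis using half[of u D] B(2) by blast
  qed
  obtain x1 x2 y1 y2 where
    "x1 \<in> \<Union>?M - ?\<tau>" "x1 \<in> C" "x2 \<in> \<Union>?M - ?\<tau>" "x2 \<notin> C"
    "y1 \<in> \<Union>?M - ?\<tau>" "y1 \<in> C'" "y2 \<in> \<Union>?M - ?\<tau>" "y2 \<notin> C'"
    using half[OF assms(4)] opp[OF assms(4)] half[OF assms(5)] opp[OF assms(5)] by blast
  then have "(\<forall>x\<in>\<Union>?M - ?\<tau>. x \<in> C \<longleftrightarrow> x \<in> C') \<or> (\<forall>x\<in>\<Union>?M - ?\<tau>. x \<in> C \<longleftrightarrow> \<not> x \<in> C')"
    using edge[OF _ _ _ _ assms(4)] edge[OF _ _ _ _ assms(5)] k
    by (intro stacked_sides_unique[OF st _ mf cd, where P = "\<lambda>x. x \<in> C" and Q = "\<lambda>x. x \<in> C'"]) auto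
  then show ?thesis unfolding Ball_def T by blast
qed

text \<open>Sides are matched to a fixed one at \<open>u\<close>; what must be excluded is that two
  of them then oppose each other along their own edge.\<close>

lemma coherent_sides:
  obtains f where "\<And>v. v \<in> \<sigma> \<Longrightarrow> side v (f v)"
    "\<And>v w x. v \<in> \<sigma> \<Longrightarrow> w \<in> \<sigma> \<Longrightarrow> {v, w, x} \<in> X \<Longrightarrow> x \<notin> \<sigma> \<Longrightarrow> x \<in> f v \<longleftrightarrow> x \<in> f w"
proof -
  obtain u where u: "u \<in> \<sigma>" using pick by blast
  obtain C0 where C0: "side u C0" using side_exists[OF u] by blast
  have "\<exists>C. side v C \<and> (\<forall>x. {u, v, x} \<in> X \<longrightarrow> x \<notin> \<sigma> \<longrightarrow> (x \<in> C0 \<longleftrightarrow> x \<in> C))" if v: "v \<in> \<sigma>" for v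
  proof (cases "v = u")
    case True
    then show ?thesis using C0 by blast
  next
    case False
    obtain C where C: "side v C" using side_exists[OF v] by blast
    obtain D where D: "side v D" "C \<inter> D = {}" "\<And>x. {v, x} \<in> X \<Longrightarrow> x \<notin> \<sigma> \<Longrightarrow> x \<in> C \<union> D"
      using side_opposite[OF C v] by blast
    have "x \<in> D \<longleftrightarrow> x \<notin> C" if "{u, v, x} \<in> X" "x \<notin> \<sigma>" for x
    proof -
      have "{v, x} \<in> X" by (rule simplicial_complexD(3)[OF sc that(1)]) auto
      then show ?thesis using D that by blast
    qed
    then show ?thesis
      using sides_agree_or_oppose[OF u v _ C0 C] C D(1) False by blast
  qed
  then have "\<forall>v. \<exists>C. v \<in> \<sigma> \<longrightarrow> side v C \<and> (\<forall>x. {u, v, x} \<in> X \<longrightarrow> x \<notin> \<sigma> \<longrightarrow> (x \<in> C0 \<longleftrightarrow> x \<in> C))"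
    by blast
  then obtain f where "\<forall>v. v \<in> \<sigma> \<longrightarrow> side v (f v) \<and> (\<forall>x. {u, v, x} \<in> X \<longrightarrow> x \<notin> \<sigma> \<longrightarrow> (x \<in> C0 \<longleftrightarrow> x \<in> f v))"
    by (rule choice[THEN exE])
  then have f: "\<And>v. v \<in> \<sigma> \<Longrightarrow> side v (f v)"
    "\<And>v x. v \<in> \<sigma> \<Longrightarrow> {u, v, x} \<in> X \<Longrightarrow> x \<notin> \<sigma> \<Longrightarrow> x \<in> C0 \<longleftrightarrow> x \<in> f v" by blast+
  have "x \<in> f v \<longleftrightarrow> x \<in> f w" if vwx: "v \<in> \<sigma>" "w \<in> \<sigma>" "{v, w, x} \<in> X" "x \<notin> \<sigma>" for v w x
  proof (cases "v = w")
    case False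
    \<comment> \<open>The face \<open>insert y (\<sigma> - {t})\<close> contains \<open>u\<close>,
      \<open>v\<close> and \<open>w\<close>. As \<open>y\<close> is in \<open>C0\<close>, it lies in
      both \<open>f v\<close> and \<open>f w\<close>, so these cannot be opposite.\<close>
    obtain t where t: "t \<in> \<sigma>" "t \<noteq> u" "t \<noteq> v" "t \<noteq> w" using pick[of u v w] by blast
    obtain y where y: "y \<in> C0" "y \<notin> \<sigma>" "insert y (\<sigma> - {t}) \<in> X"
      by (rule side_inside[OF C0 u t(1,2)])
    have sub: "A \<in> X" if "A \<subseteq> insert y (\<sigma> - {t})" for A
      using simplicial_complexD(3)[OF sc y(3) that] .
    have "{u, v, y} \<in> X" "{u, w, y} \<in> X" "{v, w, y} \<in> X"
      using u vwx t by (auto intro!: sub)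
    then show ?thesis
      using f(2)[of v y] f(2)[of w y] y vwx
        sides_agree_or_oppose[OF vwx(1,2) False f(1)[OF vwx(1)] f(1)[OF vwx(2)]] by blast
  qed simp
  then show ?thesis using that f(1) by blast
qed

text \<open>A potential \<open>g\<close> of the crossing cocycle is constant along edges avoiding
  \<open>\<sigma>\<close>, hence constant on a connected complement. But next to a vertex
  \<open>v\<close> of \<open>\<sigma>\<close> it equals \<open>g v + 1\<close> on one side and
  \<open>g v\<close> on the other.\<close>

lemma disconnects:
  assumes H: "cocycles_trivial X"
  shows "\<not> induces_connected X (\<Union>X - \<sigma>)"
proof
  assume conn: "induces_connected X (\<Union>X - \<sigma>)"
  obtain f where f: "\<And>v. v \<in> \<sigma> \<Longrightarrow> side v (f v)"
    "\<And>v w x. v \<in> \<sigma> \<Longrightarrow> w \<in> \<sigma> \<Longrightarrow> {v, w, x} \<in> X \<Longrightarrow> x \<notin> \<sigma> \<Longrightarrow> x \<in> f v \<longleftrightarrow> x \<in> f w"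
    using coherent_sides by blast
  \<comment> \<open>\<open>c\<close> counts the edges leaving \<open>\<sigma>\<close> on the side \<open>f\<close>.\<close>
  define c :: "'a \<Rightarrow> 'a \<Rightarrow> int" where
    "c a b = (if a \<in> \<sigma> then if b \<in> \<sigma> then 0 else of_bool (b \<in> f a)
              else if b \<in> \<sigma> then - of_bool (a \<in> f b) else 0)" for a b
  have e: "of_bool (x \<in> f v) = (of_bool (y \<in> f v) :: int)"
    if "{v, x, y} \<in> X" "v \<in> \<sigma>" "x \<notin> \<sigma>" "y \<notin> \<sigma>" for v x y
    using side_edge[OF f(1) that(1)] that by simp
  have e': "of_bool (x \<in> f v) = (of_bool (x \<in> f w) :: int)"
    if "{v, w, x} \<in> X" "v \<in> \<sigma>" "w \<in> \<sigma>" "x \<notin> \<sigma>" for v w x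
    using f(2) that by simp
  \<comment> \<open>Triples with one entry in \<open>\<sigma>\<close> use \<open>side_edge\<close>;
    those with two use the coherence of \<open>f\<close>.\<close>
  have "cocycle X c"
    unfolding cocycle_def
  proof (intro allI impI)
    fix x y z assume "{x, y, z} \<in> X"
    then have "{x, y, z} \<in> X" "{y, z, x} \<in> X" "{z, x, y} \<in> X" by (simp_all add: insert_commute)
    then show "c x y + c y z + c z x = 0"
      unfolding c_def
      using e[of x y z] e[of y z x] e[of z x y] e'[of x y z] e'[of y z x] e'[of z x y] by auto
  qed
  then obtain g where g: "\<And>x y. {x, y} \<in> X \<Longrightarrow> c x y = g y - g x"
    using H unfolding cocycles_trivial_def by blast
  obtain v where v: "v \<in> \<sigma>" using pick by blast
  obtain t where t: "t \<in> \<sigma>" "t \<noteq> v" using pick[of v v v] by blast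
  obtain x where x: "x \<in> f v" "x \<notin> \<sigma>" "insert x (\<sigma> - {t}) \<in> X"
    by (rule side_inside[OF f(1)[OF v] v t])
  obtain D where D: "side v D" "f v \<inter> D = {}" by (rule side_opposite[OF f(1)[OF v] v]) (rule that)
  obtain y where y: "y \<in> D" "y \<notin> \<sigma>" "insert y (\<sigma> - {t}) \<in> X"
    by (rule side_inside[OF D(1) v t])
  have "{v, x} \<in> X" by (rule simplicial_complexD(3)[OF sc x(3)]) (use v t in auto)
  then have gx: "g x - g v = 1" using g[of v x] x v unfolding c_def by simp
  have "{v, y} \<in> X" by (rule simplicial_complexD(3)[OF sc y(3)]) (use v t in auto)
  moreover have "y \<notin> f v" using D y by blast
  ultimately have gy: "g y - g v = 0" using g[of v y] y v unfolding c_def by simp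
  have "g a = g b" if "a \<in> \<Union>X - \<sigma>" "b \<in> \<Union>X - \<sigma>" "{a, b} \<in> X" for a b
    using g[OF that(3)] that unfolding c_def by simp
  then have "g x = g y"
    by (rule induces_connected_const[OF conn]) (use x y in auto)
  then show False using gx gy by simp
qed

end

section \<open>Descent to a vertex whose link is a simplex boundary\<close>

lemma standard_link_exists:
  assumes X: "locally_stacked k X" and k: "k \<ge> 3" and H: "cocycles_trivial X"
  shows "\<exists>v\<in>\<Union>X. \<exists>A. finite A \<and> card A = k + 2 \<and> link X {v} = {\<sigma>. \<sigma> \<subset> A}"
proof (rule ccontr)
  assume neg: "\<not> ?thesis"
  note sc = locally_stackedD(1)[OF X]
  \<comment> \<open>The adjacency clause is recorded because it later confines the second missing
    face to \<open>C\<close> and \<open>\<sigma>\<close>.\<close>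
  have through: "\<exists>\<sigma>. missing_face X \<sigma> \<and> card \<sigma> = k + 2 \<and> v \<in> \<sigma> \<and> (\<forall>x\<in>\<sigma>. {v, x} \<in> X)"
    if v: "v \<in> \<Union>X" for v
  proof -
    have "\<nexists>A. finite A \<and> card A = k + 2 \<and> link X {v} = {\<sigma>. \<sigma> \<subset> A}" by (rule contrapos_nn[OF neg]) (rule bexI[OF _ v])
    then obtain \<alpha> where \<alpha>: "missing_face (link X {v}) \<alpha>" "card \<alpha> = k + 1"
      using stacked_nonstandard_missing_face[OF locally_stackedD(4)[OF X v]] by blast
    note L = link_missing_face[OF X k v \<alpha>]
    have "finite \<alpha>" using \<alpha> unfolding missing_face_def by blast
    then have cd: "card (insert v \<alpha>) = k + 2" using L \<alpha> by simp
    have "{v, x} \<in> X" if "x \<in> insert v \<alpha>" for x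
    proof -
      have "card {v, x} < card (insert v \<alpha>)" using cd k by (auto simp: card_insert_if)
      then have "{v, x} \<noteq> insert v \<alpha>" by (metis less_irrefl)
      then have "{v, x} \<subset> insert v \<alpha>" using that by blast
      then show ?thesis using L unfolding missing_face_def by blast
    qed
    then show ?thesis using L cd by blast
  qed
  \<comment> \<open>Through a vertex of the side \<open>C\<close> of \<open>\<sigma>\<close> passes another missing face, one side of which lies strictly
    inside \<open>C\<close>.\<close>
  have False if "missing_face X \<sigma>" "card \<sigma> = k + 2" "C \<subseteq> \<Union>X - \<sigma>" "C \<noteq> {}" "C \<noteq> \<Union>X - \<sigma>"
    "\<And>x y. x \<in> C \<Longrightarrow> y \<in> \<Union>X - \<sigma> \<Longrightarrow> {x, y} \<in> X \<Longrightarrow> y \<in> C" for \<sigma> C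
    using that
  proof (induction "card C" arbitrary: \<sigma> C rule: less_induct)
    case (less C \<sigma>)
    let ?V = "\<Union>X"
    obtain v where v: "v \<in> C" using less.prems by blast
    then have vV: "v \<in> ?V" "v \<notin> \<sigma>" using less.prems by blast+
    obtain \<sigma>' where \<sigma>': "missing_face X \<sigma>'" "card \<sigma>' = k + 2" "v \<in> \<sigma>'" "\<And>x. x \<in> \<sigma>' \<Longrightarrow> {v, x} \<in> X"
      using through[OF vV(1)] by blast
    interpret S: missing_facet k X \<sigma> using X k less.prems(1,2) by unfold_locales
    interpret S': missing_facet k X \<sigma>' using X k \<sigma>'(1,2) by unfold_locales
    have \<sigma>'C: "x \<in> C \<or> x \<in> \<sigma>" if "x \<in> \<sigma>'" for x
      using less.prems(6)[OF v, of x] \<sigma>'(4)[OF that] S'.vert[OF that] by blast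
    have "\<not> \<sigma> \<subseteq> \<sigma>'" using card_subset_eq[OF S'.fin, of \<sigma>] less.prems(2) \<sigma>'(2,3) vV by auto
    then obtain s where s: "s \<in> \<sigma>" "s \<notin> \<sigma>'" by blast
    have "\<not> induces_connected X (?V - \<sigma>')" using S'.disconnects[OF H] .
    then obtain E where E: "E \<subseteq> ?V - \<sigma>'" "E \<noteq> {}" "E \<noteq> ?V - \<sigma>'"
      "\<And>x y. x \<in> E \<Longrightarrow> y \<in> ?V - \<sigma>' \<Longrightarrow> {x, y} \<in> X \<Longrightarrow> y \<in> E"
      unfolding induces_connected_def by blast
    \<comment> \<open>A closed set and its complement off \<open>\<sigma>'\<close> are both closed,
      so the one without \<open>s\<close> can be taken.\<close>
    have "\<exists>E. E \<subseteq> ?V - \<sigma>' \<and> E \<noteq> {} \<and> s \<notin> E \<and> (\<forall>x\<in>E. \<forall>y\<in>?V - \<sigma>'. {x, y} \<in> X \<longrightarrow> y \<in> E)"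
    proof (cases "s \<in> E")
      case True
      have "y \<in> ?V - \<sigma>' - E" if "x \<in> ?V - \<sigma>' - E" "y \<in> ?V - \<sigma>'" "{x, y} \<in> X" for x y
        using E(4)[of y x] that by (auto simp: insert_commute)
      then show ?thesis using True E by (intro exI[of _ "?V - \<sigma>' - E"]) blast
    next
      case False
      then show ?thesis using E by blast
    qed
    then obtain E' where E'1: "E' \<subseteq> ?V - \<sigma>'" "E' \<noteq> {}" "s \<notin> E'"
      "\<forall>x\<in>E'. \<forall>y\<in>?V - \<sigma>'. {x, y} \<in> X \<longrightarrow> y \<in> E'" by (elim exE conjE)
    note E' = E'1(1-3) E'1(4)[rule_format]
    \<comment> \<open>Two vertices of \<open>\<sigma>\<close> are always adjacent, so a vertex of
      \<open>\<sigma>\<close> in \<open>E'\<close> would pull \<open>s\<close> into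
      \<open>E'\<close>.\<close>
    have E'\<sigma>: "y \<notin> E'" if y: "y \<in> \<sigma>" for y
    proof
      assume "y \<in> E'"
      have "card {y, s} < card \<sigma>" using less.prems(2) k by (auto simp: card_insert_if)
      then have "{y, s} \<subset> \<sigma>" using y s by auto
      then show False using E'(4)[OF \<open>y \<in> E'\<close>, of s] S.proper S.vert[OF s(1)] s E'(3) by blast
    qed
    let ?K = "E' - C"
    \<comment> \<open>The part of \<open>E'\<close> outside \<open>C\<close> is closed under edges
      off \<open>\<sigma> \<inter> \<sigma>'\<close>, because \<open>C\<close> is closed off
      \<open>\<sigma>\<close> and \<open>\<sigma>'\<close> lies in
      \<open>C \<union> \<sigma>\<close>. As \<open>\<sigma> \<inter> \<sigma>'\<close> is a face,
      its complement is connected; it contains \<open>s\<close>, which \<open>E'\<close> does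
      not.\<close>
    have "?K = {}"
    proof (rule ccontr)
      assume "?K \<noteq> {}"
      then obtain x where x: "x \<in> ?K" by blast
      have "\<sigma> \<inter> \<sigma>' \<subset> \<sigma>" using s by blast
      then have cn: "induces_connected X (?V - \<sigma> \<inter> \<sigma>')"
        using locally_stacked_avoid[OF X] S.proper k by simp
      have "?K = ?V - \<sigma> \<inter> \<sigma>'"
      proof (rule induces_connectedD[OF cn _ x])
        show "?K \<subseteq> ?V - \<sigma> \<inter> \<sigma>'" using E' by blast
        fix a b assume ab: "a \<in> ?K" "b \<in> ?V - \<sigma> \<inter> \<sigma>'" "{a, b} \<in> X"
        have aV: "a \<in> ?V - \<sigma>" using ab E' E'\<sigma> by blast
        have bC: "b \<notin> C" using less.prems(6)[of b a] ab aV by (auto simp: insert_commute)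
        have "b \<notin> \<sigma>'" using \<sigma>'C[of b] bC ab by blast
        then show "b \<in> ?K" using E'(4)[of a b] ab bC by blast
      qed
      then show False using s E'(3) S.vert[OF s(1)] by blast
    qed
    then have "E' \<subseteq> C" by blast
    moreover have "v \<notin> E'" using E'(1) \<sigma>'(3) by blast
    ultimately have "E' \<subset> C" using v by blast
    moreover have "finite C" using less.prems(3) finite_vertices[OF sc] by (meson Diff_subset finite_subset)
    ultimately have "card E' < card C" by (rule psubset_card_mono[rotated])
    moreover have "E' \<noteq> ?V - \<sigma>'" using s S.vert[OF s(1)] E'(3) by blast
    ultimately show False using less.hyps[of E' \<sigma>'] \<sigma>'(1,2) E' by blast
  qed
  note descent = this
  obtain v where "v \<in> \<Union>X" using locally_stackedD(2)[OF X] by blast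
  then obtain \<sigma> where \<sigma>: "missing_face X \<sigma>" "card \<sigma> = k + 2" using through by blast
  interpret missing_facet k X \<sigma> using X k \<sigma> by unfold_locales
  show False using disconnects[OF H] descent[OF \<sigma>] unfolding induces_connected_def by blast
qed

text \<open>By \<open>stacked_contains_standard\<close> each vertex of \<open>D\<close> has link
  exactly the boundary of the opposite face, so no edge leaves \<open>D\<close>, and connectivity
  makes \<open>D\<close> the whole vertex set. The same links show that \<open>D\<close> itself is
  not a face.\<close>

lemma locally_stacked_contains_standard:
  assumes X: "locally_stacked k X" and k: "k \<ge> 1" and D: "finite D" "card D = k + 3" "{\<sigma>. \<sigma> \<subset> D} \<subseteq> X"
  shows "X = {\<sigma>. \<sigma> \<subset> D}"
proof -
  note sc = locally_stackedD(1)[OF X]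
  have "\<Union>{\<sigma>. \<sigma> \<subset> D} = D" using D by (intro Union_psubsets) auto
  moreover have "\<Union>{\<sigma>. \<sigma> \<subset> D} \<subseteq> \<Union>X" using D(3) by (rule Union_mono)
  ultimately have DX: "D \<subseteq> \<Union>X" by metis
  have lk: "link X {a} = {\<sigma>. \<sigma> \<subset> D - {a}}" if a: "a \<in> D" for a
  proof (rule stacked_contains_standard[OF locally_stackedD(4)[OF X] k])
    show "a \<in> \<Union>X" using a DX by blast
    show "finite (D - {a})" "card (D - {a}) = k + 2" using D a by auto
    show "{\<sigma>. \<sigma> \<subset> D - {a}} \<subseteq> link X {a}"
    proof
      fix \<tau> assume "\<tau> \<in> {\<sigma>. \<sigma> \<subset> D - {a}}"
      then have "insert a \<tau> \<in> {\<sigma>. \<sigma> \<subset> D}" "a \<notin> \<tau>" using a by auto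
      then show "\<tau> \<in> link X {a}" using D(3) mem_link_vertex[OF sc, of \<tau> a] by blast
    qed
  qed
  obtain a0 where a0: "a0 \<in> D" using D(2) by fastforce
  have "D = \<Union>X"
  proof (rule induces_connectedD[OF locally_stackedD(3)[OF X] DX a0])
    fix x y assume xy: "x \<in> D" "{x, y} \<in> X"
    show "y \<in> D"
    proof (cases "y = x")
      case False
      then have "{y} \<in> link X {x}" using mem_link_vertex[OF sc, of "{y}" x] xy by simp
      then show ?thesis using lk[OF xy(1)] by blast
    qed (use xy in simp)
  qed
  have "\<tau> \<subset> D" if "\<tau> \<in> X" for \<tau>
  proof -
    have "\<tau> \<noteq> D"
    proof
      assume "\<tau> = D"
      then have "D - {a0} \<in> link X {a0}"
        using mem_link_vertex[OF sc, of "D - {a0}" a0] that a0 by (simp add: insert_absorb)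
      then show False using lk[OF a0] by blast
    qed
    then show ?thesis using that \<open>D = \<Union>X\<close> by blast
  qed
  then show ?thesis using D(3) by blast
qed

section \<open>Removing a vertex whose link is a simplex boundary\<close>

locale standard_link =
  fixes k :: nat and X :: "'a set set" and v :: 'a and A :: "'a set"
  assumes X: "locally_stacked k X" and k: "k \<ge> 2" and v: "v \<in> \<Union>X"
    and A: "finite A" "card A = k + 2" and lk: "link X {v} = {\<sigma>. \<sigma> \<subset> A}" and AX: "A \<notin> X"
begin

lemma sc: "simplicial_complex X"
  using locally_stackedD(1)[OF X] .

lemma star_v: "v \<notin> \<tau> \<Longrightarrow> insert v \<tau> \<in> X \<longleftrightarrow> \<tau> \<subset> A"
  using mem_link_vertex[OF sc, of \<tau> v] lk by simp

lemma vA: "v \<notin> A"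
proof
  assume "v \<in> A"
  then have "{v} \<subset> A" using A by auto
  then have "{v} \<in> link X {v}" using lk by simp
  then show False using mem_link_vertex[OF sc, of "{v}" v] by simp
qed

lemma proper: "\<tau> \<subset> A \<Longrightarrow> \<tau> \<in> X"
proof -
  assume "\<tau> \<subset> A"
  then have "\<tau> \<in> link X {v}" using lk by simp
  then show ?thesis unfolding link_def by simp
qed

lemma A_sub: "A \<subseteq> \<Union>X - {v}"
proof
  fix a assume a: "a \<in> A"
  then have "{a} \<subset> A" using A by auto
  then show "a \<in> \<Union>X - {v}" using proper a vA by blast
qed

lemma mem_unstar: "\<tau> \<in> unstar X v A \<longleftrightarrow> \<tau> = A \<or> \<tau> \<in> X \<and> v \<notin> \<tau>"
  unfolding unstar_def by simp

lemma unstar_complex: "simplicial_complex (unstar X v A)"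
proof -
  have "finite (unstar X v A)" using simplicial_complexD(1)[OF sc] unfolding unstar_def by simp
  moreover have "finite \<sigma>" if "\<sigma> \<in> unstar X v A" for \<sigma>
    using that mem_unstar simplicial_complexD(2)[OF sc] A(1) by metis
  moreover have "\<tau> \<in> unstar X v A" if \<sigma>: "\<sigma> \<in> unstar X v A" and \<tau>: "\<tau> \<subseteq> \<sigma>" for \<sigma> \<tau>
  proof (cases "\<sigma> = A")
    case True
    then show ?thesis using \<tau> proper[of \<tau>] vA unfolding mem_unstar by blast
  next
    case False
    then show ?thesis using \<tau> \<sigma> simplicial_complexD(3)[OF sc, of \<sigma> \<tau>] unfolding mem_unstar by blast
  qed
  ultimately show ?thesis unfolding simplicial_complex_def by blast
qed

lemma Union_unstar: "\<Union>(unstar X v A) = \<Union>X - {v}"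
proof
  show "\<Union>(unstar X v A) \<subseteq> \<Union>X - {v}"
    unfolding unstar_def using A_sub by blast
  show "\<Union>X - {v} \<subseteq> \<Union>(unstar X v A)"
  proof
    fix x assume x: "x \<in> \<Union>X - {v}"
    then have "{x} \<in> X" using vertex_iff[OF sc] by blast
    then have "{x} \<in> unstar X v A" using x mem_unstar by auto
    then show "x \<in> \<Union>(unstar X v A)" by blast
  qed
qed

lemma link_unstar_off:
  assumes "u \<noteq> v" "u \<notin> A"
  shows "link (unstar X v A) {u} = link X {u}"
proof (intro set_eqI)
  fix \<tau>
  have "\<not> insert u \<tau> \<in> X" if "v \<in> \<tau>"
  proof
    assume "insert u \<tau> \<in> X"
    then have "insert v {u} \<in> X" by (rule simplicial_complexD(3)[OF sc]) (use that in auto)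
    then show False using star_v[of "{u}"] assms by auto
  qed
  then show "\<tau> \<in> link (unstar X v A) {u} \<longleftrightarrow> \<tau> \<in> link X {u}"
    unfolding mem_link_vertex[OF sc] mem_link_vertex[OF unstar_complex] mem_unstar using assms by auto
qed

lemma link_unstar_on:
  assumes u: "u \<in> A"
  shows "link (unstar X v A) {u} = unstar (link X {u}) v (A - {u})"
proof (intro set_eqI)
  fix \<tau>
  have "u \<noteq> v" using u vA by blast
  moreover have "u \<notin> \<tau> \<and> insert u \<tau> = A \<longleftrightarrow> \<tau> = A - {u}" using u by blast
  ultimately show "\<tau> \<in> link (unstar X v A) {u} \<longleftrightarrow> \<tau> \<in> unstar (link X {u}) v (A - {u})"
    unfolding mem_link_vertex[OF unstar_complex] mem_unstar
    unfolding unstar_def insert_iff mem_Collect_eq mem_link_vertex[OF sc] by auto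
qed

text \<open>For \<open>u\<close> in \<open>A\<close>, the link of \<open>v\<close> within the link
  of \<open>u\<close> is the boundary of \<open>A - {u}\<close>, and \<open>A \<notin> X\<close>
  keeps \<open>A - {u}\<close> out of that link. So \<open>stacked_unstar\<close> applies one
  dimension lower.\<close>

lemma link_unstar_stacked:
  assumes "u \<in> \<Union>X - {v}"
  shows "stacked_sphere k (link (unstar X v A) {u})"
proof (cases "u \<in> A")
  case False
  then show ?thesis using link_unstar_off[of u] locally_stackedD(4)[OF X, of u] assms by auto
next
  case True
  note mL = mem_link_vertex[OF sc, of _ u]
  have "stacked_sphere k (unstar (link X {u}) v (A - {u}))"
  proof (rule stacked_unstar[OF locally_stackedD(4)[OF X] k])
    show "u \<in> \<Union>X" using assms by blast
    have "{u} \<subset> A" using True A by auto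
    then have "insert v {u} \<in> X" using star_v[of "{u}"] assms by auto
    then have "{v} \<in> link X {u}" using mL[of "{v}"] assms by (simp add: insert_commute)
    then show "v \<in> \<Union>(link X {u})" by blast
    show "finite (A - {u})" "card (A - {u}) = k + 1" using A True by auto
    show "A - {u} \<notin> link X {u}" using mL[of "A - {u}"] True AX by (simp add: insert_absorb)
    show "link (link X {u}) {v} = {\<sigma>. \<sigma> \<subset> A - {u}}"
    proof (intro set_eqI)
      fix \<tau>
      have "\<tau> \<in> link (link X {u}) {v} \<longleftrightarrow> v \<notin> \<tau> \<and> u \<notin> insert v \<tau> \<and> insert u (insert v \<tau>) \<in> X"
        using mem_link_vertex[OF link_complex[OF sc], of \<tau> u v] mL[of "insert v \<tau>"] by simp
      also have "\<dots> \<longleftrightarrow> v \<notin> \<tau> \<and> u \<notin> \<tau> \<and> insert u \<tau> \<subset> A"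
        using star_v[of "insert u \<tau>"] assms by (auto simp: insert_commute)
      also have "\<dots> \<longleftrightarrow> \<tau> \<subset> A - {u}" using vA True by blast
      finally show "\<tau> \<in> link (link X {u}) {v} \<longleftrightarrow> \<tau> \<in> {\<sigma>. \<sigma> \<subset> A - {u}}" by simp
    qed
  qed
  then show ?thesis using link_unstar_on[OF True] by simp
qed

lemma unstar_locally_stacked: "locally_stacked k (unstar X v A)"
proof -
  have "{v} \<in> X" using v vertex_iff[OF sc] by blast
  then have "induces_connected X (\<Union>X - {v})" by (rule locally_stacked_avoid[OF X k])
  then have "induces_connected (unstar X v A) (\<Union>X - {v})"
    by (rule induces_connected_mono) (unfold mem_unstar, blast)
  moreover have "\<Union>X - {v} \<noteq> {}"
  proof
    assume "\<Union>X - {v} = {}"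
    with A_sub have "A = {}" by (metis subset_empty)
    then show False using A by simp
  qed
  ultimately show ?thesis
    using unstar_complex link_unstar_stacked by (simp add: locally_stacked_def Union_unstar)
qed

text \<open>Sending \<open>v\<close> to a vertex \<open>a0\<close> of \<open>A\<close> and fixing
  the rest is a simplicial map from \<open>X\<close> to the smaller complex: faces through
  \<open>v\<close> go into \<open>A\<close>, which is now a face. A cocycle is pulled back along it,
  and the potential found on \<open>X\<close> is restricted.\<close>

lemma unstar_cocycles_trivial:
  assumes "cocycles_trivial X"
  shows "cocycles_trivial (unstar X v A)"
  unfolding cocycles_trivial_def
proof (intro allI impI)
  fix c assume c: "cocycle (unstar X v A) c"
  obtain a0 where a0: "a0 \<in> A" using A(2) by fastforce
  have c3: "c x y + c y z + c z x = 0" if "{x, y, z} \<in> unstar X v A" for x y z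
    using c that unfolding cocycle_def by blast
  have anti: "c y x = - c x y" if "{x, y} \<in> unstar X v A" for x y
    using c3[of x y y] c3[of y y y] that simplicial_complexD(3)[OF unstar_complex that, of "{y}"] by simp
  have inA: "\<tau> \<in> unstar X v A" if "\<tau> \<subseteq> A" for \<tau>
    using simplicial_complexD(3)[OF unstar_complex _ that] mem_unstar by blast
  \<comment> \<open>\<open>v\<close> copies the values of \<open>a0\<close>; the value 0 at
    \<open>(v, v)\<close> agrees with \<open>c a0 a0\<close>.\<close>
  define c' where "c' x y = (if x = v then if y = v then 0 else c a0 y
     else if y = v then c x a0 else c x y)" for x y
  have nb: "x \<in> A" if "{v, x, y} \<in> X" "x \<noteq> v" for x y
  proof -
    have "insert v {x} \<in> X" by (rule simplicial_complexD(3)[OF sc that(1)]) blast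
    then show ?thesis using star_v[of "{x}"] that by blast
  qed
  have tri: "c a0 x + c x y + c y a0 = 0" if "{v, x, y} \<in> X" "x \<noteq> v" "y \<noteq> v" for x y
    using nb[of x y] nb[of y x] that a0 by (intro c3 inA) (auto simp: insert_commute)
  have two: "c a0 x + c x a0 = 0" if "{v, x, y} \<in> X" "x \<noteq> v" for x y
    using anti[of a0 x] inA[of "{a0, x}"] nb[OF that] a0 by simp
  have "cocycle X c'"
    unfolding cocycle_def
  proof (intro allI impI)
    fix x y z assume *: "{x, y, z} \<in> X"
    have p: "{x, z, y} \<in> X" "{y, x, z} \<in> X" "{y, z, x} \<in> X" "{z, x, y} \<in> X" "{z, y, x} \<in> X"
      using * by (simp_all add: insert_commute)
    show "c' x y + c' y z + c' z x = 0"
    proof (cases "v \<in> {x, y, z}")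
      case False
      then have "{x, y, z} \<in> unstar X v A" using * mem_unstar by blast
      then show ?thesis using c3 False unfolding c'_def by auto
    next
      case True
      then show ?thesis
        unfolding c'_def
        using tri[of y z] tri[of z x] tri[of x y] two[of x y] two[of x z] two[of y x] two[of y z]
          two[of z x] two[of z y] * p
        by (auto simp: insert_commute algebra_simps)
    qed
  qed
  then obtain g where g: "\<And>x y. {x, y} \<in> X \<Longrightarrow> c' x y = g y - g x"
    using assms unfolding cocycles_trivial_def by blast
  have "c x y = g y - g x" if xy: "{x, y} \<in> unstar X v A" for x y
  proof -
    have "card {x, y} < card A" using A k by (auto simp: card_insert_if)
    then have "{x, y} \<in> X" "v \<notin> {x, y}" using xy unfolding mem_unstar by auto
    then show ?thesis using g[of x y] unfolding c'_def by auto
  qed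
  then show "\<exists>g. \<forall>x y. {x, y} \<in> unstar X v A \<longrightarrow> c x y = g y - g x" by blast
qed

lemma stellar_unstar: "stellar (unstar X v A) A v = X"
proof (intro set_eqI)
  fix \<tau>
  have "v \<notin> \<Union>(unstar X v A)" unfolding Union_unstar by blast
  then have "\<tau> \<in> stellar (unstar X v A) A v \<longleftrightarrow>
      (if v \<in> \<tau> then \<tau> - {v} \<subset> A else \<tau> \<in> unstar X v A \<and> \<tau> \<noteq> A)"
    by (rule mem_stellar_iff) (simp add: mem_unstar)
  also have "\<dots> \<longleftrightarrow> \<tau> \<in> X"
  proof (cases "v \<in> \<tau>")
    case True
    then show ?thesis using star_v[of "\<tau> - {v}"] by (simp add: insert_absorb)
  next
    case False
    then show ?thesis using AX unfolding mem_unstar by auto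
  qed
  finally show "\<tau> \<in> stellar (unstar X v A) A v \<longleftrightarrow> \<tau> \<in> X" .
qed

lemma stacked_of_unstar:
  assumes "stacked_sphere (Suc k) (unstar X v A)"
  shows "stacked_sphere (Suc k) X"
proof -
  have "A \<in> facets (unstar X v A)"
    unfolding facets_uniform[OF stacked_uniform[OF assms]] using A mem_unstar by simp
  then have "stacked_sphere (Suc k) (stellar (unstar X v A) A v)"
    by (intro stacked_stellar[OF assms]) (simp_all add: Union_unstar)
  then show ?thesis using stellar_unstar by simp
qed

end

text \<open>If \<open>A\<close> is a face, the boundary of \<open>insert v A\<close> lies in
  \<open>X\<close> and is all of it: the base case. Otherwise removing \<open>v\<close> lowers the
  number of vertices and preserves every hypothesis.\<close>

theorem stacked_if_locally_stacked:
  assumes "locally_stacked k X" "k \<ge> 3" "cocycles_trivial X"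
  shows "stacked_sphere (Suc k) X"
  using assms
proof (induction "card (\<Union>X)" arbitrary: X rule: less_induct)
  case (less X)
  note sc = locally_stackedD(1)[OF less.prems(1)]
  obtain v A where v: "v \<in> \<Union>X" and A: "finite A" "card A = k + 2" and lk: "link X {v} = {\<sigma>. \<sigma> \<subset> A}"
    using standard_link_exists[OF less.prems] by blast
  show ?case
  proof (cases "A \<in> X")
    case True
    have vA: "v \<notin> A"
    proof
      assume "v \<in> A"
      then have "{v} \<subset> A" using A by auto
      then have "{v} \<in> link X {v}" using lk by simp
      then show False using mem_link_vertex[OF sc, of "{v}" v] by simp
    qed
    have sub: "\<sigma> \<in> X" if \<sigma>: "\<sigma> \<subset> insert v A" for \<sigma>
    proof (cases "v \<in> \<sigma>")
      case v\<sigma>: True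
      then have "\<sigma> - {v} \<subset> A" using \<sigma> by blast
      then have "\<sigma> - {v} \<in> link X {v}" using lk by simp
      then show ?thesis using mem_link_vertex[OF sc, of "\<sigma> - {v}" v] v\<sigma> by (simp add: insert_absorb)
    next
      case False
      then have "\<sigma> \<subseteq> A" using \<sigma> by blast
      then show ?thesis using simplicial_complexD(3)[OF sc True] by blast
    qed
    have D: "finite (insert v A)" "card (insert v A) = k + 3" using A vA by auto
    have "X = {\<sigma>. \<sigma> \<subset> insert v A}"
      by (rule locally_stacked_contains_standard[OF less.prems(1) _ D]) (use sub less.prems(2) in auto)
    then show ?thesis using stacked_sphere.standard[of "insert v A" "Suc k"] D by simp
  next
    case False
    interpret standard_link k X v A
      using less.prems(1,2) v A lk False by unfold_locales auto
    have "finite (\<Union>X)" using finite_vertices[OF sc] .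
    then have "card (\<Union>(unstar X v A)) < card (\<Union>X)"
      unfolding Union_unstar using v by (rule card_Diff1_less)
    then have "stacked_sphere (Suc k) (unstar X v A)"
      by (rule less.hyps[OF _ unstar_locally_stacked less.prems(2) unstar_cocycles_trivial[OF less.prems(3)]])
    then show ?thesis by (rule stacked_of_unstar)
  qed
qed

section \<open>A van Kampen argument for the simplex boundary\<close>

text \<open>A path in \<open>V\<close> from a point of \<open>U \<inter> V\<close> to
  \<open>a\<close> is homotopic, within the simply connected \<open>V\<close>, to one inside the
  path-connected intersection.\<close>

lemma connector_change:
  fixes U :: "'a::real_normed_vector set"
  assumes V: "simply_connected V" and UV: "path_connected (U \<inter> V)" and a: "a \<in> U \<inter> V" and z: "z \<in> U"
    and r: "path r" "pathstart r = z" "pathfinish r = a" "path_image r \<subseteq> U \<or> path_image r \<subseteq> V"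
  shows "\<exists>s. path s \<and> pathstart s = z \<and> pathfinish s = a \<and> path_image s \<subseteq> U \<and> homotopic_paths (U \<union> V) r s"
proof (cases "path_image r \<subseteq> U")
  case True
  then have "homotopic_paths (U \<union> V) r r" using r by auto
  then show ?thesis using True r by blast
next
  case False
  then have rV: "path_image r \<subseteq> V" using r by blast
  then have "z \<in> U \<inter> V" using z r by (metis IntI pathstart_in_path_image subsetD)
  then obtain s where s: "path s" "path_image s \<subseteq> U \<inter> V" "pathstart s = z" "pathfinish s = a"
    using UV a unfolding path_connected_def by blast
  then have "homotopic_paths V r s"
    using V r rV unfolding simply_connected_eq_homotopic_paths by auto
  then have "homotopic_paths (U \<union> V) r s" by (rule homotopic_paths_subset) simp
  then show ?thesis using s by blast
qed

text \<open>After both connectors are moved into \<open>U\<close>, all paths lie in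
  \<open>U\<close>, where equal endpoints suffice for homotopy.\<close>

lemma connector_slide:
  fixes U :: "'a::real_normed_vector set"
  assumes U: "simply_connected U" and V: "simply_connected V"
    and UV: "path_connected (U \<inter> V)" and a: "a \<in> U \<inter> V"
    and p: "path p" "path_image p \<subseteq> U"
    and r: "path r" "pathstart r = pathstart p" "pathfinish r = a" "path_image r \<subseteq> U \<or> path_image r \<subseteq> V"
    and r': "path r'" "pathstart r' = pathfinish p" "pathfinish r' = a" "path_image r' \<subseteq> U \<or> path_image r' \<subseteq> V"
  shows "homotopic_paths (U \<union> V) (p +++ r') r"
proof -
  have ends: "pathstart p \<in> U" "pathfinish p \<in> U" using p by auto
  obtain s where s: "path s" "pathstart s = pathstart p" "pathfinish s = a" "path_image s \<subseteq> U"
    "homotopic_paths (U \<union> V) r s"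
    using connector_change[OF V UV a ends(1) r] by blast
  obtain s' where s': "path s'" "pathstart s' = pathfinish p" "pathfinish s' = a" "path_image s' \<subseteq> U"
    "homotopic_paths (U \<union> V) r' s'"
    using connector_change[OF V UV a ends(2) r'] by blast
  have "homotopic_paths (U \<union> V) (p +++ r') (p +++ s')"
    using p r' s' by (intro homotopic_paths_join) auto
  also have "homotopic_paths U (p +++ s') s"
    using U p s s' unfolding simply_connected_eq_homotopic_paths
    by (auto simp: path_image_join)
  then have "homotopic_paths (U \<union> V) (p +++ s') s" by (rule homotopic_paths_subset) simp
  also have "homotopic_paths (U \<union> V) s r" using s by (simp add: homotopic_paths_sym)
  finally show ?thesis .
qed

text \<open>The special case of van Kampen with two simply connected pieces. Each point has a
  connector to \<open>a\<close> inside one piece; moving the endpoint along small subpaths never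
  changes the homotopy class.\<close>

theorem simply_connected_openin_Un:
  fixes S :: "'a::real_normed_vector set"
  assumes oU: "openin (top_of_set S) U" and oV: "openin (top_of_set S) V" and S: "S = U \<union> V"
    and U: "simply_connected U" and V: "simply_connected V"
    and UV: "path_connected (U \<inter> V)" and ne: "U \<inter> V \<noteq> {}"
  shows "simply_connected S"
proof -
  obtain a where a: "a \<in> U \<inter> V" using ne by blast
  have VU: "path_connected (V \<inter> U)" "a \<in> V \<inter> U" using UV a by (simp_all add: Int_commute)
  define conn where "conn z r \<longleftrightarrow> path r \<and> pathstart r = z \<and> pathfinish r = a \<and>
      (path_image r \<subseteq> U \<or> path_image r \<subseteq> V)" for z r
  have connS: "path_image r \<subseteq> S" if "conn z r" for z r using that S unfolding conn_def by blast
  have ex_conn: "\<exists>r. conn z r" if "z \<in> S" for z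
  proof -
    have "path_connected U" "path_connected V"
      using U V simply_connected_imp_path_connected by blast+
    then show ?thesis
      using that a S unfolding conn_def path_connected_def by (metis IntD1 IntD2 UnE)
  qed
  \<comment> \<open>Sliding the endpoint of a connector to the base point along \<open>p\<close> keeps its homotopy class.\<close>
  define good where "good p \<longleftrightarrow> (\<forall>r r'. conn (pathstart p) r \<longrightarrow> conn (pathfinish p) r' \<longrightarrow>
      homotopic_paths S (p +++ r') r)" for p
  have piece: "good p" if "path p" "path_image p \<subseteq> U \<or> path_image p \<subseteq> V" for p
    unfolding good_def
  proof (intro allI impI)
    fix r r' assume r: "conn (pathstart p) r" and r': "conn (pathfinish p) r'"
    show "homotopic_paths S (p +++ r') r"
    proof (cases "path_image p \<subseteq> U")
      case True
      show ?thesis unfolding S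
        by (rule connector_slide[OF U V UV a that(1) True]) (use r r' in \<open>auto simp: conn_def\<close>)
    next
      case False
      then have pV: "path_image p \<subseteq> V" using that by blast
      have "homotopic_paths (V \<union> U) (p +++ r') r"
        by (rule connector_slide[OF V U VU that(1) pV]) (use r r' in \<open>auto simp: conn_def\<close>)
      then show ?thesis unfolding S by (simp add: Un_commute)
    qed
  qed
  \<comment> \<open>Stated up to homotopy because two joined subpaths match the longer subpath only
    up to reparametrization.\<close>
  have join: "good q"
    if p: "path p1" "path_image p1 \<subseteq> S" "path p2" "path_image p2 \<subseteq> S" "pathfinish p1 = pathstart p2"
      and g: "good p1" "good p2" and q: "homotopic_paths S (p1 +++ p2) q" for p1 p2 q
    unfolding good_def
  proof (intro allI impI)
    fix r r' assume r: "conn (pathstart q) r" and r': "conn (pathfinish q) r'"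
    have ends: "pathstart q = pathstart p1" "pathfinish q = pathfinish p2"
      using homotopic_paths_imp_pathstart[OF q] homotopic_paths_imp_pathfinish[OF q] by auto
    have "pathstart p2 \<in> S" using p by (meson pathstart_in_path_image subsetD)
    then obtain m where m: "conn (pathstart p2) m" using ex_conn by blast
    have r'': "path r'" "pathstart r' = pathfinish p2" "path_image r' \<subseteq> S"
      using r' ends connS unfolding conn_def by auto
    have "homotopic_paths S (q +++ r') ((p1 +++ p2) +++ r')"
      using q r'' ends by (intro homotopic_paths_join) (auto simp: homotopic_paths_sym)
    also have "homotopic_paths S ((p1 +++ p2) +++ r') (p1 +++ (p2 +++ r'))"
      using p r'' by (intro homotopic_paths_sym[OF homotopic_paths_assoc]) auto
    also have "homotopic_paths S (p1 +++ (p2 +++ r')) (p1 +++ m)"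
      using p r'' g(2) m r' ends unfolding good_def by (intro homotopic_paths_join) auto
    also have "homotopic_paths S (p1 +++ m) r"
      using g(1) r m ends p(5) unfolding good_def by auto
    finally show "homotopic_paths S (q +++ r') r" .
  qed
  have good: "good p" if p: "path p" "path_image p \<subseteq> S" for p
  proof -
    have cp: "continuous_on {0..1} p" using p unfolding path_def by blast
    have pS: "p \<in> {0..1} \<rightarrow> S" using p unfolding path_image_def by blast
    obtain A where A: "open A" "{0..1} \<inter> p -` U = {0..1} \<inter> A"
      using continuous_openin_preimage[OF cp pS oU] unfolding openin_open by blast
    obtain B where B: "open B" "{0..1} \<inter> p -` V = {0..1} \<inter> B"
      using continuous_openin_preimage[OF cp pS oV] unfolding openin_open by blast
    \<comment> \<open>The preimages of \<open>U\<close> and \<open>V\<close> cover the interval, and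
      a Lebesgue number yields equal subintervals each mapped into one piece.\<close>
    have "{0..1::real} \<subseteq> \<Union>{A, B}"
    proof
      fix t :: real assume t: "t \<in> {0..1}"
      then have "p t \<in> U \<union> V" using pS S by blast
      then have "t \<in> {0..1} \<inter> p -` U \<or> t \<in> {0..1} \<inter> p -` V" using t by auto
      then show "t \<in> \<Union>{A, B}" unfolding A(2) B(2) by auto
    qed
    then obtain \<delta> where \<delta>: "0 < \<delta>" "\<And>T. T \<subseteq> {0..1::real} \<Longrightarrow> diameter T < \<delta> \<Longrightarrow> \<exists>B'\<in>{A, B}. T \<subseteq> B'"
      using Lebesgue_number_lemma[of "{0..1::real}" "{A, B}"] A B
      by (metis compact_Icc insert_iff insert_not_empty singletonD)
    obtain n :: nat where n: "n \<noteq> 0" "inverse (real n) < \<delta>"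
      using real_arch_inverse[of \<delta>] \<delta> by auto
    have step: "path_image (subpath s t p) \<subseteq> U \<or> path_image (subpath s t p) \<subseteq> V"
      if "s \<in> {0..1}" "t \<in> {0..1}" "s \<le> t" "t - s < \<delta>" for s t
    proof -
      have "{s..t} \<subseteq> {0..1}" "diameter {s..t} < \<delta>" using that by (auto simp: diameter_closed_interval)
      then have "{s..t} \<subseteq> A \<or> {s..t} \<subseteq> B" using \<delta>(2)[of "{s..t}"] by blast
      then have "{s..t} \<subseteq> {0..1} \<inter> p -` U \<or> {s..t} \<subseteq> {0..1} \<inter> p -` V"
        unfolding A(2) B(2) using \<open>{s..t} \<subseteq> {0..1}\<close> by simp
      then have "p ` {s..t} \<subseteq> U \<or> p ` {s..t} \<subseteq> V" by auto
      then show ?thesis using that by (simp add: path_image_subpath)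
    qed
    have "good (subpath 0 (real k / real n) p)" if "k \<le> n" for k
      using that
    proof (induction k)
      case 0
      have "path_image (subpath 0 0 p) \<subseteq> U \<or> path_image (subpath 0 0 p) \<subseteq> V"
        by (rule step) (use \<delta> in auto)
      then show ?case using p by (auto intro!: piece)
    next
      case (Suc k)
      let ?s = "real k / real n" and ?t = "real (Suc k) / real n"
      have s: "?s \<in> {0..1}" and t: "?t \<in> {0..1}" using Suc.prems n by auto
      have "?t - ?s = inverse (real n)" using n by (simp add: field_simps)
      then have "path_image (subpath ?s ?t p) \<subseteq> U \<or> path_image (subpath ?s ?t p) \<subseteq> V"
        using n s t by (intro step) (auto simp: divide_right_mono)
      then have g2: "good (subpath ?s ?t p)" using p s t by (intro piece) auto
      have g1: "good (subpath 0 ?s p)" using Suc by simp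
      have h: "homotopic_paths S (subpath 0 ?s p +++ subpath ?s ?t p) (subpath 0 ?t p)"
        using p s t by (intro homotopic_join_subpaths) auto
      have pt: "path (subpath 0 ?s p)" "path (subpath ?s ?t p)" using p s t by auto
      have im: "path_image (subpath 0 ?s p) \<subseteq> S" "path_image (subpath ?s ?t p) \<subseteq> S"
        using path_image_subpath_subset[of 0 ?s p] path_image_subpath_subset[of ?s ?t p] p s t by auto
      show ?case by (rule join[OF pt(1) im(1) pt(2) im(2) _ g1 g2 h]) simp
    qed
    from this[of n] show ?thesis using n by simp
  qed
  have "path_connected S"
    unfolding S using U V UV ne simply_connected_imp_path_connected path_connected_Un by blast
  moreover have "homotopic_paths S p (linepath (pathstart p) (pathstart p))"
    if p: "path p" "path_image p \<subseteq> S" "pathfinish p = pathstart p" for p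
  proof -
    have "pathstart p \<in> S" using p by (meson pathstart_in_path_image subsetD)
    then obtain r where r: "conn (pathstart p) r" using ex_conn by blast
    then have r': "path r" "path_image r \<subseteq> S" "pathstart r = pathstart p"
      using connS unfolding conn_def by auto
    have rr: "homotopic_paths S (r +++ reversepath r) (linepath (pathstart p) (pathstart p))"
      using homotopic_paths_rinv[OF r'(1,2)] r'(3) by simp
    \<comment> \<open>For a loop one connector serves both ends, and cancelling it contracts
      \<open>p\<close>.\<close>
    have pr: "homotopic_paths S (p +++ r) r" using good[OF p(1,2)] r p(3) unfolding good_def by auto
    have "homotopic_paths S p (p +++ linepath (pathfinish p) (pathfinish p))"
      using p by (intro homotopic_paths_sym[OF homotopic_paths_rid])
    also have "homotopic_paths S \<dots> (p +++ (r +++ reversepath r))"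
      using p rr by (intro homotopic_paths_join) (auto simp: homotopic_paths_sym)
    also have "homotopic_paths S \<dots> ((p +++ r) +++ reversepath r)"
      using p r' by (intro homotopic_paths_assoc) auto
    also have "homotopic_paths S \<dots> (r +++ reversepath r)"
      using pr r' by (intro homotopic_paths_join) auto
    also have "homotopic_paths S \<dots> (linepath (pathstart p) (pathstart p))"
      using homotopic_paths_rinv[OF r'(1,2)] r'(3) by simp
    finally show ?thesis .
  qed
  ultimately show ?thesis unfolding simply_connected_eq_contractible_path by blast
qed

text \<open>The library's results on simple connectivity need a real normed space, and the dimension varies
  here: bounded functions on \<open>nat\<close> contain simplices of every dimension.\<close>
definition std_simplex :: "nat \<Rightarrow> (nat \<Rightarrow>\<^sub>C real) set" where
  "std_simplex n = {x::nat \<Rightarrow>\<^sub>C real. (\<forall>i. 0 \<le> x i) \<and> (\<forall>i\<ge>n. x i = 0) \<and> (\<Sum>i<n. x i) = 1}"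

definition unit_bcf :: "nat \<Rightarrow> nat \<Rightarrow>\<^sub>C real" where
  "unit_bcf i = Bcontfun (\<lambda>j. of_bool (j = i))"

lemma unit_bcf_apply [simp]: "apply_bcontfun (unit_bcf i) j = of_bool (j = i)"
proof -
  have "(\<lambda>j. of_bool (j = i) :: real) \<in> bcontfun"
    unfolding bcontfun_def by (auto intro!: boundedI[of _ 1])
  then show ?thesis unfolding unit_bcf_def by (simp add: Bcontfun_inverse)
qed

lemma continuous_on_bcontfun_coordinate [continuous_intros]:
  fixes f :: "'b::topological_space \<Rightarrow> (nat \<Rightarrow>\<^sub>C real)"
  assumes "continuous_on S f"
  shows "continuous_on S (\<lambda>x. apply_bcontfun (f x) i)"
proof -
  have "bounded_linear (\<lambda>x::nat \<Rightarrow>\<^sub>C real. apply_bcontfun x i)"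
    by (rule bounded_linear_intro[where K = 1]) (simp_all only: mult_1_right norm_bounded plus_bcontfun.rep_eq scaleR_bcontfun.rep_eq)
  then show ?thesis using assms by (rule bounded_linear.continuous_on)
qed

lemma apply_bcontfun_sum: "apply_bcontfun (\<Sum>i\<in>I. f i) j = (\<Sum>i\<in>I. apply_bcontfun (f i) j)"
  by (induction I rule: infinite_finite_induct) auto

lemma convex_std_simplex: "convex (std_simplex n)"
  unfolding convex_def std_simplex_def
  by (auto simp: sum.distrib sum_distrib_left[symmetric])

text \<open>Boundary of the simplex with \<open>n\<close> vertices, a sphere of dimension
  \<open>n - 2\<close>.\<close>

definition std_sphere :: "nat \<Rightarrow> (nat \<Rightarrow>\<^sub>C real) set" where
  "std_sphere n = {x\<in>std_simplex n. \<exists>j<n. x j = 0}"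

lemma unit_in_std_simplex: "i < n \<Longrightarrow> unit_bcf i \<in> std_simplex n"
  unfolding std_simplex_def by (auto simp: of_bool_def)

lemma mid_in_std_simplex:
  assumes "i < n" "j < n"
  shows "(1/2) *\<^sub>R unit_bcf i + (1/2) *\<^sub>R unit_bcf j \<in> std_simplex n"
  using convexD[OF convex_std_simplex unit_in_std_simplex[OF assms(1)] unit_in_std_simplex[OF assms(2)]] by simp

text \<open>Cover by the open star of vertex 0, which is starlike about that vertex, and the
  complement of vertex 0, which retracts to the opposite facet. The overlap is path-connected once
  \<open>n \<ge> 4\<close>.\<close>

lemma simply_connected_std_sphere:
  assumes n: "n \<ge> 4"
  shows "simply_connected (std_sphere n)"
proof -
  let ?S = "std_sphere n" and ?b = unit_bcf
  let ?U = "{x\<in>?S. 0 < x 0}" and ?V = "{x\<in>?S. x 0 < 1}"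
  have S: "?S = ?U \<union> ?V" by auto
  have "open {x::nat \<Rightarrow>\<^sub>C real. 0 < x 0}" "open {x::nat \<Rightarrow>\<^sub>C real. x 0 < 1}"
    by (intro open_Collect_less continuous_intros)+
  then have o: "openin (top_of_set ?S) ?U" "openin (top_of_set ?S) ?V"
    unfolding openin_open by blast+
  have "starlike ?U"
    unfolding starlike_def
  proof (intro bexI ballI subsetI)
    show b0: "?b 0 \<in> ?U"
      using unit_in_std_simplex[of 0 n] n unfolding std_sphere_def by (auto intro!: exI[of _ 1])
    fix x y assume x: "x \<in> ?U" and "y \<in> closed_segment (?b 0) x"
    then obtain u where u: "0 \<le> u" "u \<le> 1" "y = (1 - u) *\<^sub>R ?b 0 + u *\<^sub>R x"
      unfolding closed_segment_def by blast
    obtain j where j: "j < n" "x j = 0" "x \<in> std_simplex n" "0 < x 0" using x unfolding std_sphere_def by blast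
    then have "j \<noteq> 0" by (metis less_irrefl)
    then have "y j = 0" using u j by simp
    moreover have "y \<in> std_simplex n"
      using convexD[OF convex_std_simplex, of "?b 0" n x "1 - u" u] unit_in_std_simplex[of 0 n] n u j by simp
    moreover have "y 0 > 0"
    proof (cases "u = 0")
      case False
      then have "u * x 0 > 0" using u j by simp
      then show ?thesis using u by simp
    qed (use u in simp)
    ultimately show "y \<in> ?U" using j unfolding std_sphere_def by blast
  qed
  then have U: "simply_connected ?U" by (rule starlike_imp_simply_connected)
  have "contractible ?V"
  proof -
    \<comment> \<open>Projection from vertex 0 onto the opposite facet. The segment from
      \<open>x\<close> to \<open>r x\<close> stays in every facet containing \<open>x\<close>, so
      straight lines first lead to \<open>?F\<close> and then contract it.\<close>
    define r where "r x = (1 / (1 - x 0)) *\<^sub>R (x - x 0 *\<^sub>R ?b 0)" for x :: "nat \<Rightarrow>\<^sub>C real"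
    let ?F = "{x\<in>std_simplex n. x 0 = 0}"
    have FV: "?F \<subseteq> ?V" using n unfolding std_sphere_def by (auto intro!: exI[of _ 0])
    have cF: "convex ?F"
      using convex_std_simplex[of n] unfolding convex_def by auto
    have r0: "r x 0 = 0" for x unfolding r_def by simp
    have rj: "r x j = x j / (1 - x 0)" if "j \<noteq> 0" for x j unfolding r_def using that by simp
    have rF: "r x \<in> ?F" if x: "x \<in> ?V" for x
    proof -
      have xs: "x \<in> std_simplex n" "x 0 < 1" using x unfolding std_sphere_def by auto
      have "0 \<le> r x i" for i
        using r0[of x] rj[of i x] xs by (cases "i = 0") (auto simp: std_simplex_def)
      moreover have "r x i = 0" if "i \<ge> n" for i
        using rj[of i x] xs that n by (simp add: std_simplex_def)
      moreover have "(\<Sum>i<n. r x i) = 1"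
      proof -
        have "(\<Sum>i<n. r x i) = (1 / (1 - x 0)) * (\<Sum>i<n. x i - x 0 * of_bool (i = 0))"
          unfolding r_def by (simp add: sum_distrib_left sum_divide_distrib)
        also have "(\<Sum>i<n. x i - x 0 * of_bool (i = 0)) = 1 - x 0"
          using xs n by (simp add: sum_subtractf std_simplex_def sum_distrib_left[symmetric] of_bool_def)
        finally show ?thesis using xs by simp
      qed
      ultimately show ?thesis using r0 unfolding std_simplex_def by simp
    qed
    have contr: "continuous_on ?V r"
      unfolding r_def by (intro continuous_intros) auto
    have "homotopic_with_canon (\<lambda>z. True) ?V ?V id r"
    proof (rule homotopic_with_linear[OF _ contr])
      show "continuous_on ?V id" by (rule continuous_on_id')
      fix x assume x: "x \<in> ?V"
      then obtain j where j: "j < n" "x j = 0" and xs: "x \<in> std_simplex n" "x 0 < 1" unfolding std_sphere_def by blast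
      show "closed_segment (id x) (r x) \<subseteq> ?V"
      proof
        fix y assume "y \<in> closed_segment (id x) (r x)"
        then obtain u where u: "0 \<le> u" "u \<le> 1" "y = (1 - u) *\<^sub>R x + u *\<^sub>R r x"
          unfolding closed_segment_def by auto
        have "y \<in> std_simplex n"
          using convexD[OF convex_std_simplex xs(1), of "r x" "1 - u" u] rF[OF x] u by simp
        moreover have "y j = 0" using u j r0[of x] rj[of j x] by (cases "j = 0") auto
        moreover have "y 0 < 1"
        proof -
          have "y 0 = (1 - u) * x 0" using u r0[of x] by simp
          also have "\<dots> \<le> 1 * x 0" using u xs by (intro mult_right_mono) (auto simp: std_simplex_def)
          finally show ?thesis using xs by simp
        qed
        ultimately show "y \<in> ?V" using j unfolding std_sphere_def by blast
      qed
    qed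
    moreover have "homotopic_with_canon (\<lambda>z. True) ?V ?V r (\<lambda>_. ?b 1)"
    proof (rule homotopic_with_linear[OF contr])
      show "continuous_on ?V (\<lambda>_. ?b 1)" by (rule continuous_on_const)
      fix x assume "x \<in> ?V"
      moreover have "?b 1 \<in> ?F" using unit_in_std_simplex[of 1 n] n by simp
      ultimately have "closed_segment (r x) (?b 1) \<subseteq> ?F" using cF rF by (intro closed_segment_subset) auto
      then show "closed_segment (r x) (?b 1) \<subseteq> ?V" using FV by blast
    qed
    ultimately have "homotopic_with_canon (\<lambda>z. True) ?V ?V id (\<lambda>_. ?b 1)" by (rule homotopic_with_trans)
    then show ?thesis unfolding contractible_def by blast
  qed
  then have V: "simply_connected ?V" by (rule contractible_imp_simply_connected)
  define m where "m i = (1/2) *\<^sub>R ?b 0 + (1/2) *\<^sub>R ?b i" for i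
  \<comment> \<open>The overlap is the union of the sets \<open>G j\<close> with
    \<open>0 < j < n\<close>; they are convex and get linked through the edge midpoints
    \<open>m i\<close>.\<close>
  define G where "G j = {x\<in>std_simplex n. x j = 0 \<and> 0 < x 0 \<and> x 0 < 1}" for j
  have GUV: "G j \<subseteq> ?U \<inter> ?V" if "j < n" for j using that unfolding G_def std_sphere_def by blast
  have "convex (G j)" for j
    unfolding convex_def
  proof (intro ballI allI impI)
    fix x y and u v :: real
    assume x: "x \<in> G j" and y: "y \<in> G j" and uv: "0 \<le> u" "0 \<le> v" "u + v = 1"
    have "u *\<^sub>R x + v *\<^sub>R y \<in> std_simplex n"
      using convexD[OF convex_std_simplex, of x n y u v] x y uv unfolding G_def by simp
    moreover have "0 < u * x 0 + v * y 0"
      using x y uv unfolding G_def by (cases "u = 0") (auto intro: add_pos_nonneg)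
    moreover have "u * x 0 + v * y 0 < 1"
      using x y uv unfolding G_def by (intro convex_bound_lt) auto
    ultimately show "u *\<^sub>R x + v *\<^sub>R y \<in> G j"
      using x y unfolding G_def by simp
  qed
  then have pc: "path_component (?U \<inter> ?V) x y" if "x \<in> G j" "y \<in> G j" "j < n" for x y j
    using that GUV[OF that(3)] by (intro path_component_linepath) (meson closed_segment_subset order_trans)
  have mG: "m i \<in> G j" if "i < n" "i \<noteq> 0" "j \<noteq> 0" "j \<noteq> i" for i j
    using mid_in_std_simplex[of 0 n i] that unfolding G_def m_def by simp
  have to_m: "path_component (?U \<inter> ?V) x (m 1)" if x: "x \<in> ?U \<inter> ?V" for x
  proof -
    obtain j where j: "j < n" "x j = 0" using x unfolding std_sphere_def by blast
    then have j0: "j \<noteq> 0" using x by (metis (mono_tags, lifting) IntE mem_Collect_eq less_irrefl)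
    then have xG: "x \<in> G j" using x j unfolding G_def std_sphere_def by blast
    \<comment> \<open>\<open>m i\<close> must lie in \<open>G j\<close>, so \<open>i\<close> differs
      from \<open>j\<close>. As \<open>i\<close> is 1 or 2, both \<open>m i\<close> and
      \<open>m 1\<close> lie in \<open>G 3\<close>, which exists because
      \<open>n \<ge> 4\<close>.\<close>
    define i :: nat where "i = (if j = 1 then 2 else 1)"
    have i: "i < n" "i \<noteq> 0" "i \<noteq> j" "i \<noteq> 3" unfolding i_def using n by auto
    have "path_component (?U \<inter> ?V) x (m i)" using pc[OF xG mG[of i j]] i j j0 by auto
    moreover have "path_component (?U \<inter> ?V) (m i) (m 1)"
      using pc[OF mG[of i 3] mG[of 1 3]] i n by auto
    ultimately show ?thesis by (rule path_component_trans)
  qed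
  then have UV: "path_connected (?U \<inter> ?V)"
    unfolding path_connected_component by (meson path_component_sym path_component_trans)
  have "m 1 \<in> ?U \<inter> ?V" using mG[of 1 2] GUV[of 2] n by auto
  then have "?U \<inter> ?V \<noteq> {}" by blast
  then show ?thesis by (rule simply_connected_openin_Un[OF o S U V UV])
qed

section \<open>Geometric realizations\<close>

lemma geom_realizationI:
  assumes "\<sigma> \<in> X" "\<And>v. 0 \<le> f v" "\<And>v. v \<notin> \<sigma> \<Longrightarrow> f v = 0" "sum f \<sigma> = 1"
  shows "f \<in> geom_realization X"
  using assms unfolding geom_realization_def by blast

lemma geom_realizationE:
  assumes "f \<in> geom_realization X"
  obtains \<sigma> where "\<sigma> \<in> X" "\<And>v. 0 \<le> f v" "\<And>v. v \<notin> \<sigma> \<Longrightarrow> f v = 0" "sum f \<sigma> = 1"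
  using assms unfolding geom_realization_def by blast

lemma continuous_on_coordinate [continuous_intros]:
  fixes f :: "'b::topological_space \<Rightarrow> 'a \<Rightarrow> real"
  shows "continuous_on S f \<Longrightarrow> continuous_on S (\<lambda>x. f x i)"
  by (rule continuous_on_product_then_coordinatewise)

text \<open>An enumeration of \<open>A\<close> identifies barycentric coordinates. Only finitely
  many coordinates are nonzero, so the sup norm and the product topology agree on these
  sets.\<close>

lemma simply_connected_standard:
  assumes A: "finite A" "card A \<ge> 4"
  shows "simply_connected (geom_realization {\<sigma>. \<sigma> \<subset> A})"
proof -
  define n where "n = card A"
  obtain e where e: "bij_betw e {..<n} A"
    using ex_bij_betw_nat_finite[OF A(1)] unfolding n_def lessThan_atLeast0 by blast
  define \<iota> where "\<iota> = inv_into {..<n} e"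
  have \<iota>: "bij_betw \<iota> A {..<n}" unfolding \<iota>_def using bij_betw_inv_into[OF e] .
  have e\<iota>: "e (\<iota> v) = v" if "v \<in> A" for v
    unfolding \<iota>_def using that e by (simp add: bij_betw_inv_into_right)
  have \<iota>e: "\<iota> (e i) = i" if "i < n" for i
    unfolding \<iota>_def using that e by (simp add: bij_betw_inv_into_left)
  have eA: "e i \<in> A" if "i < n" for i using e that by (auto simp: bij_betw_def)
  have \<iota>n: "\<iota> v < n" if "v \<in> A" for v using \<iota> that by (auto simp: bij_betw_def)
  let ?T = "geom_realization {\<sigma>. \<sigma> \<subset> A}"
  have T: "f \<in> ?T \<longleftrightarrow> (\<forall>v. 0 \<le> f v) \<and> (\<forall>v. v \<notin> A \<longrightarrow> f v = 0) \<and> sum f A = 1 \<and> (\<exists>v\<in>A. f v = 0)" for f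
  proof
    assume "f \<in> ?T"
    then obtain \<sigma> where \<sigma>: "\<sigma> \<subset> A" "\<And>v. 0 \<le> f v" "\<And>v. v \<notin> \<sigma> \<Longrightarrow> f v = 0" "sum f \<sigma> = 1"
      by (rule geom_realizationE) blast
    have "sum f \<sigma> = sum f A" using \<sigma> A by (intro sum.mono_neutral_left) auto
    then show "(\<forall>v. 0 \<le> f v) \<and> (\<forall>v. v \<notin> A \<longrightarrow> f v = 0) \<and> sum f A = 1 \<and> (\<exists>v\<in>A. f v = 0)"
      using \<sigma> by auto
  next
    assume f: "(\<forall>v. 0 \<le> f v) \<and> (\<forall>v. v \<notin> A \<longrightarrow> f v = 0) \<and> sum f A = 1 \<and> (\<exists>v\<in>A. f v = 0)"
    then obtain v where v: "v \<in> A" "f v = 0" by blast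
    have "sum f (A - {v}) = 1" using f v A by (simp add: sum_diff1)
    then show "f \<in> ?T" using f v by (intro geom_realizationI[of "A - {v}"]) auto
  qed
  define h where "h x v = (if v \<in> A then apply_bcontfun x (\<iota> v) else 0)" for x :: "nat \<Rightarrow>\<^sub>C real" and v
  \<comment> \<open>As a finite combination of fixed vectors this is visibly continuous into the
    normed space.\<close>
  define k where "k f = (\<Sum>i<n. f (e i) *\<^sub>R unit_bcf i)" for f
  have k_apply: "apply_bcontfun (k f) j = (if j < n then f (e j) else 0)" for f j
  proof -
    have "apply_bcontfun (k f) j = (\<Sum>i<n. f (e i) * of_bool (j = i))"
      unfolding k_def by (simp add: apply_bcontfun_sum)
    also have "\<dots> = (\<Sum>i<n. if i = j then f (e i) else 0)" by (intro sum.cong) auto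
    also have "\<dots> = (if j < n then f (e j) else 0)" by simp
    finally show ?thesis .
  qed
  have hk: "h (k f) = f" if "f \<in> ?T" for f
  proof
    fix v show "h (k f) v = f v"
      unfolding h_def k_apply using e\<iota>[of v] \<iota>n[of v] that unfolding T by auto
  qed
  have hT: "h x \<in> ?T" if x: "x \<in> std_sphere n" for x
  proof -
    have xs: "\<And>i. 0 \<le> apply_bcontfun x i" "(\<Sum>i<n. apply_bcontfun x i) = 1"
      using x unfolding std_sphere_def std_simplex_def by auto
    obtain j where j: "j < n" "apply_bcontfun x j = 0" using x unfolding std_sphere_def by blast
    have "sum (h x) A = (\<Sum>v\<in>A. apply_bcontfun x (\<iota> v))" unfolding h_def by simp
    also have "\<dots> = (\<Sum>i<n. apply_bcontfun x i)" by (rule sum.reindex_bij_betw[OF \<iota>])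
    finally have "sum (h x) A = 1" using xs by simp
    moreover have "h x (e j) = 0" using j eA \<iota>e unfolding h_def by simp
    ultimately show ?thesis using xs eA[OF j(1)] unfolding T by (auto simp: h_def)
  qed
  have kS: "k f \<in> std_sphere n" if f: "f \<in> ?T" for f
  proof -
    obtain v where v: "v \<in> A" "f v = 0" using f unfolding T by blast
    have "(\<Sum>i<n. f (e i)) = sum f A" by (rule sum.reindex_bij_betw[OF e])
    then have "k f \<in> std_simplex n" using f unfolding T std_simplex_def by (simp add: k_apply)
    moreover have "apply_bcontfun (k f) (\<iota> v) = 0" using v \<iota>n e\<iota> by (simp add: k_apply)
    ultimately show ?thesis unfolding std_sphere_def using \<iota>n[OF v(1)] by blast
  qed
  show ?thesis
  proof (rule simply_connected_retraction_gen)
    show "simply_connected (std_sphere n)" using A unfolding n_def by (intro simply_connected_std_sphere)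
    show "continuous_on (std_sphere n) h"
    proof (rule continuous_on_coordinatewise_then_product)
      fix v show "continuous_on (std_sphere n) (\<lambda>x. h x v)"
        unfolding h_def by (cases "v \<in> A") (simp_all add: continuous_intros)
    qed
    show "h ` std_sphere n = ?T" using hT hk kS by (metis (no_types, lifting) image_subset_iff image_eqI subsetI subset_antisym)
    show "continuous_on ?T k" unfolding k_def by (intro continuous_intros continuous_on_id)
    show "k \<in> ?T \<rightarrow> std_sphere n" using kS by blast
    show "\<And>y. y \<in> ?T \<Longrightarrow> h (k y) = y" using hk .
  qed
qed

section \<open>Starring leaves the realization unchanged up to homeomorphism\<close>

lemma continuous_on_Min_coordinates:
  fixes S :: "('a \<Rightarrow> real) set"
  assumes "finite \<rho>" "\<rho> \<noteq> {}"
  shows "continuous_on S (\<lambda>f. Min (f ` \<rho>))"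
  using assms
proof (induction rule: finite_ne_induct)
  case (singleton x)
  show ?case by (simp, rule continuous_on_coordinate, rule continuous_on_id)
next
  case (insert x F)
  then have "(\<lambda>f::'a \<Rightarrow> real. Min (f ` insert x F)) = (\<lambda>f. min (f x) (Min (f ` F)))"
    by simp
  moreover have "continuous_on S (\<lambda>f. min (f x) (Min (f ` F)))"
    by (rule continuous_on_min[OF continuous_on_coordinate[OF continuous_on_id] insert.IH])
  ultimately show ?case by (simp only:)
qed

text \<open>A point of \<open>\<rho>\<close> is split as its least coordinate times the all-ones
  vector plus a remainder on a proper face; the first part is a multiple of the barycentre and its
  weight \<open>card \<rho> * m g\<close> goes to \<open>v\<close>. Off \<open>\<rho>\<close> the
  least coordinate is 0, so nothing moves.\<close>

lemma simply_connected_stellar: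
  assumes X: "simplicial_complex X" and \<rho>: "\<rho> \<in> facets X" "\<rho> \<noteq> {}" and v: "v \<notin> \<Union>X"
    and sc: "simply_connected (geom_realization X)"
  shows "simply_connected (geom_realization (stellar X \<rho> v))"
proof -
  let ?S = "geom_realization X" and ?T = "geom_realization (stellar X \<rho> v)"
  have \<rho>X: "\<rho> \<in> X" and max: "\<And>\<sigma>. \<sigma> \<in> X \<Longrightarrow> \<rho> \<subseteq> \<sigma> \<Longrightarrow> \<sigma> = \<rho>"
    using \<rho>(1) unfolding facets_def by blast+
  have fin: "finite \<rho>" using X \<rho>X by (rule simplicial_complexD(2))
  have v\<rho>: "v \<notin> \<rho>" using \<rho>X v by blast
  have c0: "card \<rho> > 0" using fin \<rho>(2) by (simp add: card_gt_0_iff)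
  define m where "m g = Min (g ` \<rho>)" for g :: "'a \<Rightarrow> real"
  \<comment> \<open>\<open>k\<close> sends the new vertex to the barycentre of \<open>\<rho>\<close>; \<open>h\<close> is its inverse.\<close>
  define h where "h g x = (if x = v then real (card \<rho>) * m g else if x \<in> \<rho> then g x - m g else g x)" for g x
  define k where "k f x = (if x = v then 0 else if x \<in> \<rho> then f x + f v / real (card \<rho>) else f x)"
    for f :: "'a \<Rightarrow> real" and x
  have m_le: "m g \<le> g x" if "x \<in> \<rho>" for g x unfolding m_def using fin that by simp
  have m_ex: "\<exists>x\<in>\<rho>. m g = g x" for g
  proof -
    have "m g \<in> g ` \<rho>" unfolding m_def using fin \<rho>(2) by (intro Min_in) auto
    then show ?thesis by blast
  qed
  have m0: "m g = 0" if "\<And>x. 0 \<le> g x" "x \<in> \<rho>" "g x = 0" for g x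
    using m_le[OF that(2), of g] m_ex[of g] that(1,3) by (metis order_antisym)
  have k\<rho>: "k f x = f x + f v / real (card \<rho>)" if "x \<in> \<rho>" for f x
    using that v\<rho> by (auto simp: k_def)
  have kS: "k f \<in> ?S" and hk: "h (k f) = f" if f: "f \<in> ?T" for f
  proof -
    obtain \<tau> where \<tau>: "\<tau> \<in> stellar X \<rho> v" "\<And>x. 0 \<le> f x" "\<And>x. x \<notin> \<tau> \<Longrightarrow> f x = 0" "sum f \<tau> = 1"
      using f by (rule geom_realizationE) blast
    have "\<not> \<rho> \<subseteq> \<tau>"
      using \<tau>(1)
    proof (cases rule: stellarE)
      case 1
      then show ?thesis using max by blast
    next
      case (2 \<tau>')
      then show ?thesis using v\<rho> by blast
    qed
    \<comment> \<open>Some vertex of \<open>\<rho>\<close> carries no weight, so the minimum of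
      \<open>k f\<close> over \<open>\<rho>\<close> is exactly the share received from
      \<open>v\<close>; this lets \<open>h\<close> recover \<open>f v\<close>.\<close>
    then obtain r where r: "r \<in> \<rho>" "f r = 0" using \<tau>(3) by blast
    have mk: "m (k f) = f v / real (card \<rho>)"
    proof -
      have "m (k f) \<le> f v / real (card \<rho>)" using m_le[OF r(1), of "k f"] k\<rho>[OF r(1), of f] r(2) by simp
      moreover obtain x where x: "x \<in> \<rho>" "m (k f) = k f x" using m_ex by blast
      have "m (k f) \<ge> f v / real (card \<rho>)" using \<tau>(2)[of x] k\<rho>[OF x(1), of f] x(2) by simp
      ultimately show ?thesis by simp
    qed
    have "m f = 0" using m0[of f r, OF \<tau>(2) r] .
    show "h (k f) = f"
    proof
      fix x show "h (k f) x = f x"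
        unfolding h_def mk using v\<rho> c0 by (simp add: k_def)
    qed
    have k0: "0 \<le> k f x" for x unfolding k_def using \<tau>(2) by simp
    show "k f \<in> ?S"
      using \<tau>(1)
    proof (cases rule: stellarE)
      case 1
      then have "v \<notin> \<tau>" using v by blast
      then have "k f = f" using \<tau>(3)[of v] by (auto simp: k_def)
      then show ?thesis using geom_realizationI[OF 1(1) \<tau>(2-4)] by simp
    next
      case (2 \<tau>')
      have fin': "finite \<tau>'" using 2(1) fin by (meson finite_subset psubset_imp_subset)
      have v': "v \<notin> \<tau>'" using 2(1) v\<rho> by blast
      have "sum (k f) \<rho> = (\<Sum>x\<in>\<rho>. f x + f v / real (card \<rho>))"
        using v\<rho> by (intro sum.cong) (auto simp: k_def)
      also have "\<dots> = sum f \<rho> + f v" using c0 by (simp add: sum.distrib)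
      also have "sum f \<rho> = sum f \<tau>'"
      proof (rule sum.mono_neutral_right[OF fin])
        show "\<tau>' \<subseteq> \<rho>" using 2 by blast
        show "\<forall>x\<in>\<rho> - \<tau>'. f x = 0"
        proof
          fix x assume "x \<in> \<rho> - \<tau>'"
          then have "x \<notin> \<tau>" using 2(2) v\<rho> by blast
          then show "f x = 0" by (rule \<tau>(3))
        qed
      qed
      also have "sum f \<tau>' + f v = 1" using \<tau>(4) 2(2) fin' v' by simp
      finally have "sum (k f) \<rho> = 1" .
      moreover have "k f x = 0" if "x \<notin> \<rho>" for x
        using that \<tau>(3)[of x] 2 unfolding k_def by auto
      ultimately show ?thesis using k0 by (intro geom_realizationI[OF \<rho>X]) auto
    qed
  qed
  have hT: "h g \<in> ?T" if g: "g \<in> ?S" for g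
  proof -
    obtain \<sigma> where \<sigma>: "\<sigma> \<in> X" "\<And>x. 0 \<le> g x" "\<And>x. x \<notin> \<sigma> \<Longrightarrow> g x = 0" "sum g \<sigma> = 1"
      using g by (rule geom_realizationE) blast
    show ?thesis
    proof (cases "\<rho> \<subseteq> \<sigma>")
      case True
      then have \<sigma>\<rho>: "\<sigma> = \<rho>" using max \<sigma> by blast
      obtain r where r: "r \<in> \<rho>" "m g = g r" using m_ex by blast
      have "insert v (\<rho> - {r}) \<in> stellar X \<rho> v" using r by (intro stellarI(2)) blast
      moreover have "0 \<le> h g x" for x using \<sigma>(2) m_le[of x g] r unfolding h_def by auto
      moreover have "h g x = 0" if "x \<notin> insert v (\<rho> - {r})" for x
        using that \<sigma>(3)[of x] r \<sigma>\<rho> unfolding h_def by auto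
      moreover have "sum (h g) (insert v (\<rho> - {r})) = 1"
      proof -
        have "sum (h g) (insert v (\<rho> - {r})) = real (card \<rho>) * m g + sum (h g) (\<rho> - {r})"
          using fin v\<rho> by (simp add: h_def)
        also have "sum (h g) (\<rho> - {r}) = sum (h g) \<rho>"
          using fin r v\<rho> by (intro sum.mono_neutral_left) (auto simp: h_def)
        also have "sum (h g) \<rho> = (\<Sum>x\<in>\<rho>. g x - m g)"
          using v\<rho> by (intro sum.cong) (auto simp: h_def)
        also have "\<dots> = sum g \<rho> - real (card \<rho>) * m g" by (simp add: sum_subtractf)
        finally show ?thesis using \<sigma>(4) \<sigma>\<rho> by simp
      qed
      ultimately show ?thesis by (rule geom_realizationI)
    next
      case False
      then obtain r where r: "r \<in> \<rho>" "r \<notin> \<sigma>" by blast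
      then have "m g = 0" using m0[of g r, OF \<sigma>(2) r(1)] \<sigma>(3) by blast
      moreover have "v \<notin> \<sigma>" using \<sigma>(1) v by blast
      ultimately have "h g = g" using \<sigma>(3)[of v] by (auto simp: h_def)
      moreover have "\<sigma> \<in> stellar X \<rho> v" using \<sigma>(1) False by (intro stellarI(1)) auto
      then have "g \<in> ?T" using \<sigma>(2-4) by (rule geom_realizationI)
      ultimately show ?thesis by simp
    qed
  qed
  show ?thesis
  proof (rule simply_connected_retraction_gen[OF sc])
    show "continuous_on ?S h"
    proof (rule continuous_on_coordinatewise_then_product)
      fix x
      have cm: "continuous_on ?S m" unfolding m_def by (rule continuous_on_Min_coordinates[OF fin \<rho>(2)])
      have cx: "continuous_on ?S (\<lambda>g. g x)" by (rule continuous_on_coordinate[OF continuous_on_id])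
      have eq: "(\<lambda>g. h g x) = (if x = v then (\<lambda>g. real (card \<rho>) * m g)
          else if x \<in> \<rho> then (\<lambda>g. g x - m g) else (\<lambda>g. g x))"
        unfolding h_def by auto
      show "continuous_on ?S (\<lambda>g. h g x)"
        unfolding eq
        by (split if_split, split if_split,
            intro conjI impI continuous_on_mult_left[OF cm] continuous_on_diff[OF cx cm] cx)
    qed
    show "h ` ?S = ?T" using hT hk kS by (metis (no_types, lifting) image_subset_iff image_eqI subsetI subset_antisym)
    show "continuous_on ?T k"
    proof (rule continuous_on_coordinatewise_then_product)
      fix x
      have cx: "continuous_on ?T (\<lambda>f. f y)" for y by (rule continuous_on_coordinate[OF continuous_on_id])
      have eq: "(\<lambda>f. k f x) = (if x = v then (\<lambda>f. 0)
          else if x \<in> \<rho> then (\<lambda>f. f x + f v * inverse (real (card \<rho>))) else (\<lambda>f. f x))"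
        unfolding k_def divide_inverse by auto
      show "continuous_on ?T (\<lambda>f. k f x)"
        unfolding eq
        by (split if_split, split if_split,
            intro conjI impI continuous_on_const continuous_on_add[OF cx continuous_on_mult_right[OF cx]] cx)
    qed
    show "k \<in> ?T \<rightarrow> ?S" using kS by blast
    show "\<And>y. y \<in> ?T \<Longrightarrow> h (k y) = y" using hk .
  qed
qed

theorem stacked_simply_connected:
  assumes "stacked_sphere k X" "k \<ge> 2"
  shows "simply_connected (geom_realization X)"
  using assms
proof (induction rule: stacked_induct)
  case (standard A)
  then show ?case by (intro simply_connected_standard) auto
next
  case (stellar X \<rho> v)
  have "\<rho> \<noteq> {}" using stacked_facetD(2)[OF stellar.hyps(1,2)] by auto
  then show ?case using stellar stacked_complex by (intro simply_connected_stellar) auto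
qed

section \<open>Integral cocycles as circle-valued maps and their lifts\<close>

lemma cocycle_refl:
  assumes "cocycle X c" "{x} \<in> X"
  shows "c x x = 0"
proof -
  have "{x, x, x} \<in> X" using assms(2) by simp
  then have "c x x + c x x + c x x = 0" using assms(1) unfolding cocycle_def by blast
  then show ?thesis by simp
qed

lemma cocycle_sym:
  assumes "simplicial_complex X" "cocycle X c" "{x, y} \<in> X"
  shows "c y x = - c x y"
proof -
  have "c x y + c y y + c y x = 0" using assms unfolding cocycle_def by simp
  moreover have "{y} \<in> X" using simplicial_complexD(3)[OF assms(1,3)] by blast
  then have "c y y = 0" using cocycle_refl[OF assms(2)] by blast
  ultimately show ?thesis by simp
qed

definition vertex_pt :: "'a \<Rightarrow> 'a \<Rightarrow> real" where
  "vertex_pt a v = of_bool (v = a)"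

definition edge_path :: "'a \<Rightarrow> 'a \<Rightarrow> real \<Rightarrow> 'a \<Rightarrow> real" where
  "edge_path a b t v = (1 - t) * of_bool (v = a) + t * of_bool (v = b)"

text \<open>On a face, another base vertex changes the sum by an integer, so the choice is harmless.\<close>
definition circle_map :: "'a set set \<Rightarrow> ('a \<Rightarrow> 'a \<Rightarrow> int) \<Rightarrow> ('a \<Rightarrow> real) \<Rightarrow> complex" where
  "circle_map X c f =
     exp (2 * of_real pi * \<i> * of_real (\<Sum>v\<in>\<Union>X. f v * of_int (c (SOME a. 0 < f a) v)))"

locale cocycle_on =
  fixes X :: "'a set set" and c :: "'a \<Rightarrow> 'a \<Rightarrow> int"
  assumes sc: "simplicial_complex X" and c: "cocycle X c"
begin

abbreviation "G \<equiv> geom_realization X"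
abbreviation "F \<equiv> circle_map X c"

definition face :: "'a set \<Rightarrow> ('a \<Rightarrow> real) set" where
  "face \<sigma> = {f. (\<forall>v. 0 \<le> f v) \<and> (\<forall>v. v \<notin> \<sigma> \<longrightarrow> f v = 0) \<and> sum f \<sigma> = 1}"

lemma G_eq: "G = (\<Union>\<sigma>\<in>X. face \<sigma>)"
  unfolding geom_realization_def face_def by blast

lemma F_face:
  assumes \<sigma>: "\<sigma> \<in> X" and a: "a \<in> \<sigma>" and f: "f \<in> face \<sigma>"
  shows "F f = exp (2 * of_real pi * \<i> * of_real (\<Sum>v\<in>\<Union>X. f v * of_int (c a v)))"
proof -
  have f': "\<And>v. 0 \<le> f v" "\<And>v. v \<notin> \<sigma> \<Longrightarrow> f v = 0" "sum f \<sigma> = 1" using f unfolding face_def by auto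
  have fin: "finite (\<Union>X)" "finite \<sigma>" using finite_vertices[OF sc] simplicial_complexD(2)[OF sc \<sigma>] by auto
  have "\<exists>v. 0 < f v"
  proof (rule ccontr)
    assume "\<not> ?thesis"
    then have "f v = 0" for v using f'(1)[of v] by (metis less_eq_real_def)
    then show False using f'(3) by simp
  qed
  then have b0: "0 < f (SOME a. 0 < f a)" by (rule someI_ex)
  define b where "b = (SOME a. 0 < f a)"
  have b: "b \<in> \<sigma>" using b0 f'(2) unfolding b_def by force
  \<comment> \<open>The cocycle identity on \<open>{b, v, a}\<close>. Summed over coordinates of
    total 1, the correction is the integer \<open>c b a\<close>.\<close>
  have eq: "f v * of_int (c b v) = f v * of_int (c a v) + f v * of_int (c b a)" for v
  proof (cases "v \<in> \<sigma>")
    case True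
    have "{b, v, a} \<in> X" "{a, v} \<in> X" "{b, a} \<in> X"
      using simplicial_complexD(3)[OF sc \<sigma>] a b True by auto
    then have "c b v + c v a + c a b = 0" "c v a = - c a v" "c a b = - c b a"
      using c cocycle_sym[OF sc c] unfolding cocycle_def by blast+
    then have "c b v = c a v + c b a" by simp
    then show ?thesis by (simp add: algebra_simps)
  qed (use f'(2) in simp)
  have "sum f (\<Union>X) = sum f \<sigma>" using \<sigma> fin f'(2) by (intro sum.mono_neutral_right) auto
  then have "(\<Sum>v\<in>\<Union>X. f v * of_int (c b v)) = (\<Sum>v\<in>\<Union>X. f v * of_int (c a v)) + of_int (c b a)"
    unfolding eq sum.distrib using f'(3) by (simp add: sum_distrib_right[symmetric])
  then have "F f = exp (2 * of_real pi * \<i> * of_real (\<Sum>v\<in>\<Union>X. f v * of_int (c a v)) +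
      (2 * of_int (c b a) * pi) * \<i>)"
    unfolding circle_map_def b_def[symmetric] by (simp add: algebra_simps)
  also have "\<dots> = exp (2 * of_real pi * \<i> * of_real (\<Sum>v\<in>\<Union>X. f v * of_int (c a v))) *
      exp ((2 * of_int (c b a) * pi) * \<i>)"
    by (rule exp_add)
  also have "exp ((2 * of_int (c b a) * pi) * \<i>) = 1"
    using exp_integer_2pi[of "of_int (c b a)"] by simp
  finally show ?thesis by simp
qed

lemma closed_face: "closed (face \<sigma>)"
proof -
  have c: "continuous_on UNIV (\<lambda>f::'a \<Rightarrow> real. f v)" for v
    by (rule continuous_on_coordinate) (rule continuous_on_id)
  have "face \<sigma> = (\<Inter>v. {f. 0 \<le> f v}) \<inter> (\<Inter>v\<in>- \<sigma>. {f. f v = 0}) \<inter> {f. sum f \<sigma> = 1}"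
    unfolding face_def by auto
  moreover have "closed \<dots>"
    by (intro closed_Int closed_INT ballI closed_Collect_le closed_Collect_eq c continuous_on_const
        continuous_on_sum)
  ultimately show ?thesis by simp
qed

text \<open>The choice of base vertex by \<open>SOME\<close> need not vary continuously, but on each
  of the finitely many closed faces \<open>F_face\<close> permits a fixed one.\<close>

lemma continuous_F: "continuous_on G F"
  unfolding G_eq
proof (rule continuous_on_closed_Union)
  show "finite X" using simplicial_complexD(1)[OF sc] .
  fix \<sigma> assume \<sigma>: "\<sigma> \<in> X"
  show "closed (face \<sigma>)" by (rule closed_face)
  show "continuous_on (face \<sigma>) F"
  proof (cases "\<sigma> = {}")
    case True
    then have "face \<sigma> = {}" unfolding face_def by auto
    then show ?thesis by simp
  next
    case False
    then obtain a where a: "a \<in> \<sigma>" by blast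
    have "continuous_on (face \<sigma>) (\<lambda>f. exp (2 * of_real pi * \<i> * of_real (\<Sum>v\<in>\<Union>X. f v * of_int (c a v))) :: complex)"
      by (intro continuous_intros continuous_on_id)
    then show ?thesis
      by (rule continuous_on_cong[THEN iffD1, rotated 2]) (simp_all add: F_face[OF \<sigma> a])
  qed
qed

lemma F_nonzero: "F f \<noteq> 0"
  unfolding circle_map_def by simp

lemma edge_path_face: "{a, b} \<in> X \<Longrightarrow> t \<in> {0..1} \<Longrightarrow> edge_path a b t \<in> face {a, b}"
  unfolding face_def edge_path_def by (cases "a = b") auto

text \<open>With base vertex \<open>a\<close> only the coordinate at \<open>b\<close> contributes,
  so \<open>F\<close> winds \<open>c a b\<close> times along the edge.\<close>

lemma F_edge_path:
  assumes ab: "{a, b} \<in> X" and t: "t \<in> {0..1}"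
  shows "F (edge_path a b t) = exp (2 * of_real pi * \<i> * of_real (t * of_int (c a b)))"
proof -
  have fin: "finite (\<Union>X)" using finite_vertices[OF sc] .
  have V: "a \<in> \<Union>X" "b \<in> \<Union>X" using ab by blast+
  have "{a} \<in> X" using simplicial_complexD(3)[OF sc ab] by blast
  then have caa: "c a a = 0" using cocycle_refl[OF c] by blast
  have "(\<Sum>v\<in>\<Union>X. edge_path a b t v * of_int (c a v)) =
      (\<Sum>v\<in>\<Union>X. if v = b then t * of_int (c a v) else 0)"
  proof (intro sum.cong refl)
    fix v
    have "(1 - t) * of_bool (v = a) * of_int (c a v) = 0" using caa by (cases "v = a") auto
    then show "edge_path a b t v * of_int (c a v) = (if v = b then t * of_int (c a v) else 0)"
      unfolding edge_path_def distrib_right by simp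
  qed
  also have "\<dots> = t * of_int (c a b)"
    using fin V by simp
  finally show ?thesis
    using F_face[OF ab _ edge_path_face[OF ab t], of a] by simp
qed

text \<open>Some path in the realization from \<open>a\<close> to \<open>b\<close> has
  \<open>F\<close>-image winding \<open>m\<close> times; \<open>h\<close> is the continuous
  logarithm, normalised to start at 0. Vertices of \<open>X\<close> are mapped to 1, hence endpoints
  in multiples of \<open>2 * pi * \<i>\<close>.\<close>

definition lifts_to :: "'a \<Rightarrow> int \<Rightarrow> 'a \<Rightarrow> bool" where
  "lifts_to a m b \<longleftrightarrow> (\<exists>p h. path p \<and> path_image p \<subseteq> G \<and> pathstart p = vertex_pt a \<and>
     pathfinish p = vertex_pt b \<and> path h \<and> pathstart h = 0 \<and>
     pathfinish h = 2 * of_real pi * \<i> * of_int m \<and> (\<forall>t\<in>{0..1}. F (p t) = F (vertex_pt a) * exp (h t)))"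

lemma edge_path_path: "path (edge_path a b)"
  unfolding path_def edge_path_def
  by (rule continuous_on_coordinatewise_then_product) (intro continuous_on_add continuous_on_mult
      continuous_on_diff continuous_on_const continuous_on_id)

lemma edge_path_ends: "pathstart (edge_path a b) = vertex_pt a" "pathfinish (edge_path a b) = vertex_pt b"
  unfolding pathstart_def pathfinish_def edge_path_def vertex_pt_def by auto

lemma F_vertex: "{a} \<in> X \<Longrightarrow> F (vertex_pt a) = 1"
  using F_edge_path[of a a 0] edge_path_ends(1)[of a a] unfolding pathstart_def by simp

lemma lifts_to_refl: "{a} \<in> X \<Longrightarrow> lifts_to a 0 a"
proof -
  assume a: "{a} \<in> X"
  then have aa: "{a, a} \<in> X" by simp
  have "c a a = 0" using cocycle_refl[OF c a] .
  then have "F (edge_path a a t) = F (vertex_pt a) * exp 0" if "t \<in> {0..1}" for t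
    using F_edge_path[OF aa that] F_vertex[OF a] by simp
  moreover have z: "path (\<lambda>_::real. 0::complex)" "pathstart (\<lambda>_::real. 0::complex) = 0"
    "pathfinish (\<lambda>_::real. 0::complex) = 0"
    by (simp_all add: path_def pathstart_def pathfinish_def)
  moreover have "path_image (edge_path a a) \<subseteq> G"
    using edge_path_face[OF aa] aa unfolding G_eq path_image_def by blast
  ultimately show ?thesis
    unfolding lifts_to_def
    by (intro exI[of _ "edge_path a a"] exI[of _ "\<lambda>_. 0"]) (auto simp: edge_path_path edge_path_ends z)
qed

lemma lifts_to_step:
  assumes ab: "lifts_to a m b" and bd: "{b, d} \<in> X"
  shows "lifts_to a (m + c b d) d"
proof -
  obtain p h where p: "path p" "path_image p \<subseteq> G" "pathstart p = vertex_pt a" "pathfinish p = vertex_pt b"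
    and h: "path h" "pathstart h = 0" "pathfinish h = 2 * of_real pi * \<i> * of_int m"
    and ph: "\<And>t. t \<in> {0..1} \<Longrightarrow> F (p t) = F (vertex_pt a) * exp (h t)"
    using ab unfolding lifts_to_def by blast
  have b: "{b} \<in> X" using simplicial_complexD(3)[OF sc bd] by blast
  let ?q = "edge_path b d"
  \<comment> \<open>The logarithm along the edge is linear and starts where \<open>h\<close>
    ends.\<close>
  let ?k = "\<lambda>t::real. pathfinish h + 2 * of_real pi * \<i> * of_real (t * of_int (c b d))"
  have k: "path ?k" "pathstart ?k = pathfinish h" "pathfinish ?k = 2 * of_real pi * \<i> * of_int (m + c b d)"
    unfolding path_def using h by (auto simp: pathstart_def pathfinish_def algebra_simps intro!: continuous_intros)
  have "F (vertex_pt b) = F (vertex_pt a) * exp (pathfinish h)"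
    using ph[of 1] p(4) unfolding pathfinish_def by simp
  then have qk: "F (?q t) = F (vertex_pt a) * exp (?k t)" if "t \<in> {0..1}" for t
    using F_edge_path[OF bd that] F_vertex[OF b] by (simp add: exp_add)
  have "F ((p +++ ?q) t) = F (vertex_pt a) * exp ((h +++ ?k) t)" if "t \<in> {0..1}" for t
    using ph[of "2 * t"] qk[of "2 * t - 1"] that unfolding joinpaths_def by auto
  moreover have "path_image ?q \<subseteq> G"
    using edge_path_face[OF bd] bd unfolding G_eq path_image_def by blast
  then have "path_image (p +++ ?q) \<subseteq> G" using p by (simp add: subset_path_image_join)
  moreover have "path (p +++ ?q)" "path (h +++ ?k)"
    using p h k by (auto simp: edge_path_path edge_path_ends)
  ultimately show ?thesis
    unfolding lifts_to_def
    by (intro exI[of _ "p +++ ?q"] exI[of _ "h +++ ?k"])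
       (use p h k in \<open>auto simp: edge_path_ends\<close>)
qed

text \<open>Paths with common ends in a simply connected realization have homotopic images in the
  punctured plane, and by monodromy of the covering \<open>exp\<close> their lifts end at the same
  point.\<close>

lemma lifts_to_unique:
  assumes S: "simply_connected G" and 1: "lifts_to a m b" and 2: "lifts_to a m' b"
  shows "m = m'"
proof -
  obtain p h where p: "path p" "path_image p \<subseteq> G" "pathstart p = vertex_pt a" "pathfinish p = vertex_pt b"
    and h: "path h" "pathstart h = 0" "pathfinish h = 2 * of_real pi * \<i> * of_int m"
    and ph: "\<And>t. t \<in> {0..1} \<Longrightarrow> F (p t) = F (vertex_pt a) * exp (h t)"
    using 1 unfolding lifts_to_def by blast
  obtain q k where q: "path q" "path_image q \<subseteq> G" "pathstart q = vertex_pt a" "pathfinish q = vertex_pt b"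
    and k: "path k" "pathstart k = 0" "pathfinish k = 2 * of_real pi * \<i> * of_int m'"
    and qk: "\<And>t. t \<in> {0..1} \<Longrightarrow> F (q t) = F (vertex_pt a) * exp (k t)"
    using 2 unfolding lifts_to_def by blast
  have aG: "vertex_pt a \<in> G" using p by (metis pathstart_in_path_image subsetD)
  have cont: "continuous_on S' F" if "S' \<subseteq> G" for S' using continuous_F that continuous_on_subset by blast
  let ?z = "F (vertex_pt a)"
  have "path (\<lambda>_::real. vertex_pt a)" unfolding path_def by (rule continuous_on_const)
  moreover have "path_image (\<lambda>_::real. vertex_pt a) \<subseteq> G" using aG unfolding path_image_def by auto
  moreover have "path (p +++ reversepath q)" "path_image (p +++ reversepath q) \<subseteq> G"
    using p q by (auto simp: subset_path_image_join)
  moreover have "pathfinish (p +++ reversepath q) = pathstart (p +++ reversepath q)"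
    using p q by simp
  ultimately have "homotopic_loops G (p +++ reversepath q) (\<lambda>_. vertex_pt a)"
    using S unfolding simply_connected_def by (simp add: pathstart_def pathfinish_def)
  then have "homotopic_loops (- {0}) (F \<circ> (p +++ reversepath q)) (F \<circ> (\<lambda>_. vertex_pt a))"
    by (rule homotopic_loops_continuous_image[OF _ continuous_F]) (use F_nonzero in auto)
  moreover have "F \<circ> (\<lambda>_. vertex_pt a) = linepath ?z ?z" by (auto simp: linepath_refl)
  moreover have "F \<circ> (p +++ reversepath q) = (F \<circ> p) +++ reversepath (F \<circ> q)"
    by (simp add: path_compose_join path_compose_reversepath)
  ultimately have loop: "homotopic_loops (- {0}) ((F \<circ> p) +++ reversepath (F \<circ> q)) (linepath ?z ?z)"
    by simp
  have Fp: "path (F \<circ> p)" "path (F \<circ> q)"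
    using p q cont by (auto intro: path_continuous_image)
  have hom: "homotopic_paths (- {0}) (F \<circ> p) (F \<circ> q)"
    by (rule homotopic_paths_loop_parts[OF loop Fp(2)])
  \<comment> \<open>Both logarithms start at 0; shifting by a logarithm of the starting value turns
    them into genuine lifts.\<close>
  obtain w where w: "exp w = ?z" using exp_Ln[OF F_nonzero] by blast
  have "pathfinish (\<lambda>t. w + h t) = pathfinish (\<lambda>t. w + k t)"
  proof (rule covering_space_monodromy[OF covering_space_exp_punctured_plane Fp(1) _ Fp(2) _ hom])
    show "path_image (F \<circ> p) \<subseteq> - {0}" "path_image (F \<circ> q) \<subseteq> - {0}"
      using F_nonzero by (auto simp: path_image_def)
    show "path (\<lambda>t. w + h t)" "path (\<lambda>t. w + k t)"
      using h k unfolding path_def by (auto intro!: continuous_intros)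
    show "exp (w + h t) = (F \<circ> p) t" if "t \<in> {0..1}" for t using ph[OF that] w by (simp add: exp_add)
    show "exp (w + k t) = (F \<circ> q) t" if "t \<in> {0..1}" for t using qk[OF that] w by (simp add: exp_add)
    show "pathstart (\<lambda>t. w + h t) = pathstart (\<lambda>t. w + k t)"
      using h(2) k(2) by (simp add: pathstart_def)
  qed auto
  then have "pathfinish h = pathfinish k" by (simp add: pathfinish_def)
  then show ?thesis using h(3) k(3) by simp
qed

end

text \<open>The potential at \<open>b\<close> is the winding number along any path from a base
  vertex to \<open>b\<close>. It exists by connectivity, is unique by
  \<open>lifts_to_unique\<close>, and an edge adds its cocycle value.\<close>

theorem simply_connected_cocycles_trivial:
  assumes sc: "simplicial_complex X" and conn: "induces_connected X (\<Union>X)"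
    and S: "simply_connected (geom_realization X)"
  shows "cocycles_trivial X"
  unfolding cocycles_trivial_def
proof (intro allI impI)
  fix c assume c: "cocycle X c"
  interpret cocycle_on X c using sc c by unfold_locales
  show "\<exists>g. \<forall>x y. {x, y} \<in> X \<longrightarrow> c x y = g y - g x"
  proof (cases "\<Union>X = {}")
    case True
    then show ?thesis by blast
  next
    case False
    then obtain a where a: "a \<in> \<Union>X" by blast
    then have "lifts_to a 0 a" using vertex_iff[OF sc] lifts_to_refl by blast
    have "{b\<in>\<Union>X. \<exists>m. lifts_to a m b} = \<Union>X"
    proof (rule induces_connectedD[OF conn, of _ a])
      show "a \<in> {b\<in>\<Union>X. \<exists>m. lifts_to a m b}" using a \<open>lifts_to a 0 a\<close> by blast
      show "y \<in> {b\<in>\<Union>X. \<exists>m. lifts_to a m b}"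
        if "x \<in> {b\<in>\<Union>X. \<exists>m. lifts_to a m b}" "y \<in> \<Union>X" "{x, y} \<in> X" for x y
        using that lifts_to_step by blast
    qed blast
    then have "\<forall>b\<in>\<Union>X. \<exists>m. lifts_to a m b" by blast
    then obtain g where g: "\<And>b. b \<in> \<Union>X \<Longrightarrow> lifts_to a (g b) b" by metis
    have "c x y = g y - g x" if xy: "{x, y} \<in> X" for x y
    proof -
      have V: "x \<in> \<Union>X" "y \<in> \<Union>X" using xy by blast+
      have "g y = g x + c x y"
        using lifts_to_unique[OF S g[OF V(2)] lifts_to_step[OF g[OF V(1)] xy]] .
      then show ?thesis by simp
    qed
    then show ?thesis by blast
  qed
qed

section \<open>From the class K to the combinatorial hypotheses, and the equivalence\<close>

lemma induces_connected_if_complex_connected: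
  assumes "complex_connected X"
  shows "induces_connected X (\<Union>X)"
  unfolding induces_connected_def
proof (intro allI impI)
  fix C assume C: "C \<subseteq> \<Union>X" "C \<noteq> {}" and cl: "\<forall>x\<in>C. \<forall>y\<in>\<Union>X. {x, y} \<in> X \<longrightarrow> y \<in> C"
  obtain a where a: "a \<in> C" using C by blast
  have "b \<in> C" if "b \<in> \<Union>X" for b
  proof -
    have "(a, b) \<in> {(x, y). {x, y} \<in> X}\<^sup>*"
      using assms a C that unfolding complex_connected_def by blast
    then show ?thesis
    proof (induction rule: rtrancl_induct)
      case (step y z)
      then have "{y, z} \<in> X" by simp
      then show ?case using cl step.IH by blast
    qed (rule a)
  qed
  then show "C = \<Union>X" using C by blast
qed

text \<open>Connectivity of \<open>X\<close> is the link condition for the empty face; the index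
  drops to the dimension of the links.\<close>

lemma class_K_locally_stacked:
  assumes "class_K d X"
  shows "locally_stacked (d - 1) X"
proof -
  have np: "normal_pseudomanifold d X" and lk: "\<And>v. v \<in> \<Union>X \<Longrightarrow> stacked_sphere (d - 1) (link X {v})"
    using assms unfolding class_K_def by blast+
  then have sc: "simplicial_complex X" and p: "pure d X"
    and con: "\<And>\<alpha>. \<alpha> \<in> X \<Longrightarrow> card \<alpha> \<le> d - 1 \<Longrightarrow> complex_connected (link X \<alpha>)"
    unfolding normal_pseudomanifold_def by blast+
  obtain \<sigma> where \<sigma>: "\<sigma> \<in> facets X" "card \<sigma> = d + 1" using p unfolding pure_def by blast
  then have \<sigma>X: "\<sigma> \<in> X" "\<sigma> \<noteq> {}" unfolding facets_def by auto
  have "link X {} = X" unfolding link_def by auto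
  moreover have "{} \<in> X" using simplicial_complexD(3)[OF sc \<sigma>X(1)] by blast
  ultimately have "complex_connected X" using con[of "{}"] by simp
  then have "induces_connected X (\<Union>X)" by (rule induces_connected_if_complex_connected)
  moreover have "\<Union>X \<noteq> {}" using \<sigma>X by blast
  ultimately show ?thesis using sc lk unfolding locally_stacked_def by blast
qed

theorem theorem4p15:
  fixes X :: "'a set set" and d :: nat
  assumes "normal_pseudomanifold d X" and "d \<ge> 4"
  shows "stacked_sphere d X \<longleftrightarrow>
           (class_K d X \<and> simply_connected (geom_realization X))"
proof
  assume st: "stacked_sphere d X"
  then have "stacked_sphere (d - 1) (link X {v})" if "v \<in> \<Union>X" for v
    using stacked_vertex_link[of "d - 1" X v] that assms(2) by simp
  then have "class_K d X" using assms unfolding class_K_def by simp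
  moreover have "simply_connected (geom_realization X)"
    using stacked_simply_connected[OF st] assms(2) by simp
  ultimately show "class_K d X \<and> simply_connected (geom_realization X)" ..
next
  assume "class_K d X \<and> simply_connected (geom_realization X)"
  then have ls: "locally_stacked (d - 1) X" and S: "simply_connected (geom_realization X)"
    using class_K_locally_stacked by blast+
  have "cocycles_trivial X"
    by (rule simply_connected_cocycles_trivial[OF locally_stackedD(1,3)[OF ls] S])
  then have "stacked_sphere (Suc (d - 1)) X"
    using stacked_if_locally_stacked[OF ls] assms(2) by simp
  then show "stacked_sphere d X" using assms(2) by simp
qed

end
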